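(* Let $G=(Q,\Delta)$ be a compact quantum group, let $\mathcal{Q}_G\subset Q$ be its canonical Hopf $*$-algebra of matrix coefficients of finite-dimensional representations, and let $\mathrm{Rep}\, G$ be its fusion ring. Then \[ G \text{ irreducible} \implies G \text{ weakly irreducible} \implies G \text{ connected}. \] That is: if $\mathcal{Q}_G$ is a (possibly noncommutative) domain, then $\mathrm{Rep}\, G$ is a domain; and if $\mathrm{Rep}\, G$ is a domain, then $G$ has no nontrivial torsion irreducible representation.
   Context: A compact quantum group is a pair $G=(Q,\Delta)$ where $Q$ is a unital $C^*$-algebra and $\Delta:Q\to Q\otimes Q$ (minimal tensor product) is a coassociative unital $*$-homomorphism such that $(1\otimes Q)\Delta(Q)$ and $(Q\otimes 1)\Delta(Q)$ are dense in $Q\otimes Q$. A finite-dimensional (unitary) representation of $G$ is a unitary $u\in\mathcal{B}(H)\otimes Q$, with $H$ a finite-dimensional Hilbert space, such that $\Delta(u_{\xi,\eta})=\sum_r u_{\xi,e_r}\otimes u_{e_r,\eta}$ for all $\xi,\eta\in H$, where $(e_r)$ is an orthonormal basis of $H$ and $u_{\xi,\eta}=(\xi^*\otimes 1)u(\eta\otimes 1)$ are the matrix coefficients of $u$. Direct sums, tensor products, conjugates (denoted $u^*$ for the conjugate of $u$), irreducibility and equivalence of representations are defined in the usual way; every representation is a direct sum of irreducible (finite-dimensional) ones, uniquely up to equivalence. $\mathcal{Q}_G$ denotes the linear span of all matrix coefficients of finite-dimensional representations of $G$; it is a dense $*$-subalgebra of $Q$ and a cosemisimple Hopf $*$-algebra.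 $\mathrm{Rep}\, G$ denotes the Grothendieck (fusion) ring of finite-dimensional representations of $G$: the free $\mathbb{Z}$-module on equivalence classes of irreducible representations, with multiplication induced by the tensor product. A domain is a nonzero ring, not necessarily commutative, without zero divisors. An irreducible representation $u$ is torsion if only finitely many pairwise non-isomorphic irreducible representations occur as summands in the tensor powers of $u\oplus u^*$. The trivial representation is torsion. Definitions: $G$ is irreducible iff $\mathcal{Q}_G$ is a domain; $G$ is weakly irreducible iff $\mathrm{Rep}\, G$ is a domain; $G$ is connected iff it has no nontrivial torsion irreducible representation. *)

theory Defs
  imports
    "HOL-Analysis.Analysis"
    "HOL-Library.Poly_Mapping"
    "HOL-Algebra.Free_Abelian_Groups"
    "Jordan_Normal_Form.Matrix"
begin

section \<open>Unital C*-algebras and their minimal tensor product\<close>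

text \<open>Unital complex C*-algebras with \<open>1 \<noteq> 0\<close>; being a class over \<open>banach\<close>, completeness is
  included. The real scalar multiplication of the library is the restriction of \<open>scaleC\<close>.\<close>

class cstar_algebra = real_normed_algebra_1 + banach +
  fixes scaleC :: "complex \<Rightarrow> 'a \<Rightarrow> 'a" (infixr \<open>*\<^sub>C\<close> 75)
    and star :: "'a \<Rightarrow> 'a"
  assumes scaleC_add_right: "a *\<^sub>C (x + y) = a *\<^sub>C x + a *\<^sub>C y"
    and scaleC_add_left: "(a + b) *\<^sub>C x = a *\<^sub>C x + b *\<^sub>C x"
    and scaleC_scaleC: "a *\<^sub>C (b *\<^sub>C x) = (a * b) *\<^sub>C x"
    and scaleC_of_real: "complex_of_real r *\<^sub>C x = r *\<^sub>R x"
    and norm_scaleC: "norm (a *\<^sub>C x) = cmod a * norm x"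
    and mult_scaleC_left: "(a *\<^sub>C x) * y = a *\<^sub>C (x * y)"
    and mult_scaleC_right: "x * (a *\<^sub>C y) = a *\<^sub>C (x * y)"
    and star_add: "star (x + y) = star x + star y"
    and star_scaleC: "star (a *\<^sub>C x) = cnj a *\<^sub>C star x"
    and star_mult: "star (x * y) = star y * star x"
    and star_star: "star (star x) = x"
    and cstar_identity: "norm (star x * x) = (norm x)\<^sup>2"

instantiation complex :: cstar_algebra
begin

definition scaleC_complex :: "complex \<Rightarrow> complex \<Rightarrow> complex" where "scaleC_complex a x = a * x"
definition star_complex :: "complex \<Rightarrow> complex" where "star_complex = cnj"

instance
  by standard
    (auto simp: scaleC_complex_def star_complex_def algebra_simps norm_mult power2_eq_square
      scaleR_conv_of_real)

end

global_interpretation cvec: vector_space "scaleC :: complex \<Rightarrow> 'a::cstar_algebra \<Rightarrow> 'a"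
proof
  show "1 *\<^sub>C x = x" for x :: 'a
    using scaleC_of_real[of 1 x] by simp
qed (simp_all add: scaleC_add_right scaleC_add_left scaleC_scaleC)

text \<open>Unital *-homomorphisms; between C*-algebras these are automatically contractive.\<close>

definition star_hom :: "('a::cstar_algebra \<Rightarrow> 'b::cstar_algebra) \<Rightarrow> bool" where
  "star_hom f \<longleftrightarrow>
     (\<forall>x y. f (x + y) = f x + f y) \<and> (\<forall>c x. f (c *\<^sub>C x) = c *\<^sub>C f x) \<and>
     (\<forall>x y. f (x * y) = f x * f y) \<and> f 1 = 1 \<and> (\<forall>x. f (star x) = star (f x))"

text \<open>C*-norms on a *-subalgebra \<open>S\<close>, not required to be complete.\<close>

definition cstar_norm_on :: "'a::cstar_algebra set \<Rightarrow> ('a \<Rightarrow> real) \<Rightarrow> bool" where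
  "cstar_norm_on S p \<longleftrightarrow>
     (\<forall>x\<in>S. 0 \<le> p x) \<and> (\<forall>x\<in>S. p x = 0 \<longleftrightarrow> x = 0) \<and>
     (\<forall>x\<in>S. \<forall>y\<in>S. p (x + y) \<le> p x + p y) \<and> (\<forall>c. \<forall>x\<in>S. p (c *\<^sub>C x) = cmod c * p x) \<and>
     (\<forall>x\<in>S. \<forall>y\<in>S. p (x * y) \<le> p x * p y) \<and> (\<forall>x\<in>S. p (star x * x) = (p x)\<^sup>2)"

text \<open>\<open>min_tensor t\<close> says that the algebra \<open>'t\<close>, with elementary tensors \<open>t a b\<close>, is the minimal
  tensor product of \<open>'a\<close> and \<open>'b\<close>. The condition on independent sets says that the linear map
  from the algebraic tensor product into \<open>'t\<close> is injective, so that the span of the elementary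
  tensors is the algebraic tensor product; \<open>'t\<close> is its completion for the least C*-norm on it
  (which is the spatial norm, by Takesaki's theorem).\<close>

definition min_tensor ::
    "('a::cstar_algebra \<Rightarrow> 'b::cstar_algebra \<Rightarrow> 't::cstar_algebra) \<Rightarrow> bool" where
  "min_tensor t \<longleftrightarrow>
     (\<forall>a a' b. t (a + a') b = t a b + t a' b) \<and> (\<forall>a b b'. t a (b + b') = t a b + t a b') \<and>
     (\<forall>c a b. t (c *\<^sub>C a) b = c *\<^sub>C t a b) \<and> (\<forall>c a b. t a (c *\<^sub>C b) = c *\<^sub>C t a b) \<and>
     (\<forall>a b a' b'. t a b * t a' b' = t (a * a') (b * b')) \<and>
     (\<forall>a b. star (t a b) = t (star a) (star b)) \<and> t 1 1 = 1 \<and>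
     (\<forall>B f. finite B \<longrightarrow> cvec.independent B \<longrightarrow> (\<Sum>b\<in>B. t (f b) b) = 0 \<longrightarrow> (\<forall>b\<in>B. f b = 0)) \<and>
     closure (cvec.span {t a b |a b. True}) = UNIV \<and>
     (\<forall>p. cstar_norm_on (cvec.span {t a b |a b. True}) p \<longrightarrow>
        (\<forall>x\<in>cvec.span {t a b |a b. True}. norm x \<le> p x))"


section \<open>Noncommutative domains\<close>

text \<open>The locale \<open>domain\<close> of HOL-Algebra is commutative.\<close>

definition nc_domain :: "('a, 'm) ring_scheme \<Rightarrow> bool" where
  "nc_domain R \<longleftrightarrow> ring R \<and> \<one>\<^bsub>R\<^esub> \<noteq> \<zero>\<^bsub>R\<^esub> \<and>
     (\<forall>a\<in>carrier R. \<forall>b\<in>carrier R. a \<otimes>\<^bsub>R\<^esub> b = \<zero>\<^bsub>R\<^esub> \<longrightarrow> a = \<zero>\<^bsub>R\<^esub> \<or> b = \<zero>\<^bsub>R\<^esub>)"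


section \<open>Matrices over a C*-algebra\<close>

text \<open>An element of \<open>B(H) \<otimes> Q\<close> with \<open>H = \<complex>\<^sup>n\<close> is an \<open>n \<times> n\<close> matrix over \<open>Q\<close>, namely that of its
  coefficients with respect to the standard basis.\<close>

definition adj :: "'a::cstar_algebra mat \<Rightarrow> 'a mat" where
  "adj u = transpose_mat (map_mat star u)"

text \<open>The image \<open>T \<otimes> 1\<close> of a complex matrix.\<close>

definition cmat :: "complex mat \<Rightarrow> 'a::cstar_algebra mat" where
  "cmat T = map_mat (\<lambda>c. c *\<^sub>C 1) T"

definition dsum :: "'a::cstar_algebra mat \<Rightarrow> 'a mat \<Rightarrow> 'a mat" where
  "dsum u v = diag_block_mat [u, v]"

text \<open>The tensor product \<open>u\<^sub>1\<^sub>3 v\<^sub>2\<^sub>3\<close>; its coefficients are the products \<open>u\<^sub>i\<^sub>j v\<^sub>k\<^sub>l\<close>, in this order.\<close>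

definition tprod :: "'a::cstar_algebra mat \<Rightarrow> 'a mat \<Rightarrow> 'a mat" where
  "tprod u v = mat (dim_row u * dim_row v) (dim_col u * dim_col v)
     (\<lambda>(i, j). u $$ (i div dim_row v, j div dim_col v) * v $$ (i mod dim_row v, j mod dim_col v))"

fun tpow :: "'a::cstar_algebra mat \<Rightarrow> nat \<Rightarrow> 'a mat" where
  "tpow u 0 = 1\<^sub>m 1"
| "tpow u (Suc n) = tprod (tpow u n) u"

text \<open>The conjugate is the matrix of adjoints \<open>u\<^sub>i\<^sub>j\<^sup>*\<close>. It need not be unitary, only equivalent to a
  unitary representation; it is used below only through notions invariant under equivalence.\<close>

definition conjugate_rep :: "'a::cstar_algebra mat \<Rightarrow> 'a mat" where
  "conjugate_rep u = map_mat star u"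

definition equivalent :: "'a::cstar_algebra mat \<Rightarrow> 'a mat \<Rightarrow> bool" where
  "equivalent u v \<longleftrightarrow> dim_row u = dim_row v \<and>
     (\<exists>T\<in>carrier_mat (dim_row v) (dim_row u). invertible_mat T \<and> cmat T * u = v * cmat T)"


section \<open>Compact quantum groups\<close>

text \<open>Besides the comultiplication \<open>\<Delta>\<close>, the data name the algebras \<open>'t = Q \<otimes> Q\<close> (elementary tensors
  \<open>t\<close>) and \<open>'w = Q \<otimes> Q \<otimes> Q\<close>, the latter identified with both \<open>(Q \<otimes> Q) \<otimes> Q\<close> (via \<open>tl\<close>) and
  \<open>Q \<otimes> (Q \<otimes> Q)\<close> (via \<open>tr\<close>). In the coassociativity axiom \<open>D\<^sub>1 = \<Delta> \<otimes> id\<close> and \<open>D\<^sub>2 = id \<otimes> \<Delta>\<close>: a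
  *-homomorphism is continuous, so it is determined by its values on elementary tensors.\<close>

locale compact_quantum_group =
  fixes t :: "'q::cstar_algebra \<Rightarrow> 'q \<Rightarrow> 't::cstar_algebra"
    and tl :: "'t \<Rightarrow> 'q \<Rightarrow> 'w::cstar_algebra"
    and tr :: "'q \<Rightarrow> 't \<Rightarrow> 'w"
    and \<Delta> :: "'q \<Rightarrow> 't"
  assumes tensor: "min_tensor t" "min_tensor tl" "min_tensor tr"
    and tensor_assoc: "tl (t a b) c = tr a (t b c)"
    and comult_hom: "star_hom \<Delta>"
    and coassoc: "\<exists>D\<^sub>1 D\<^sub>2. star_hom D\<^sub>1 \<and> star_hom D\<^sub>2 \<and>
       (\<forall>a b. D\<^sub>1 (t a b) = tl (\<Delta> a) b) \<and> (\<forall>a b. D\<^sub>2 (t a b) = tr a (\<Delta> b)) \<and>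
       D\<^sub>1 \<circ> \<Delta> = D\<^sub>2 \<circ> \<Delta>"
    and dense_right: "closure (cvec.span {t 1 a * \<Delta> b |a b. True}) = UNIV"
    and dense_left: "closure (cvec.span {t a 1 * \<Delta> b |a b. True}) = UNIV"

text \<open>The remaining notions depend on \<open>t\<close> and \<open>\<Delta>\<close> only.\<close>

context
  fixes t :: "'q::cstar_algebra \<Rightarrow> 'q \<Rightarrow> 't::cstar_algebra"
    and \<Delta> :: "'q \<Rightarrow> 't"
begin

definition comultiplicative :: "'q mat \<Rightarrow> bool" where
  "comultiplicative u \<longleftrightarrow> square_mat u \<and>
     (\<forall>i<dim_row u. \<forall>j<dim_row u.
        \<Delta> (u $$ (i, j)) = (\<Sum>r<dim_row u. t (u $$ (i, r)) (u $$ (r, j))))"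

definition representation :: "'q mat \<Rightarrow> bool" where
  "representation u \<longleftrightarrow> comultiplicative u \<and>
     u * adj u = 1\<^sub>m (dim_row u) \<and> adj u * u = 1\<^sub>m (dim_row u)"

text \<open>Irreducibility: \<open>H \<noteq> 0\<close> and only \<open>0\<close> and \<open>H\<close> are invariant subspaces. Subspaces of \<open>H\<close> are given
  by their orthogonal projections \<open>P\<close>, and invariance of \<open>P H\<close> reads \<open>u (P \<otimes> 1) = (P \<otimes> 1) u (P \<otimes> 1)\<close>.\<close>

definition irreducible_rep :: "'q mat \<Rightarrow> bool" where
  "irreducible_rep u \<longleftrightarrow> representation u \<and> 0 < dim_row u \<and>
     (\<forall>P\<in>carrier_mat (dim_row u) (dim_row u).
        P * P = P \<longrightarrow> adj P = P \<longrightarrow> u * cmat P = cmat P * u * cmat P \<longrightarrow>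
        P = 0\<^sub>m (dim_row u) (dim_row u) \<or> P = 1\<^sub>m (dim_row u))"

definition irr_class :: "'q mat \<Rightarrow> 'q mat set" where
  "irr_class u = {v. irreducible_rep v \<and> equivalent u v}"

definition irr_classes :: "'q mat set set" where
  "irr_classes = irr_class ` {u. irreducible_rep u}"

definition summand :: "'q mat \<Rightarrow> 'q mat \<Rightarrow> bool" where
  "summand v w \<longleftrightarrow> (\<exists>w'. comultiplicative w' \<and> equivalent w (dsum v w'))"

definition coefficient_algebra :: "'q set" where
  "coefficient_algebra =
     cvec.span {u $$ (i, j) |u i j. representation u \<and> i < dim_row u \<and> j < dim_row u}"

definition coefficient_ring :: "'q ring" where
  "coefficient_ring = \<lparr>carrier = coefficient_algebra, mult = (*), one = 1, zero = 0, add = (+)\<rparr>"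

text \<open>The class in the fusion ring of a representation \<open>w\<close>: the sum of the classes of the irreducible
  representations in a decomposition of \<open>w\<close>, which is unique up to order and equivalence.\<close>

definition fusion_class :: "'q mat \<Rightarrow> ('q mat set \<Rightarrow>\<^sub>0 int)" where
  "fusion_class w = (THE x. \<exists>vs. (\<forall>v\<in>set vs. irreducible_rep v) \<and>
     equivalent w (diag_block_mat vs) \<and> x = (\<Sum>v\<leftarrow>vs. frag_of (irr_class v)))"

text \<open>The product is the \<open>\<int>\<close>-bilinear extension of \<open>[u] [v] = [u \<otimes> v]\<close>, where \<open>u\<close>, \<open>v\<close> are
  representatives of their classes.\<close>

definition fusion_mult ::
    "('q mat set \<Rightarrow>\<^sub>0 int) \<Rightarrow> ('q mat set \<Rightarrow>\<^sub>0 int) \<Rightarrow> ('q mat set \<Rightarrow>\<^sub>0 int)" where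
  "fusion_mult x y =
     frag_extend (\<lambda>\<alpha>. frag_extend (\<lambda>\<beta>. fusion_class (tprod (SOME u. u \<in> \<alpha>) (SOME v. v \<in> \<beta>))) y) x"

definition fusion_ring :: "('q mat set \<Rightarrow>\<^sub>0 int) ring" where
  "fusion_ring = \<lparr>carrier = carrier (free_Abelian_group irr_classes), mult = fusion_mult,
     one = frag_of (irr_class (1\<^sub>m 1)), zero = 0, add = (+)\<rparr>"

definition torsion_rep :: "'q mat \<Rightarrow> bool" where
  "torsion_rep u \<longleftrightarrow> irreducible_rep u \<and>
     finite {irr_class v |v. irreducible_rep v \<and> (\<exists>n. summand v (tpow (dsum u (conjugate_rep u)) n))}"

definition irreducible_cqg :: bool where
  "irreducible_cqg \<longleftrightarrow> nc_domain coefficient_ring"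

definition weakly_irreducible_cqg :: bool where
  "weakly_irreducible_cqg \<longleftrightarrow> nc_domain fusion_ring"

definition connected_cqg :: bool where
  "connected_cqg \<longleftrightarrow> (\<forall>u. torsion_rep u \<longrightarrow> equivalent u (1\<^sub>m 1))"

end

end

(*
Characters of compact quantum groups embed the fusion ring into the algebra of matrix coefficients:
they are multiplicative, and those of inequivalent irreducible representations are orthonormal for
the Haar state. Hence zero divisors of the fusion ring yield zero divisors among the coefficients.
If u is torsion, the powers of its class x span a group of finite rank, so f(x) = 0 for an integer
polynomial f of minimal degree. Applying the dimension homomorphism shows that d = dim u is a root
of f; cancelling the factor x - d in a domain gives x = d, so u is trivial.

The fusion product makes sense because unitary representations are completely reducible. An invariant
subspace has an invariant complement since a comultiplicative matrix d with d d* = 1 satisfies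
d* d = 1, a consequence of the invariance of the Haar state and of the cancellation property.
The Haar state needs product states on the minimal tensor product. They are obtained as extensions of
states whose first marginal is pure, which are product states; that the second marginal can be
prescribed follows from the independence of commuting elements a (x) 1 and 1 (x) b.
*)

theory Submission
  imports Defs "Jordan_Normal_Form.Spectral_Radius"
begin

section \<open>Positive elements of C*-algebras\<close>

text \<open>Over a noncommutative algebra a square matrix with a one-sided inverse need not be
  invertible. This is the obstacle to complete reducibility: for a unitary \<open>u\<close> and an
  invariant subspace with complementary projection \<open>P\<close>, the matrix
  \<open>d = P u\<close> satisfies \<open>d adj d = P\<close> for free, whereas
  \<open>adj d d = P\<close> is the commutation of \<open>P\<close> with \<open>u\<close> that is
  wanted. The Haar state is not known to be faithful, so a positive element that it kills cannot
  simply be discarded; such elements are removed by Cauchy-Schwarz followed by a density condition.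
  The conjugate of a representation need not be unitary, while fusion classes are taken of unitary
  ones. Torsion is therefore used only through the powers of \<open>u\<close> itself, which are
  summands of the powers of \<open>u \<oplus> conjugate\<close>. Uniqueness of decompositions and
  the axioms of the fusion ring are pulled back along the injective character map. The C*-algebra
  facts rest on roots obtained by iteration and on a norm criterion for positivity, without spectra
  or Hilbert space representations.\<close>

lemma star_zero [simp]: "star (0::'a::cstar_algebra) = 0"
  by (metis add_cancel_right_right star_add)

lemma star_minus [simp]: "star (- x) = - star (x::'a::cstar_algebra)"
  by (metis add.right_inverse minus_unique star_add star_zero)

lemma star_diff: "star (x - y) = star x - star (y::'a::cstar_algebra)"
  by (metis diff_conv_add_uminus star_add star_minus)

lemma star_one [simp]: "star (1::'a::cstar_algebra) = 1"
  by (metis mult.right_neutral star_mult star_star)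

lemma star_scaleR [simp]: "star (r *\<^sub>R x) = r *\<^sub>R star (x::'a::cstar_algebra)"
  by (metis complex_cnj_complex_of_real scaleC_of_real star_scaleC)

lemma star_sum: "star (sum f A) = (\<Sum>i\<in>A. star (f i :: 'a::cstar_algebra))"
  by (induction A rule: infinite_finite_induct) (auto simp: star_add)

lemma norm_star [simp]: "norm (star x) = norm (x::'a::cstar_algebra)"
proof -
  have le: "norm y \<le> norm (star y)" for y :: 'a
  proof (cases "norm y = 0")
    case False
    have "(norm y)\<^sup>2 \<le> norm (star y) * norm y"
      by (metis cstar_identity norm_mult_ineq)
    then show ?thesis using False by (simp add: power2_eq_square)
  qed simp
  show ?thesis using le[of x] le[of "star x"] by (simp add: star_star)
qed

lemma bounded_linear_star: "bounded_linear (star :: 'a::cstar_algebra \<Rightarrow> 'a)"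
  by (rule bounded_linear_intro[where K = 1]) (auto simp: star_add)

lemma bounded_linear_scaleC: "bounded_linear (\<lambda>x::'a::cstar_algebra. c *\<^sub>C x)"
proof (rule bounded_linear_intro[where K = "cmod c"])
  show "c *\<^sub>C (r *\<^sub>R x) = r *\<^sub>R (c *\<^sub>C x)" for r :: real and x :: 'a
    by (metis cvec.scale_left_commute scaleC_of_real)
qed (auto simp: scaleC_add_right norm_scaleC)

lemma scaleC_ii_ii: "\<i> *\<^sub>C (\<i> *\<^sub>C x) = - (x::'a::cstar_algebra)"
  by (simp add: scaleC_scaleC)

lemma norm_mult_self: "star a = a \<Longrightarrow> norm (a * a) = (norm (a::'a::cstar_algebra))\<^sup>2"
  by (metis cstar_identity)

text \<open>The iteration converges to \<open>1 - sqrt (1 - z)\<close>; it is dominated by the scalar iteration for \<open>z = 1\<close>.\<close>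

fun sqrt_iter :: "'a::real_normed_algebra_1 \<Rightarrow> nat \<Rightarrow> 'a" where
  "sqrt_iter z 0 = 0"
| "sqrt_iter z (Suc n) = (1/2) *\<^sub>R (z + sqrt_iter z n * sqrt_iter z n)"

lemma sqrt_iter_one: "0 \<le> sqrt_iter (1::real) n \<and> sqrt_iter (1::real) n \<le> 1"
  by (induction n) (auto simp: mult_le_one)

lemma sqrt_iter_one_mono: "sqrt_iter (1::real) n \<le> sqrt_iter 1 (Suc n)"
proof -
  have "0 \<le> (1 - sqrt_iter (1::real) n)\<^sup>2" by simp
  then show ?thesis by (simp add: power2_eq_square algebra_simps)
qed

lemma sqrt_iter_commute: "c * z = z * c \<Longrightarrow> c * sqrt_iter z n = sqrt_iter z n * c"
proof (induction n)
  case (Suc n)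
  then have "c * (sqrt_iter z n * sqrt_iter z n) = sqrt_iter z n * sqrt_iter z n * c"
    by (metis mult.assoc)
  then show ?case using Suc by (simp add: algebra_simps)
qed simp

lemma norm_sqrt_iter_le: "norm z \<le> 1 \<Longrightarrow> norm (sqrt_iter z n) \<le> sqrt_iter (1::real) n"
proof (induction n)
  case (Suc n)
  have "norm (z + sqrt_iter z n * sqrt_iter z n) \<le> norm z + norm (sqrt_iter z n) * norm (sqrt_iter z n)"
    by (meson add_left_mono norm_mult_ineq norm_triangle_ineq order_trans)
  also have "\<dots> \<le> 1 + sqrt_iter (1::real) n * sqrt_iter 1 n"
    using Suc by (intro add_mono mult_mono) (auto simp: sqrt_iter_one)
  finally show ?case by simp
qed simp

text \<open>Consecutive iterates commute, so their differences factor like a difference of squares,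
  and each factor is majorized by its scalar counterpart.\<close>

lemma norm_sqrt_iter_diff_le:
  "norm z \<le> 1 \<Longrightarrow>
    norm (sqrt_iter z (Suc n) - sqrt_iter z n) \<le> sqrt_iter (1::real) (Suc n) - sqrt_iter 1 n"
proof (induction n)
  case (Suc n)
  let ?y = "sqrt_iter z n" and ?y' = "sqrt_iter z (Suc n)"
  let ?r = "sqrt_iter (1::real) n" and ?r' = "sqrt_iter (1::real) (Suc n)"
  have com: "?y * ?y' = ?y' * ?y"
    by (metis sqrt_iter_commute)
  have eq: "sqrt_iter z (Suc (Suc n)) - ?y' = (1/2) *\<^sub>R ((?y' - ?y) * (?y' + ?y))"
  proof -
    have "(?y' - ?y) * (?y' + ?y) = ?y' * ?y' - ?y * ?y"
      using com by (simp only: ring_distribs) (simp add: algebra_simps del: sqrt_iter.simps(2))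
    moreover have "sqrt_iter z (Suc (Suc n)) - ?y' = (1/2) *\<^sub>R (z + ?y' * ?y') - (1/2) *\<^sub>R (z + ?y * ?y)"
      by (simp only: sqrt_iter.simps)
    ultimately show ?thesis by (simp only: scaleR_right_diff_distrib[symmetric]) simp
  qed
  have "norm ((?y' - ?y) * (?y' + ?y)) \<le> norm (?y' - ?y) * norm (?y' + ?y)"
    by (rule norm_mult_ineq)
  also have "\<dots> \<le> (?r' - ?r) * (?r' + ?r)"
  proof (rule mult_mono)
    show "norm (?y' + ?y) \<le> ?r' + ?r"
      using norm_sqrt_iter_le[OF Suc.prems] by (meson add_mono norm_triangle_ineq order_trans)
    show "0 \<le> ?r' - ?r" using sqrt_iter_one_mono[of n] by simp
  qed (use Suc in auto)
  finally have "norm (sqrt_iter z (Suc (Suc n)) - ?y') \<le> (1/2) * ((?r' - ?r) * (?r' + ?r))"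
    unfolding eq by simp
  also have "\<dots> = sqrt_iter (1::real) (Suc (Suc n)) - ?r'"
    by (simp add: algebra_simps power2_eq_square)
  finally show ?case .
qed simp

text \<open>The scalar sequence is monotone and bounded, and its Cauchy estimate passes to the
  iterates by telescoping. The last clause stands in for the root lying in the closed subalgebra
  generated by \<open>z\<close>.\<close>

lemma sqrt_one_minus:
  fixes z :: "'a::cstar_algebra"
  assumes "star z = z" "norm z \<le> 1"
  obtains y where "star y = y" "norm y \<le> 1" "(1 - y) * (1 - y) = 1 - z"
    "\<And>c. c * z = z * c \<Longrightarrow> c * y = y * c"
proof -
  let ?r = "sqrt_iter (1::real)" and ?y = "sqrt_iter z"
  have "convergent ?r"
  proof (rule Bseq_monoseq_convergent)
    show "Bseq ?r" by (rule BseqI'[of _ 1]) (use sqrt_iter_one in auto)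
    show "monoseq ?r" by (rule mono_SucI1) (use sqrt_iter_one_mono in blast)
  qed
  then have "Cauchy ?r" by (rule convergent_Cauchy)
  have bound: "norm (?y (n + k) - ?y n) \<le> ?r (n + k) - ?r n" for n k
  proof (induction k)
    case (Suc k)
    have "norm (?y (n + Suc k) - ?y n) \<le>
        norm (?y (Suc (n + k)) - ?y (n + k)) + norm (?y (n + k) - ?y n)"
      by (metis add_Suc_right norm_diff_triangle_ineq diff_add_cancel norm_triangle_ineq
        add_diff_eq)
    then show ?case
      using Suc norm_sqrt_iter_diff_le[OF assms(2), of "n + k"]
      by (simp del: sqrt_iter.simps(2))
  qed simp
  have "Cauchy ?y"
  proof (rule CauchyI')
    fix e :: real assume "e > 0"
    with \<open>Cauchy ?r\<close> obtain M where M: "\<And>m n. m \<ge> M \<Longrightarrow> n \<ge> M \<Longrightarrow> norm (?r m - ?r n) < e"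
      by (meson CauchyD)
    have "norm (?y m - ?y n) < e" if "m \<ge> M" "n > m" for m n
    proof -
      obtain k where k: "n = m + k" using \<open>n > m\<close> less_imp_add_positive by blast
      have "norm (?y n - ?y m) \<le> ?r n - ?r m" using bound[of m k] k by simp
      also have "\<dots> < e" using M[of n m] that by auto
      finally show ?thesis by (simp add: norm_minus_commute)
    qed
    then show "\<exists>M. \<forall>m\<ge>M. \<forall>n>m. dist (?y m) (?y n) < e" by (auto simp: dist_norm)
  qed
  then obtain y where y: "?y \<longlonglongrightarrow> y"
    using Cauchy_convergent convergent_def by blast
  have "star y = y"
  proof -
    have "star (?y n) = ?y n" for n
      by (induction n) (auto simp: star_add star_mult assms)
    moreover have "(\<lambda>n. star (?y n)) \<longlonglongrightarrow> star y"
      using bounded_linear.tendsto[OF bounded_linear_star y] .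
    ultimately show ?thesis using y LIMSEQ_unique by auto
  qed
  moreover have "norm y \<le> 1"
    using tendsto_norm[OF y]
    by (rule LIMSEQ_le_const2) (use norm_sqrt_iter_le[OF assms(2)] sqrt_iter_one order_trans in blast)
  moreover have "(1 - y) * (1 - y) = 1 - z"
  proof -
    have "(\<lambda>n. ?y (Suc n)) \<longlonglongrightarrow> (1/2) *\<^sub>R (z + y * y)"
      unfolding sqrt_iter.simps by (intro tendsto_intros y)
    then have "y = (1/2) *\<^sub>R (z + y * y)" using LIMSEQ_Suc[OF y] LIMSEQ_unique by blast
    then have "2 *\<^sub>R y = z + y * y" by (metis (no_types, lifting) scaleR_half_double
      scaleR_2 add.commute scaleR_right_distrib)
    then show ?thesis by (simp add: algebra_simps scaleR_2)
  qed
  moreover have "c * y = y * c" if "c * z = z * c" for c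
  proof -
    have "(\<lambda>n. c * ?y n) \<longlonglongrightarrow> c * y" "(\<lambda>n. ?y n * c) \<longlonglongrightarrow> y * c"
      by (intro tendsto_intros y)+
    then show ?thesis using sqrt_iter_commute[OF that] LIMSEQ_unique by auto
  qed
  ultimately show ?thesis using that by blast
qed

text \<open>Squares of self-adjoint elements make sense without spectra. That every
  \<open>star x * x\<close> is of this form is the hard part,
  \<open>pos_star_mult_self\<close>.\<close>

definition pos :: "'a::cstar_algebra \<Rightarrow> bool" where
  "pos x \<longleftrightarrow> (\<exists>s. star s = s \<and> x = s * s)"

lemma pos_star: "pos x \<Longrightarrow> star x = x"
  unfolding pos_def by (auto simp: star_mult)

text \<open>Division by \<open>t\<close> puts \<open>1 - a/t\<close> into the unit ball, where
  \<open>sqrt_one_minus\<close> extracts the root. Together with \<open>pos_normD\<close> this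
  describes the cone by a norm inequality which, unlike being a square, is visibly stable under sums
  and limits.\<close>

lemma posI:
  fixes a :: "'a::cstar_algebra"
  assumes "star a = a" "norm (t *\<^sub>R 1 - a) \<le> t"
  shows "pos a"
proof (cases "t > 0")
  case True
  let ?z = "(1/t) *\<^sub>R (t *\<^sub>R 1 - a)"
  have "star ?z = ?z" using assms by (simp add: star_diff)
  moreover have "norm ?z \<le> 1" using assms True by simp
  ultimately obtain y where y: "star y = y" "(1 - y) * (1 - y) = 1 - ?z"
    by (rule sqrt_one_minus) auto
  have "1 - ?z = (1/t) *\<^sub>R a" using True by (simp add: algebra_simps)
  then have "(sqrt t *\<^sub>R (1 - y)) * (sqrt t *\<^sub>R (1 - y)) = a"
    using y True by (simp add: real_sqrt_mult_self abs_of_pos)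
  then show ?thesis unfolding pos_def
    using y by (intro exI[of _ "sqrt t *\<^sub>R (1 - y)"]) (auto simp: star_diff)
next
  case False
  then have "t = 0" using assms(2) norm_ge_zero[of "t *\<^sub>R 1 - a"] by linarith
  then have "a = 0" using assms by simp
  then show ?thesis unfolding pos_def by (auto intro: exI[of _ 0])
qed

text \<open>For \<open>u = r + i y\<close> the product \<open>star u * u\<close> is the scalar
  \<open>l\<close>, so \<open>u\<close> has norm sqrt l and its real part \<open>r\<close> cannot
  exceed it. This does the work of a joint spectrum of commuting elements.\<close>

lemma norm_re_part_le:
  fixes r y :: "'a::cstar_algebra"
  assumes "star r = r" "star y = y" "r * y = y * r" "r * r + y * y = l *\<^sub>R 1" "l \<ge> 0"
  shows "(norm r)\<^sup>2 \<le> l"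
proof -
  let ?u = "r + \<i> *\<^sub>C y"
  have su: "star ?u = r - \<i> *\<^sub>C y" using assms by (simp add: star_add star_scaleC)
  have "star ?u * ?u = r * r + y * y"
    unfolding su using assms(3)
    by (simp add: algebra_simps mult_scaleC_left mult_scaleC_right scaleC_scaleC)
  then have "(norm ?u)\<^sup>2 = l" using cstar_identity[of ?u] assms by simp
  moreover have "2 *\<^sub>R r = ?u + star ?u" unfolding su by (simp add: scaleR_2)
  then have "2 * norm r \<le> norm ?u + norm (star ?u)" by (metis norm_scaleR norm_triangle_ineq
    abs_numeral)
  then have "norm r \<le> norm ?u" by simp
  ultimately show ?thesis by (metis norm_ge_zero power_mono)
qed

text \<open>The root \<open>k\<close> of \<open>1 - a/t\<close> commutes with the root
  \<open>s\<close> of \<open>a\<close>, and \<open>k k + s s / t = 1\<close>; so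
  \<open>norm_re_part_le\<close> bounds \<open>k\<close>, hence \<open>1 - a/t = k k\<close>, by
  1.\<close>

lemma pos_normD:
  fixes a :: "'a::cstar_algebra"
  assumes "pos a" "norm a \<le> t"
  shows "norm (t *\<^sub>R 1 - a) \<le> t"
proof (cases "t = 0")
  case False
  then have t: "t > 0" using assms norm_ge_zero[of a] by linarith
  obtain s where s: "star s = s" "a = s * s" using assms unfolding pos_def by auto
  let ?z = "(1/t) *\<^sub>R a"
  have "star ?z = ?z" using pos_star[OF assms(1)] by simp
  moreover have "norm ?z \<le> 1" using assms t by simp
  ultimately obtain y where y: "star y = y" "(1 - y) * (1 - y) = 1 - ?z"
    "\<And>c. c * ?z = ?z * c \<Longrightarrow> c * y = y * c"
    by (rule sqrt_one_minus) auto
  have "s * ?z = ?z * s" using s by (simp add: mult.assoc)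
  then have com: "s * y = y * s" using y by blast
  let ?k = "1 - y" and ?s = "(1 / sqrt t) *\<^sub>R s"
  have "(norm ?k)\<^sup>2 \<le> 1"
  proof (rule norm_re_part_le)
    show "star ?k = ?k" "star ?s = ?s" using y s by (auto simp: star_diff)
    show "?k * ?s = ?s * ?k" using com by (simp add: algebra_simps)
    show "?k * ?k + ?s * ?s = 1 *\<^sub>R 1" using y s t by (simp add: real_sqrt_mult_self abs_of_pos)
  qed simp
  then have "norm (1 - ?z) \<le> 1" using y norm_mult_self[of ?k] by (simp add: star_diff)
  moreover have "t *\<^sub>R 1 - a = t *\<^sub>R (1 - ?z)" using t by (simp add: algebra_simps)
  ultimately show ?thesis using t by simp
qed (use assms in auto)

lemma pos_zero [simp]: "pos 0" and pos_one [simp]: "pos 1"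
  unfolding pos_def by (auto intro: exI[of _ 0] exI[of _ 1])

text \<open>In the norm criterion the bounds \<open>norm a\<close> and \<open>norm b\<close> add up,
  so additivity is the triangle inequality.\<close>

lemma pos_add: "pos a \<Longrightarrow> pos b \<Longrightarrow> pos (a + b)"
proof (rule posI)
  assume *: "pos a" "pos b"
  show "star (a + b) = a + b" using * by (simp add: star_add pos_star)
  have "norm ((norm a *\<^sub>R 1 - a) + (norm b *\<^sub>R 1 - b)) \<le> norm a + norm b"
    using * by (meson add_mono norm_triangle_ineq order_trans pos_normD order_refl)
  then show "norm ((norm a + norm b) *\<^sub>R 1 - (a + b)) \<le> norm a + norm b"
    by (simp add: algebra_simps)
qed

lemma pos_scaleR: "pos a \<Longrightarrow> c \<ge> 0 \<Longrightarrow> pos (c *\<^sub>R a)"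
  unfolding pos_def
proof (elim exE conjE)
  fix s assume "c \<ge> 0" "star s = s" "a = s * s"
  then show "\<exists>s. star s = s \<and> c *\<^sub>R a = s * s"
    by (intro exI[of _ "sqrt c *\<^sub>R s"]) (auto simp: real_sqrt_mult_self)
qed

lemma pos_norm_minus: "star a = a \<Longrightarrow> pos (norm a *\<^sub>R 1 - a)"
  by (rule posI[where t = "norm a"]) (auto simp: star_diff)

lemma pos_norm_plus: "star a = a \<Longrightarrow> pos (norm a *\<^sub>R 1 + a)"
  using pos_norm_minus[of "- a"] by simp

lemma pos_sqrt:
  assumes "pos a"
  obtains s where "pos s" "s * s = a" "\<And>c. c * a = a * c \<Longrightarrow> c * s = s * c"
proof -
  \<comment> \<open>The added 1 keeps \<open>t\<close> invertible when \<open>a = 0\<close>.\<close>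
  define t where "t = norm a + 1"
  have t: "t > 0" "norm a \<le> t" unfolding t_def by (auto simp: add_nonneg_pos)
  let ?z = "(1/t) *\<^sub>R (t *\<^sub>R 1 - a)"
  have "star ?z = ?z" using pos_star[OF assms(1)] by (simp add: star_diff)
  moreover have "norm ?z \<le> 1" using pos_normD[OF assms t(2)] t by simp
  ultimately obtain y where y: "star y = y" "norm y \<le> 1" "(1 - y) * (1 - y) = 1 - ?z"
    "\<And>c. c * ?z = ?z * c \<Longrightarrow> c * y = y * c"
    by (rule sqrt_one_minus) auto
  have z: "1 - ?z = (1/t) *\<^sub>R a" using t by (simp add: algebra_simps)
  let ?s = "sqrt t *\<^sub>R (1 - y)"
  have "pos (1 - y)" by (rule posI[where t = 1]) (use y in \<open>auto simp: star_diff\<close>)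
  then have "pos ?s" using t by (intro pos_scaleR) auto
  moreover have "?s * ?s = a" using y z t by (simp add: real_sqrt_mult_self abs_of_pos)
  moreover have "c * ?s = ?s * c" if "c * a = a * c" for c
    using y(4)[of c] that by (simp add: algebra_simps)
  ultimately show ?thesis using that by blast
qed

lemma pos_scaleR_one_iff: "pos (l *\<^sub>R (1::'a::cstar_algebra)) \<longleftrightarrow> l \<ge> 0"
proof
  assume "pos (l *\<^sub>R (1::'a))"
  then have "norm (\<bar>l\<bar> *\<^sub>R 1 - l *\<^sub>R (1::'a)) \<le> \<bar>l\<bar>" by (rule pos_normD) simp
  then show "l \<ge> 0" by (simp only: scaleR_left_diff_distrib[symmetric] norm_scaleR norm_one) simp
qed (simp add: pos_scaleR)

text \<open>The roots of \<open>a\<close> and of \<open>l - a\<close> commute and their squares add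
  up to \<open>l\<close>, so \<open>norm_re_part_le\<close> applies.\<close>

lemma norm_le_of_pos:
  fixes a :: "'a::cstar_algebra"
  assumes "pos a" "pos (l *\<^sub>R 1 - a)"
  shows "norm a \<le> l"
proof -
  have "l \<ge> 0" using pos_add[OF assms] by (simp add: pos_scaleR_one_iff)
  obtain r where r: "pos r" "r * r = a" "\<And>c. c * a = a * c \<Longrightarrow> c * r = r * c"
    using pos_sqrt[OF assms(1)] by blast
  obtain y where y: "pos y" "y * y = l *\<^sub>R 1 - a"
    "\<And>c. c * (l *\<^sub>R 1 - a) = (l *\<^sub>R 1 - a) * c \<Longrightarrow> c * y = y * c"
    using pos_sqrt[OF assms(2)] by blast
  have "a * y = y * a" by (rule y(3)) (simp add: algebra_simps)
  then have "y * r = r * y" by (intro r(3)) simp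
  then have "(norm r)\<^sup>2 \<le> l"
    by (intro norm_re_part_le[OF pos_star[OF r(1)] pos_star[OF y(1)]])
      (simp_all add: r(2) y(2) \<open>l \<ge> 0\<close>)
  then show ?thesis using norm_mult_self[OF pos_star[OF r(1)]] r(2) by simp
qed

lemma pos_antisym: "pos a \<Longrightarrow> pos (- a) \<Longrightarrow> a = 0"
  using norm_le_of_pos[of a 0] by simp

lemma self_adjoint_cube_zero:
  assumes "star (n::'a::cstar_algebra) = n" "n * n * n = 0" shows "n = 0"
proof -
  have "norm ((n * n) * (n * n)) = (norm (n * n))\<^sup>2"
    by (rule norm_mult_self) (simp add: star_mult assms)
  also have "(n * n) * (n * n) = 0" using assms by (simp add: mult.assoc[symmetric])
  finally show ?thesis using norm_mult_self[OF assms(1)] by simp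
qed

text \<open>The usual decomposition into positive and negative parts; positivity is stated for their cubes
  only, as that is immediate from \<open>p\<^sup>2 = |a| p\<close>.\<close>

lemma jordan_decomposition:
  assumes "star a = a"
  obtains p n where "star p = p" "star n = n" "a = p - n" "p * n = 0" "n * p = 0"
    "pos (p * p * p)" "pos (n * n * n)" "pos (p + n)"
proof -
  have "pos (a * a)" unfolding pos_def using assms by blast
  then obtain s where s: "pos s" "s * s = a * a" "\<And>c. c * (a * a) = (a * a) * c \<Longrightarrow> c * s = s * c"
    using pos_sqrt by blast
  have com: "a * s = s * a" by (rule s(3)) (simp add: mult.assoc)
  \<comment> \<open>\<open>s\<close> is the absolute value of \<open>a\<close>. Its root
    \<open>q\<close> turns \<open>p * p * p = s * p * p\<close> into the square of the self-adjoint
    \<open>q * p\<close>.\<close>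
  obtain q where q: "pos q" "q * q = s" "\<And>c. c * s = s * c \<Longrightarrow> c * q = q * c"
    using pos_sqrt[OF s(1)] by blast
  have cube: "pos (p * p * p)" if p: "star p = p" "p * p = s * p" "p * s = s * p" for p
  proof -
    have pq: "p * q = q * p" using q(3) p(3) by blast
    have "p * p * p = (q * p) * (q * p)"
      by (metis mult.assoc p(2,3) pq q(2))
    moreover have "star (q * p) = q * p" using p pos_star[OF q(1)] pq by (simp add: star_mult)
    ultimately show ?thesis unfolding pos_def by metis
  qed
  define p n where "p = (1/2) *\<^sub>R (s + a)" and "n = (1/2) *\<^sub>R (s - a)"
  have st: "star p = p" "star n = n"
    unfolding p_def n_def using assms pos_star[OF s(1)] by (auto simp: star_add star_diff)
  have an: "a = p - n" "p + n = s" unfolding p_def n_def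
    by (auto simp: algebra_simps simp flip: scaleR_left_distrib)
  have "p * n = 0" "n * p = 0"
    unfolding p_def n_def using s(2) com by (auto simp: algebra_simps)
  moreover from this an have "p * p = s * p" "n * n = s * n" "p * s = s * p" "n * s = s * n"
    by (auto simp: distrib_left distrib_right simp flip: an(2))
  ultimately show ?thesis
    using that[of p n] st an cube s(1) by auto
qed

lemma scaleC_re_im: "\<exists>p q. star p = p \<and> star q = q \<and> (x::'a::cstar_algebra) = p + \<i> *\<^sub>C q"
proof (intro exI conjI)
  let ?p = "(1/2) *\<^sub>R (x + star x)" and ?q = "- (\<i> *\<^sub>C ((1/2) *\<^sub>R (x - star x)))"
  show "star ?p = ?p" by (simp add: star_add star_star add.commute)
  have "star ?q = - (cnj \<i> *\<^sub>C star ((1/2) *\<^sub>R (x - star x)))"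
    by (simp only: star_minus star_scaleC)
  also have "\<dots> = ?q"
    by (simp add: star_diff star_star algebra_simps)
  finally show "star ?q = ?q" .
  have "\<i> *\<^sub>C ?q = (1/2) *\<^sub>R (x - star x)"
    by (simp only: cvec.scale_minus_right scaleC_ii_ii minus_minus)
  then show "x = ?p + \<i> *\<^sub>C ?q"
    by (simp add: algebra_simps flip: scaleR_left_distrib)
qed

text \<open>The argument of Kelley and Vaught.\<close>

theorem pos_star_mult_self: "pos (star x * (x::'a::cstar_algebra))"
proof -
  let ?a = "star x * x"
  have "star ?a = ?a" by (simp add: star_mult star_star)
  then obtain p n where pn: "star p = p" "star n = n" "?a = p - n" "p * n = 0" "n * p = 0"
    "pos (p * p * p)" "pos (n * n * n)" "pos (p + n)"
    using jordan_decomposition by blast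
  \<comment> \<open>Cutting down by the negative part makes \<open>star y * y\<close> equal to
    \<open>- (n * n * n)\<close>; the aim is \<open>n = 0\<close>.\<close>
  define y where "y = x * n"
  define b c where "b = star y * y" and "c = y * star y"
  have "b = n * (star x * x) * n" unfolding b_def y_def using pn(2) by (simp add: star_mult mult.assoc)
  then have b: "b = - (n * n * n)" unfolding pn(3) using pn(5) by (simp add: algebra_simps)
  obtain P Q where PQ: "star P = P" "star Q = Q" "y = P + \<i> *\<^sub>C Q" using scaleC_re_im by blast
  \<comment> \<open>The cross terms cancel in \<open>star y * y + y * star y\<close>; since
    \<open>b\<close> is negative, \<open>c\<close> comes out positive.\<close>
  have "b + c = 2 *\<^sub>R (P * P) + 2 *\<^sub>R (Q * Q)"
    unfolding b_def c_def PQ(3) using PQ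
    by (simp add: algebra_simps star_add star_scaleC mult_scaleC_left mult_scaleC_right scaleC_scaleC scaleR_2)
  then have "c = 2 *\<^sub>R (P * P) + 2 *\<^sub>R (Q * Q) + n * n * n" using b
    by (simp add: algebra_simps)
  moreover have "pos (P * P)" "pos (Q * Q)" unfolding pos_def using PQ by blast+
  ultimately have c: "pos c" using pn by (auto intro!: pos_add pos_scaleR)
  define m where "m = norm c"
  have m: "(norm y)\<^sup>2 = m" "norm b = m"
    unfolding m_def b_def c_def using cstar_identity[of y] cstar_identity[of "star y"]
    by (auto simp: star_star)
  \<comment> \<open>The clash with \<open>m > 0\<close>: since
    \<open>e (e - m) = (m + c) c = y (m + b) star y\<close> and \<open>m + b\<close> has norm at
    most \<open>m\<close>, the norm of \<open>e e - m e\<close> is at most \<open>m m\<close>. But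
    \<open>c\<close> is positive of norm \<open>m\<close>, so \<open>norm e\<close> is at least
    \<open>2 m\<close>, which forces at least \<open>2 m m\<close>.\<close>
  define e where "e = m *\<^sub>R 1 + c"
  define L where "L = norm e"
  have m0: "m \<ge> 0" unfolding m_def by simp
  have e: "pos e" unfolding e_def using c m0 by (intro pos_add pos_scaleR pos_one)
  have "pos (L *\<^sub>R 1 - e)" unfolding L_def by (rule pos_norm_minus) (rule pos_star[OF e])
  then have "pos ((L - m) *\<^sub>R 1 - c)" unfolding e_def by (simp add: algebra_simps)
  then have L: "L \<ge> 2 * m" using norm_le_of_pos[OF c] m_def by fastforce
  have "norm (m *\<^sub>R 1 - (- b)) \<le> m"
    by (rule pos_normD) (use pn(7) b m in auto)
  then have mb: "norm (m *\<^sub>R 1 + b) \<le> m" by simp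
  have "e * e - m *\<^sub>R e = y * (m *\<^sub>R 1 + b) * star y"
    unfolding e_def b_def c_def by (simp add: algebra_simps)
  then have "norm (e * e - m *\<^sub>R e) \<le> norm y * norm (m *\<^sub>R 1 + b) * norm y"
    using norm_mult_ineq[of "y * (m *\<^sub>R 1 + b)" "star y"] norm_mult_ineq[of y "m *\<^sub>R 1 + b"]
      mult_right_mono[of _ "norm y * norm (m *\<^sub>R 1 + b)" "norm y"] by (simp add: order_trans)
  also have "\<dots> \<le> norm y * m * norm y" using mb m0 by (intro mult_mono) auto
  also have "\<dots> = m * m" using m by (simp add: power2_eq_square)
  finally have 1: "norm (e * e - m *\<^sub>R e) \<le> m * m" .
  have "norm (e * e) - norm (m *\<^sub>R e) \<le> norm (e * e - m *\<^sub>R e)" by (rule norm_triangle_ineq2)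
  then have "L * L - m * L \<le> m * m"
    using 1 norm_mult_self[OF pos_star[OF e]] m0 unfolding L_def by (simp add: power2_eq_square)
  moreover have "2 * m * m \<le> L * (L - m)" using L m0 by (intro mult_mono) auto
  ultimately have "m * m \<le> 0" by (simp add: algebra_simps)
  then have "m = 0" using m0 by (metis mult_nonneg_nonneg order_antisym mult_eq_0_iff)
  then have "b = 0" using m by simp
  then have "n = 0" using b pn self_adjoint_cube_zero by (metis neg_equal_0_iff_equal)
  then show ?thesis using pn by simp
qed

lemma pos_conj: assumes "pos a" shows "pos (star x * a * x)"
proof -
  obtain s where s: "star s = s" "a = s * s" using assms unfolding pos_def by auto
  then have "star x * a * x = star (s * x) * (s * x)" by (simp add: star_mult mult.assoc)
  then show ?thesis by (metis pos_star_mult_self)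
qed

lemma pos_norm_sq_minus: "pos ((norm x)\<^sup>2 *\<^sub>R 1 - star x * x)"
  using pos_norm_minus[of "star x * x"] by (simp add: star_mult star_star cstar_identity)

text \<open>With one \<open>t\<close> that is large enough for all small perturbations, positivity
  is the closed condition \<open>norm (t - a) \<le> t\<close>.\<close>

lemma pos_closed:
  assumes "star a = a" "\<And>e. e > 0 \<Longrightarrow> pos (a + e *\<^sub>R 1)"
  shows "pos a"
proof (rule posI)
  let ?t = "norm a + 1"
  show "norm (?t *\<^sub>R 1 - a) \<le> ?t"
  proof (rule field_le_epsilon)
    fix e :: real assume "e > 0"
    \<comment> \<open>The cap at 1 keeps \<open>norm (a + d)\<close> below \<open>?t\<close>, so the
      same \<open>?t\<close> serves for every \<open>e\<close>.\<close>
    define d where "d = min e 1"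
    have d: "d > 0" "d \<le> e" "d \<le> 1" unfolding d_def using \<open>e > 0\<close> by auto
    have "norm (a + d *\<^sub>R 1) \<le> ?t"
      using norm_triangle_ineq[of a "d *\<^sub>R 1"] d by simp
    then have "norm (?t *\<^sub>R 1 - (a + d *\<^sub>R 1)) \<le> ?t" using assms(2) d by (intro pos_normD) auto
    moreover have "?t *\<^sub>R 1 - a = (?t *\<^sub>R 1 - (a + d *\<^sub>R 1)) + d *\<^sub>R (1::'a)"
      by simp
    then have "norm (?t *\<^sub>R 1 - a) \<le> norm (?t *\<^sub>R 1 - (a + d *\<^sub>R 1)) + norm (d *\<^sub>R (1::'a))"
      by (metis norm_triangle_ineq)
    ultimately show "norm (?t *\<^sub>R 1 - a) \<le> ?t + e" using d by simp
  qed
qed fact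

section \<open>States\<close>

text \<open>\<open>upper x\<close> is the supremum of the spectrum of the self-adjoint part of \<open>x\<close>.\<close>

definition re_part :: "'a::cstar_algebra \<Rightarrow> 'a" where
  "re_part x = (1/2) *\<^sub>R (x + star x)"

definition upper :: "'a::cstar_algebra \<Rightarrow> real" where
  "upper x = Inf {l. pos (l *\<^sub>R 1 - re_part x)}"

lemma star_re_part [simp]: "star (re_part x) = re_part x"
  by (simp add: re_part_def star_add star_star add.commute)

lemma re_part_self_adjoint: "star x = x \<Longrightarrow> re_part x = x"
  by (simp add: re_part_def)

lemma re_part_add: "re_part (x + y) = re_part x + re_part y"
  by (simp add: re_part_def star_add algebra_simps)

lemma re_part_scaleR: "re_part (c *\<^sub>R x) = c *\<^sub>R re_part x"
  by (simp add: re_part_def algebra_simps)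

lemma re_part_minus: "re_part (- x) = - re_part x"
  using re_part_scaleR[of "-1" x] by simp

lemma upper_set:
  fixes x :: "'a::cstar_algebra"
  shows "norm (re_part x) \<in> {l. pos (l *\<^sub>R 1 - re_part x)}"
  "bdd_below {l. pos (l *\<^sub>R 1 - re_part x)}"
proof -
  show "norm (re_part x) \<in> {l. pos (l *\<^sub>R 1 - re_part x)}"
    by (simp add: pos_norm_minus)
  have "- norm (re_part x) \<le> l" if "pos (l *\<^sub>R 1 - re_part x)" for l
  proof -
    have "pos ((l *\<^sub>R 1 - re_part x) + (norm (re_part x) *\<^sub>R 1 + re_part x))"
      by (rule pos_add[OF that pos_norm_plus[OF star_re_part]])
    then have "pos ((l + norm (re_part x)) *\<^sub>R (1::'a))" by (simp add: algebra_simps)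
    then show ?thesis unfolding pos_scaleR_one_iff by simp
  qed
  then show "bdd_below {l. pos (l *\<^sub>R 1 - re_part x)}" by (intro bdd_belowI) auto
qed

lemma upper_le: "pos (l *\<^sub>R 1 - re_part x) \<Longrightarrow> upper x \<le> l"
  unfolding upper_def by (rule cInf_lower) (use upper_set in auto)

text \<open>The infimum defining \<open>upper\<close> is attained because the cone is closed; this
  is what converts inequalities for \<open>upper\<close> into positivity and back.\<close>

lemma pos_upper: "pos (upper x *\<^sub>R 1 - re_part x)"
proof (rule pos_closed)
  fix e :: real assume "e > 0"
  then obtain l where l: "pos (l *\<^sub>R 1 - re_part x)" "l < upper x + e"
    using cInf_lessD[of "{l. pos (l *\<^sub>R 1 - re_part x)}" "upper x + e"] upper_set(1)
    unfolding upper_def by fastforce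
  have "pos ((l *\<^sub>R 1 - re_part x) + (upper x + e - l) *\<^sub>R 1)"
    using l by (intro pos_add pos_scaleR) auto
  then show "pos (upper x *\<^sub>R 1 - re_part x + e *\<^sub>R 1)" by (simp add: algebra_simps)
qed (simp add: star_diff)

lemma upper_le_iff: "upper x \<le> l \<longleftrightarrow> pos (l *\<^sub>R 1 - re_part x)"
proof
  assume "upper x \<le> l"
  then have "pos ((upper x *\<^sub>R 1 - re_part x) + (l - upper x) *\<^sub>R 1)"
    by (intro pos_add pos_upper pos_scaleR) auto
  then show "pos (l *\<^sub>R 1 - re_part x)" by (simp add: algebra_simps)
qed (rule upper_le)

lemma upper_add: "upper (x + y) \<le> upper x + upper y"
  using pos_add[OF pos_upper pos_upper, of x y]
  by (simp add: upper_le_iff re_part_add algebra_simps)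

lemma upper_scaleR: assumes "c \<ge> 0" shows "upper (c *\<^sub>R x) = c * upper (x::'a::cstar_algebra)"
proof -
  have le: "upper (d *\<^sub>R z) \<le> d * upper z" if "d \<ge> 0" for d and z :: 'a
    using pos_scaleR[OF pos_upper that, of z] by (simp add: upper_le_iff re_part_scaleR algebra_simps)
  show ?thesis
  proof (cases "c = 0")
    case True
    have "upper (0::'a) = 0"
    proof (rule antisym)
      show "upper (0::'a) \<le> 0" using le[of 0 0] by simp
      show "0 \<le> upper (0::'a)"
        using pos_upper[of "0::'a"] by (simp add: re_part_def pos_scaleR_one_iff)
    qed
    then show ?thesis using True by simp
  next
    case False
    have "upper ((1/c) *\<^sub>R (c *\<^sub>R x)) \<le> (1/c) * upper (c *\<^sub>R x)" by (rule le) (use assms in simp)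
    then have "upper x \<le> upper (c *\<^sub>R x) / c" using False by simp
    then show ?thesis using le[OF assms, of x] False assms by (simp add: field_simps)
  qed
qed

lemma upper_zero [simp]: "upper 0 = 0"
  using upper_scaleR[of 0 0] by simp

lemma upper_scaleR_one [simp]: "upper (l *\<^sub>R (1::'a::cstar_algebra)) = l"
proof -
  have "upper (l *\<^sub>R (1::'a)) \<le> k \<longleftrightarrow> l \<le> k" for k
    by (simp add: upper_le_iff re_part_self_adjoint pos_scaleR_one_iff flip: scaleR_left_diff_distrib)
  then show ?thesis by (meson order_antisym order_refl)
qed

lemma upper_one [simp]: "upper 1 = 1" and upper_minus_one [simp]: "upper (- 1) = - 1"
  using upper_scaleR_one[of 1] upper_scaleR_one[of "-1"] by simp_all

lemma upper_neg_pos: "pos x \<Longrightarrow> upper (- x) \<le> 0"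
  by (simp add: upper_le_iff re_part_minus re_part_self_adjoint pos_star)

text \<open>Only real parts are asked to be nonnegative, as hermitian functionals are real on
  \<open>star x * x\<close>. Continuity is a consequence, \<open>state_norm\<close>, and all clauses
  are pointwise closed, which matters for \<open>compact_states\<close>.\<close>

definition state :: "('a::cstar_algebra \<Rightarrow> complex) \<Rightarrow> bool" where
  "state \<omega> \<longleftrightarrow> (\<forall>x y. \<omega> (x + y) = \<omega> x + \<omega> y) \<and> (\<forall>c x. \<omega> (c *\<^sub>C x) = c * \<omega> x) \<and> \<omega> 1 = 1 \<and>
     (\<forall>x. \<omega> (star x) = cnj (\<omega> x)) \<and> (\<forall>x. 0 \<le> Re (\<omega> (star x * x)))"

lemma
  assumes "state \<omega>"
  shows state_add: "\<omega> (x + y) = \<omega> x + \<omega> y"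
    and state_scaleC: "\<omega> (c *\<^sub>C x) = c * \<omega> x"
    and state_one: "\<omega> 1 = 1"
    and state_star: "\<omega> (star x) = cnj (\<omega> x)"
    and state_square: "0 \<le> Re (\<omega> (star x * x))"
  using assms unfolding state_def by auto

lemma
  assumes "state \<omega>"
  shows state_zero: "\<omega> 0 = 0"
    and state_minus: "\<omega> (- x) = - \<omega> x"
    and state_diff: "\<omega> (x - y) = \<omega> x - \<omega> y"
    and state_scaleR: "\<omega> (r *\<^sub>R x) = r * \<omega> x"
    and state_sum: "\<omega> (sum f A) = (\<Sum>i\<in>A. \<omega> (f i))"
proof -
  show 0: "\<omega> 0 = 0" using state_add[OF assms, of 0 0] by simp
  show m: "\<omega> (- x) = - \<omega> x" for x
    using state_add[OF assms, of x "- x"] 0 by (simp add: eq_neg_iff_add_eq_0 add.commute)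
  show "\<omega> (x - y) = \<omega> x - \<omega> y" using state_add[OF assms, of x "- y"] m by simp
  show "\<omega> (r *\<^sub>R x) = r * \<omega> x" using state_scaleC[OF assms, of "complex_of_real r" x]
    by (simp add: scaleC_of_real)
  show "\<omega> (sum f A) = (\<Sum>i\<in>A. \<omega> (f i))"
    by (induction A rule: infinite_finite_induct) (auto simp: 0 state_add[OF assms])
qed

lemma state_pos: "state \<omega> \<Longrightarrow> pos x \<Longrightarrow> 0 \<le> Re (\<omega> x)"
  unfolding pos_def by (metis state_square)

lemma state_self_adjoint: "state \<omega> \<Longrightarrow> star x = x \<Longrightarrow> \<omega> x = complex_of_real (Re (\<omega> x))"
  by (metis Reals_cnj_iff of_real_Re state_star)

lemma state_le_upper: assumes "state \<omega>" shows "Re (\<omega> x) \<le> upper x"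
proof -
  have "\<omega> (re_part x) = complex_of_real (Re (\<omega> x))"
    by (simp add: re_part_def state_scaleR[OF assms] state_add[OF assms] state_star[OF assms]
      complex_eq_iff)
  then show ?thesis using state_pos[OF assms pos_upper, of x]
    by (simp add: state_diff[OF assms] state_scaleR[OF assms] state_one[OF assms])
qed

text \<open>Positivity at \<open>y - k x\<close> is a real quadratic inequality in \<open>t\<close>
  once \<open>k = t \<omega>(star x * y)\<close> carries the phase of the mixed term. Its optimum is
  \<open>t = 1 / \<omega>(star x * x)\<close>; if that denominator vanishes, the linear term has to
  vanish too.\<close>

lemma state_cauchy_schwarz:
  assumes "state \<omega>"
  shows "(cmod (\<omega> (star x * y)))\<^sup>2 \<le> Re (\<omega> (star x * x)) * Re (\<omega> (star y * y))"
proof -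
  let ?c = "\<omega> (star x * y)" and ?a = "Re (\<omega> (star x * x))" and ?b = "Re (\<omega> (star y * y))"
  have sa: "\<omega> (star z * z) = complex_of_real (Re (\<omega> (star z * z)))" for z
    by (rule state_self_adjoint[OF assms]) (simp add: star_mult star_star)
  have yx: "\<omega> (star y * x) = cnj ?c" using state_star[OF assms, of "star x * y"]
    by (simp add: star_mult star_star)
  have quad: "0 \<le> t\<^sup>2 * ?a * (cmod ?c)\<^sup>2 - 2 * t * (cmod ?c)\<^sup>2 + ?b" for t :: real
  proof -
    define k where "k = complex_of_real t * ?c"
    let ?z = "y - k *\<^sub>C x"
    have "star ?z * ?z = star y * y - k *\<^sub>C (star y * x) - cnj k *\<^sub>C (star x * y)
        + (cnj k * k) *\<^sub>C (star x * x)"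
      by (simp add: star_diff star_scaleC mult_scaleC_left mult_scaleC_right algebra_simps scaleC_scaleC
        cvec.scale_right_diff_distrib)
    then have "\<omega> (star ?z * ?z) = complex_of_real ?b - k * cnj ?c - cnj k * ?c
        + (cnj k * k) * complex_of_real ?a"
      using sa[of x] sa[of y] yx
      by (simp only: state_add[OF assms] state_diff[OF assms] state_scaleC[OF assms])
    moreover have "Re (k * cnj ?c) = t * (cmod ?c)\<^sup>2" "Re (cnj k * ?c) = t * (cmod ?c)\<^sup>2"
      unfolding k_def cmod_power2 by (simp_all add: power2_eq_square algebra_simps)
    moreover have "cnj k * k = complex_of_real (t\<^sup>2 * (cmod ?c)\<^sup>2)"
      unfolding k_def by (simp add: complex_norm_square[symmetric, of ?c] power2_eq_square
        complex_norm_square[of ?c, unfolded power2_eq_square] algebra_simps)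
    then have "Re ((cnj k * k) * complex_of_real ?a) = t\<^sup>2 * (cmod ?c)\<^sup>2 * ?a"
      by (metis Re_complex_of_real of_real_mult)
    ultimately have "Re (\<omega> (star ?z * ?z)) = ?b - 2 * t * (cmod ?c)\<^sup>2 + t\<^sup>2 * (cmod ?c)\<^sup>2 * ?a"
      by simp
    then show ?thesis using state_square[OF assms, of ?z] by (simp add: algebra_simps)
  qed
  have a0: "?a \<ge> 0" by (rule state_square[OF assms])
  show ?thesis
  proof (cases "?a = 0")
    case True
    have "?c = 0"
    proof (rule ccontr)
      assume "?c \<noteq> 0"
      then have p: "(cmod ?c)\<^sup>2 > 0" by simp
      have "2 * t * (cmod ?c)\<^sup>2 \<le> ?b" for t using quad[of t] True by simp
      \<comment> \<open>At this \<open>t\<close> the left side equals \<open>?b + 1\<close>.\<close>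
      from this[of "(?b + 1) / (2 * (cmod ?c)\<^sup>2)"]
      have "2 * ((?b + 1) / (2 * (cmod ?c)\<^sup>2)) * (cmod ?c)\<^sup>2 \<le> ?b" .
      moreover have "2 * ((?b + 1) / (2 * (cmod ?c)\<^sup>2)) * (cmod ?c)\<^sup>2 = ?b + 1" using p by simp
      ultimately show False by linarith
    qed
    then show ?thesis using True by simp
  next
    case False
    have "0 \<le> (1 / ?a)\<^sup>2 * ?a * (cmod ?c)\<^sup>2 - 2 * (1 / ?a) * (cmod ?c)\<^sup>2 + ?b" by (rule quad)
    also have "\<dots> = ?b - (cmod ?c)\<^sup>2 / ?a" using False by (simp add: power2_eq_square field_simps)
    finally show ?thesis using False a0 by (simp add: field_simps)
  qed
qed

lemma state_null_left:
  "state \<omega> \<Longrightarrow> Re (\<omega> (star y * y)) \<le> 0 \<Longrightarrow> \<omega> (x * y) = 0"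
  using state_cauchy_schwarz[of \<omega> "star x" y] state_square[of \<omega> "star x"]
    mult_nonneg_nonpos[of "Re (\<omega> (star (star x) * star x))" "Re (\<omega> (star y * y))"]
  by (simp add: star_star) (metis norm_eq_zero order_trans power2_less_eq_zero_iff)

lemma state_norm: assumes "state \<omega>" shows "cmod (\<omega> x) \<le> norm x"
proof -
  have "Re (\<omega> (star x * x)) \<le> (norm x)\<^sup>2"
    using state_pos[OF assms pos_norm_sq_minus[of x]]
    by (simp add: state_diff[OF assms] state_scaleR[OF assms] state_one[OF assms])
  moreover have "(cmod (\<omega> x))\<^sup>2 \<le> Re (\<omega> (star x * x))"
    using state_cauchy_schwarz[OF assms, of 1 x] by (simp add: state_one[OF assms])
  ultimately show ?thesis by (meson norm_ge_zero order_trans power2_le_imp_le)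
qed

lemma state_bounded_linear: "state \<omega> \<Longrightarrow> bounded_linear \<omega>"
  by (rule bounded_linear_intro[where K = 1])
    (simp_all add: state_add state_scaleR state_norm scaleR_conv_of_real[where 'a = complex])

text \<open>The formula is the only complex-linear functional with real part \<open>f\<close>.
  Domination by \<open>upper\<close> supplies the rest: \<open>upper\<close> sees only self-adjoint
  parts, so \<open>f\<close> is hermitian; it is nonpositive on negative elements, so
  \<open>f\<close> is positive; and its values at 1 and -1 normalize \<open>f\<close>.\<close>

lemma stateI_upper:
  assumes f: "linear f" and le: "\<And>x. f x \<le> upper x"
  shows "state (\<lambda>x. Complex (f x) (- f (\<i> *\<^sub>C x)))"
proof -
  have eq: "f x = r" if "upper x \<le> r" "upper (- x) \<le> - r" for x r
    using le[of x] le[of "- x"] that linear_neg[OF f, of x] by simp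
  have star: "f (star x) = f x" for x
  proof -
    have "re_part (star x - x) = 0" by (simp add: re_part_def star_diff star_star)
    then have "f (star x - x) = 0" by (intro eq) (simp_all add: upper_le_iff re_part_minus del: minus_diff_eq)
    then show ?thesis by (simp add: linear_diff[OF f])
  qed
  have C: "f (c *\<^sub>C x) = Re c * f x + Im c * f (\<i> *\<^sub>C x)" for c x
  proof -
    have "c *\<^sub>C x = Re c *\<^sub>R x + Im c *\<^sub>R (\<i> *\<^sub>C x)"
      by (subst complex_eq[of c]) (simp add: scaleC_add_left scaleC_scaleC
        scaleC_of_real[symmetric] mult.commute)
    then show ?thesis by (simp add: linear_add[OF f] linear_scale[OF f])
  qed
  show ?thesis unfolding state_def
  proof (intro conjI allI)
    fix x y c
    show "Complex (f (x + y)) (- f (\<i> *\<^sub>C (x + y))) =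
        Complex (f x) (- f (\<i> *\<^sub>C x)) + Complex (f y) (- f (\<i> *\<^sub>C y))"
      by (simp add: scaleC_add_right linear_add[OF f] complex_eq_iff)
    show "Complex (f (c *\<^sub>C x)) (- f (\<i> *\<^sub>C c *\<^sub>C x)) = c * Complex (f x) (- f (\<i> *\<^sub>C x))"
      by (simp add: scaleC_scaleC complex_eq_iff C[of "\<i> * c"] C[of c])
    show "Complex (f 1) (- f (\<i> *\<^sub>C 1)) = 1"
    proof -
      have "f 1 = 1" by (rule eq) simp_all
      moreover have "re_part (\<i> *\<^sub>C (1::'a)) = 0" by (simp add: re_part_def star_scaleC)
      then have "f (\<i> *\<^sub>C 1) = 0" by (intro eq) (simp_all add: upper_le_iff re_part_minus)
      ultimately show ?thesis by (simp add: complex_eq_iff)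
    qed
    have "f (\<i> *\<^sub>C star x) = - f (\<i> *\<^sub>C x)"
      using star[of "\<i> *\<^sub>C x"] by (simp add: star_scaleC linear_neg[OF f])
    then show "Complex (f (star x)) (- f (\<i> *\<^sub>C star x)) = cnj (Complex (f x) (- f (\<i> *\<^sub>C x)))"
      by (simp add: star complex_eq_iff)
    show "0 \<le> Re (Complex (f (star x * x)) (- f (\<i> *\<^sub>C (star x * x))))"
      using le[of "- (star x * x)"] upper_neg_pos[OF pos_star_mult_self[of x]]
      by (simp add: linear_neg[OF f])
  qed
qed

text \<open>Extreme points of the state space in midpoint form; comparing \<phi> suffices, since
  \<psi> is then determined.\<close>

definition pure_state :: "('a::cstar_algebra \<Rightarrow> complex) \<Rightarrow> bool" where
  "pure_state \<omega> \<longleftrightarrow> state \<omega> \<and>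
     (\<forall>\<phi> \<psi>. state \<phi> \<longrightarrow> state \<psi> \<longrightarrow> (\<forall>x. \<omega> x = (\<phi> x + \<psi> x) / 2) \<longrightarrow> \<phi> = \<omega>)"

section \<open>Extreme linear functionals below a sublinear one\<close>

definition sublinear :: "('a::real_vector \<Rightarrow> real) \<Rightarrow> bool" where
  "sublinear q \<longleftrightarrow> (\<forall>x y. q (x + y) \<le> q x + q y) \<and> (\<forall>c\<ge>0. \<forall>x. q (c *\<^sub>R x) = c * q x)"

lemma sublinear_zero: "sublinear q \<Longrightarrow> q 0 = 0"
  unfolding sublinear_def by (metis mult_zero_left order_refl scaleR_zero_left)

lemma sublinear_neg: "sublinear q \<Longrightarrow> - q (- x) \<le> q x"
  using sublinear_zero[of q] unfolding sublinear_def
  by (metis add.right_inverse minus_le_iff neg_le_iff_le add.commute diff_le_eq diff_0 le_diff_eq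
    add.inverse_inverse)

text \<open>The functional \<open>tighten q a\<close> is the supremum of the linear functionals below \<open>q\<close> that agree with
  \<open>q\<close> at \<open>a\<close>.\<close>

definition tighten :: "('a::real_vector \<Rightarrow> real) \<Rightarrow> 'a \<Rightarrow> 'a \<Rightarrow> real" where
  "tighten q a x = (INF t\<in>{0..}. q (x + t *\<^sub>R a) - t * q a)"

context
  fixes q :: "'a::real_vector \<Rightarrow> real" and a :: 'a
  assumes q: "sublinear q"
begin

lemma q_add: "q (x + y) \<le> q x + q y" and q_scale: "c \<ge> 0 \<Longrightarrow> q (c *\<^sub>R x) = c * q x"
  using q unfolding sublinear_def by auto

lemma tighten_bdd: "bdd_below ((\<lambda>t. q (x + t *\<^sub>R a) - t * q a) ` {0..})"
proof (rule bdd_belowI2)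
  fix t :: real assume "t \<in> {0..}"
  then show "- q (- x) \<le> q (x + t *\<^sub>R a) - t * q a"
    using q_add[of "x + t *\<^sub>R a" "- x"] q_scale[of t a] by simp
qed

lemma tighten_le: "t \<ge> 0 \<Longrightarrow> tighten q a x \<le> q (x + t *\<^sub>R a) - t * q a"
  unfolding tighten_def by (rule cINF_lower[OF tighten_bdd]) simp

lemma tighten_greatest:
  "(\<And>t. t \<ge> 0 \<Longrightarrow> r \<le> q (x + t *\<^sub>R a) - t * q a) \<Longrightarrow> r \<le> tighten q a x"
  unfolding tighten_def by (rule cINF_greatest) auto

lemma tighten_le_self: "tighten q a x \<le> q x"
  using tighten_le[of 0 x] by simp

lemma tighten_neg: "tighten q a (- a) \<le> - q a"
  using tighten_le[of 1 "- a"] sublinear_zero[OF q] by simp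

lemma sublinear_tighten: "sublinear (tighten q a)"
  unfolding sublinear_def
proof (intro conjI allI impI)
  fix x y
  show "tighten q a (x + y) \<le> tighten q a x + tighten q a y"
  proof (rule ccontr)
    assume "\<not> ?thesis"
    then have lt: "tighten q a x + tighten q a y < tighten q a (x + y)" by simp
    \<comment> \<open>Half of the supposed gap: two near-optimal parameters together lose less than
      \<open>2 e\<close>.\<close>
    define e where "e = (tighten q a (x + y) - tighten q a x - tighten q a y) / 2"
    have e: "e > 0" using lt unfolding e_def by simp
    have ex: "\<exists>t\<ge>0. q (z + t *\<^sub>R a) - t * q a < tighten q a z + e" for z
      using cINF_less_iff[OF _ tighten_bdd, of z "tighten q a z + e"] e
      unfolding tighten_def by auto
    obtain s where s: "s \<ge> 0" "q (x + s *\<^sub>R a) - s * q a < tighten q a x + e" using ex by blast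
    obtain t where t: "t \<ge> 0" "q (y + t *\<^sub>R a) - t * q a < tighten q a y + e" using ex by blast
    have "tighten q a (x + y) \<le> q ((x + y) + (s + t) *\<^sub>R a) - (s + t) * q a"
      using s t by (intro tighten_le) auto
    also have "(x + y) + (s + t) *\<^sub>R a = (x + s *\<^sub>R a) + (y + t *\<^sub>R a)" by (simp add: algebra_simps)
    also have "q \<dots> \<le> q (x + s *\<^sub>R a) + q (y + t *\<^sub>R a)" by (rule q_add)
    finally have "tighten q a (x + y) < tighten q a x + tighten q a y + 2 * e"
      using s t by (simp add: algebra_simps)
    then show False unfolding e_def by (simp add: field_simps)
  qed
next
  fix c :: real and x assume c: "c \<ge> 0"
  show "tighten q a (c *\<^sub>R x) = c * tighten q a x"
  proof (cases "c = 0")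
    case True
    have "tighten q a 0 = 0"
    proof (rule antisym)
      show "tighten q a 0 \<le> 0" using tighten_le_self[of 0] sublinear_zero[OF q] by simp
      show "0 \<le> tighten q a 0" by (rule tighten_greatest) (simp add: q_scale)
    qed
    then show ?thesis using True by simp
  next
    case False
    have le: "tighten q a (d *\<^sub>R z) \<le> d * tighten q a z" if d: "d > 0" for d z
    proof -
      have "tighten q a (d *\<^sub>R z) / d \<le> tighten q a z"
      proof (rule tighten_greatest)
        fix t :: real assume "t \<ge> 0"
        then have "tighten q a (d *\<^sub>R z) \<le> q (d *\<^sub>R z + (d * t) *\<^sub>R a) - (d * t) * q a"
          using d by (intro tighten_le) auto
        also have "d *\<^sub>R z + (d * t) *\<^sub>R a = d *\<^sub>R (z + t *\<^sub>R a)" by (simp add: algebra_simps)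
        finally show "tighten q a (d *\<^sub>R z) / d \<le> q (z + t *\<^sub>R a) - t * q a"
          using d q_scale[of d "z + t *\<^sub>R a"] by (simp add: field_simps)
      qed
      then show ?thesis using d by (simp add: field_simps)
    qed
    have "tighten q a ((1/c) *\<^sub>R (c *\<^sub>R x)) \<le> (1/c) * tighten q a (c *\<^sub>R x)" by (rule le) (use False c in simp)
    then show ?thesis using le[of c x] False c by (simp add: field_simps)
  qed
qed

end

text \<open>Zorn's lemma is applied to the sublinear functionals \<open>q \<le> p\<close> whose dominated functionals form a face;
  a minimal one is linear, so this contains both the Hahn-Banach and the Krein-Milman theorem.\<close>

theorem sublinear_extreme:
  fixes p :: "'a::real_vector \<Rightarrow> real"
  assumes p: "sublinear p"
  obtains f where "linear f" "\<And>x. f x \<le> p x" "f a = p a"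
    "\<And>g h. linear g \<Longrightarrow> linear h \<Longrightarrow> (\<And>x. g x \<le> p x) \<Longrightarrow> (\<And>x. h x \<le> p x) \<Longrightarrow>
       (\<And>x. f x = (g x + h x) / 2) \<Longrightarrow> g = f"
proof -
  define L where "L = {g. linear g \<and> (\<forall>x. g x \<le> p x)}"
  define face where "face q \<longleftrightarrow> (\<forall>g\<in>L. \<forall>h\<in>L. (\<forall>x. (g x + h x) / 2 \<le> q x) \<longrightarrow> (\<forall>x. g x \<le> q x))"
    for q :: "'a \<Rightarrow> real"
  define A where "A = {q. sublinear q \<and> q \<le> tighten p a \<and> face q}"
  \<comment> \<open>If the midpoint of two functionals below \<open>q\<close> attains the value
    \<open>q b\<close>, both ends attain it.\<close>
  have face_tighten: "face (tighten q b)" if q: "sublinear q" "q \<le> p" "face q" for q b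
    unfolding face_def
  proof (intro ballI impI allI)
    fix g h x assume g: "g \<in> L" and h: "h \<in> L" and le: "\<forall>x. (g x + h x) / 2 \<le> tighten q b x"
    have leq: "\<forall>x. (g x + h x) / 2 \<le> q x" using le tighten_le_self[OF q(1)] order_trans by blast
    have gq: "\<forall>x. g x \<le> q x" using q(3) g h leq unfolding face_def by blast
    have hq: "\<forall>x. h x \<le> q x" using q(3) g h leq unfolding face_def by (metis add.commute)
    have lin: "linear g" "linear h" using g h unfolding L_def by auto
    have "(g (- b) + h (- b)) / 2 \<le> - q b" using le tighten_neg[OF q(1)] order_trans by blast
    then have "q b \<le> (g b + h b) / 2" using lin by (simp add: linear_neg)
    then have "g b = q b" using gq[rule_format, of b] hq[rule_format, of b] by simp
    then show "g x \<le> tighten q b x"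
    proof (intro tighten_greatest[OF q(1)])
      fix t :: real
      have "g (x + t *\<^sub>R b) \<le> q (x + t *\<^sub>R b)" using gq by blast
      then show "g x \<le> q (x + t *\<^sub>R b) - t * q b"
        using \<open>g b = q b\<close> by (simp add: linear_add[OF lin(1)] linear_scale[OF lin(1)])
    qed
  qed
  have p0: "face p" unfolding face_def L_def by simp
  have pa: "tighten p a \<in> A" unfolding A_def
    using sublinear_tighten[OF p] face_tighten[OF p _ p0] by simp
  have tp: "tighten p a \<le> p" using tighten_le_self[OF p] by (simp add: le_fun_def)
  have "\<exists>m\<in>A. \<forall>q\<in>A. q \<le> m \<longrightarrow> q = m"
  proof (rule predicate_Zorn[where P = "\<lambda>x y. y \<le> x", simplified])
    show "partial_order_on A (relation_of (\<lambda>x y. y \<le> x) A)"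
      unfolding partial_order_on_def preorder_on_def refl_on_def trans_def antisym_def relation_of_def
      by auto
    fix C assume C: "C \<in> Chains (relation_of (\<lambda>x y. y \<le> x) A)"
    then have CA: "C \<subseteq> A" and tot: "\<And>q r. q \<in> C \<Longrightarrow> r \<in> C \<Longrightarrow> q \<le> r \<or> r \<le> q"
      unfolding Chains_def relation_of_def by auto
    show "\<exists>u\<in>A. \<forall>q\<in>C. u \<le> q"
    proof (cases "C = {}")
      case True then show ?thesis using pa by blast
    next
      case False
      \<comment> \<open>Subadditivity of the pointwise infimum needs the chain property: two members
        are compared at the smaller one.\<close>
      define u where "u x = (INF q\<in>C. q x)" for x
      have Cs: "sublinear q" "q \<le> tighten p a" "face q" if "q \<in> C" for q
        using that CA unfolding A_def by auto
      have bdd: "bdd_below ((\<lambda>q. q x) ` C)" for x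
      proof (rule bdd_belowI2)
        fix q assume q: "q \<in> C"
        have "q (- x) \<le> p (- x)" using Cs(2)[OF q] tp by (meson le_fun_def order_trans)
        then show "- p (- x) \<le> q x" using sublinear_neg[OF Cs(1)[OF q], of x] by simp
      qed
      have ule: "u x \<le> q x" if "q \<in> C" for q x
        unfolding u_def by (rule cINF_lower[OF bdd that])
      have ug: "r \<le> u x" if "\<And>q. q \<in> C \<Longrightarrow> r \<le> q x" for r x
        unfolding u_def by (rule cINF_greatest[OF False that])
      have "u (x + y) \<le> u x + u y" for x y
      proof -
        have "u (x + y) - q y \<le> u x" if q: "q \<in> C" for q
        proof (rule ug)
          fix r assume r: "r \<in> C"
          consider "q \<le> r" | "r \<le> q" using tot q r by blast
          then obtain s where s: "s \<in> C" "s \<le> q" "s \<le> r" using q r by (cases) auto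
          have "u (x + y) \<le> s (x + y)" by (rule ule[OF s(1)])
          also have "\<dots> \<le> s x + s y" using Cs(1)[OF s(1)] unfolding sublinear_def by blast
          also have "\<dots> \<le> r x + q y" using s by (intro add_mono) (auto simp: le_fun_def)
          finally show "u (x + y) - q y \<le> r x" by simp
        qed
        then have "u (x + y) - u x \<le> u y" by (intro ug) (simp add: algebra_simps)
        then show ?thesis by simp
      qed
      moreover have "u (c *\<^sub>R x) = c * u x" if c: "c \<ge> 0" for c x
      proof (cases "c = 0")
        case True
        have "u 0 = 0" unfolding u_def
          using False by (subst INF_cong[OF refl sublinear_zero[OF Cs(1)]]) auto
        then show ?thesis using True by simp
      next
        case cn: False
        have sc: "q (c *\<^sub>R x) = c * q x" if "q \<in> C" for q
          using Cs(1)[OF that] c unfolding sublinear_def by blast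
        show ?thesis
        proof (rule antisym)
          have "u (c *\<^sub>R x) / c \<le> u x"
            by (rule ug) (use ule[of _ "c *\<^sub>R x"] sc c cn in \<open>fastforce simp: field_simps\<close>)
          then show "u (c *\<^sub>R x) \<le> c * u x" using c cn by (simp add: field_simps)
          show "c * u x \<le> u (c *\<^sub>R x)"
            by (rule ug) (simp add: sc ule c mult_left_mono)
        qed
      qed
      ultimately have "sublinear u" unfolding sublinear_def by blast
      moreover have "u \<le> tighten p a"
        using False ule Cs(2) by (metis all_not_in_conv le_fun_def order_trans)
      moreover have "face u" unfolding face_def
      proof (intro ballI impI allI)
        fix g h x assume g: "g \<in> L" and h: "h \<in> L" and le: "\<forall>x. (g x + h x) / 2 \<le> u x"
        show "g x \<le> u x"
        proof (rule ug)
          fix q assume q: "q \<in> C"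
          have "\<forall>x. (g x + h x) / 2 \<le> q x" using le ule[OF q] order_trans by blast
          then show "g x \<le> q x" using Cs(3)[OF q] g h unfolding face_def by blast
        qed
      qed
      ultimately show ?thesis using ule unfolding A_def by (auto simp: le_fun_def)
    qed
  qed
  then obtain m where m: "m \<in> A" "\<And>q. q \<in> A \<Longrightarrow> q \<le> m \<Longrightarrow> q = m" by blast
  have ms: "sublinear m" "m \<le> tighten p a" "face m" using m(1) unfolding A_def by auto
  have mp: "m \<le> p" using ms(2) tp by simp
  \<comment> \<open>Tightening stays in \<open>A\<close> and only lowers, so it fixes a minimal
    \<open>m\<close>. At \<open>- b\<close> this makes \<open>m\<close> odd, and an odd sublinear
    functional is linear.\<close>
  have stable: "tighten m b = m" for b
  proof (rule m(2))
    show le: "tighten m b \<le> m" using tighten_le_self[OF ms(1)] by (simp add: le_fun_def)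
    show "tighten m b \<in> A"
      unfolding A_def using sublinear_tighten[OF ms(1)] face_tighten[OF ms(1) mp ms(3)] le ms(2)
      by auto
  qed
  have neg: "m (- x) = - m x" for x
    using tighten_neg[OF ms(1), of x] sublinear_neg[OF ms(1), of x] stable by simp
  have add: "m (x + y) = m x + m y" for x y
  proof (rule antisym)
    show "m (x + y) \<le> m x + m y" using ms(1) unfolding sublinear_def by blast
    have "m ((- x) + (- y)) \<le> m (- x) + m (- y)" using ms(1) unfolding sublinear_def by blast
    then have "m (- (x + y)) \<le> m (- x) + m (- y)" by (simp add: algebra_simps)
    then show "m x + m y \<le> m (x + y)" by (simp only: neg)
  qed
  have lin: "linear m"
  proof (rule linearI)
    fix c :: real and x
    show "m (c *\<^sub>R x) = c *\<^sub>R m x"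
    proof (cases "c \<ge> 0")
      case True then show ?thesis using ms(1) unfolding sublinear_def by simp
    next
      case False
      then have "m ((- c) *\<^sub>R x) = (- c) * m x" using ms(1) unfolding sublinear_def
        by (meson linear neg_0_le_iff_le order_less_imp_le)
      then show ?thesis using neg[of "c *\<^sub>R x"] by simp
    qed
  qed (rule add)
  show ?thesis
  proof (rule that[OF lin])
    show "m x \<le> p x" for x using mp by (simp add: le_fun_def)
    have "m (- a) \<le> - p a" using ms(2) tighten_neg[OF p, of a] by (meson le_fun_def order_trans)
    then show "m a = p a" using neg mp by (simp add: le_fun_def antisym)
    fix g h assume gh: "linear g" "linear h" "\<And>x. g x \<le> p x" "\<And>x. h x \<le> p x" "\<And>x. m x = (g x + h x) / 2"
    have "g \<in> L" "h \<in> L" using gh unfolding L_def by auto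
    then have "g x \<le> m x" "h x \<le> m x" for x
      using ms(3) gh(5) unfolding face_def by (metis order_refl, metis add.commute order_refl)
    moreover have "2 * m x = g x + h x" for x using gh(5)[of x] by simp
    ultimately show "g = m" by (intro ext) (smt (verit))
  qed
qed

lemma sublinear_upper: "sublinear upper"
  unfolding sublinear_def using upper_add upper_scaleR by blast

lemma linear_Re_state: "state \<omega> \<Longrightarrow> linear (\<lambda>x. Re (\<omega> x))"
  by (rule linearI) (auto simp: state_add state_scaleR)

text \<open>A state is determined by its real part, a linear functional below \<open>upper\<close>;
  so extremality among those functionals is purity.\<close>

theorem pure_state_exists:
  obtains \<omega> where "pure_state \<omega>" "Re (\<omega> a) = upper a"
proof -
  obtain f where f: "linear f" "\<And>x. f x \<le> upper x" "f a = upper a"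
    "\<And>g h. linear g \<Longrightarrow> linear h \<Longrightarrow> (\<And>x. g x \<le> upper x) \<Longrightarrow> (\<And>x. h x \<le> upper x) \<Longrightarrow>
       (\<And>x. f x = (g x + h x) / 2) \<Longrightarrow> g = f"
    using sublinear_extreme[OF sublinear_upper, of a] by blast
  let ?w = "\<lambda>x. Complex (f x) (- f (\<i> *\<^sub>C x))"
  have st: "state ?w" by (rule stateI_upper[OF f(1,2)])
  have "\<phi> = ?w" if \<phi>: "state \<phi>" and \<psi>: "state \<psi>" and eq: "\<forall>x. ?w x = (\<phi> x + \<psi> x) / 2" for \<phi> \<psi>
  proof -
    have "f x = (Re (\<phi> x) + Re (\<psi> x)) / 2" for x
      using eq[rule_format, of x] by (simp add: complex_eq_iff)
    then have fx: "(\<lambda>x. Re (\<phi> x)) = f"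
      by (intro f(4)[OF linear_Re_state[OF \<phi>] linear_Re_state[OF \<psi>]])
        (auto intro: state_le_upper \<phi> \<psi>)
    have "Im (\<phi> x) = - f (\<i> *\<^sub>C x)" for x
      using state_scaleC[OF \<phi>, of \<i> x] fun_cong[OF fx, of "\<i> *\<^sub>C x"] by simp
    then show ?thesis using fun_cong[OF fx] by (auto simp: complex_eq_iff)
  qed
  then have "pure_state ?w" unfolding pure_state_def using st by blast
  then show ?thesis using that f(3) by simp
qed
text \<open>Some state attains \<open>upper\<close> at \<open>star x * x\<close>; the bound there
  makes \<open>c c - star x * x\<close> positive.\<close>

lemma norm_le_if_states:
  fixes x :: "'a::cstar_algebra" and c :: real
  assumes "\<And>\<omega> :: 'a \<Rightarrow> complex. state \<omega> \<Longrightarrow> Re (\<omega> (star x * x)) \<le> c\<^sup>2" "c \<ge> 0"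
  shows "norm x \<le> c"
proof -
  let ?a = "star x * x"
  obtain \<omega> where w: "pure_state \<omega>" "Re (\<omega> ?a) = upper ?a" using pure_state_exists by blast
  then have "upper ?a \<le> c\<^sup>2" using assms unfolding pure_state_def by metis
  then have "pos (c\<^sup>2 *\<^sub>R 1 - ?a)"
    by (simp add: upper_le_iff re_part_self_adjoint star_mult star_star)
  then have "(norm x)\<^sup>2 \<le> c\<^sup>2" using norm_le_of_pos[OF pos_star_mult_self[of x]] cstar_identity[of x]
    by simp
  then show ?thesis using assms(2) by (rule power2_le_imp_le)
qed

lemma pos_if_states:
  assumes "\<And>\<omega>. pure_state \<omega> \<Longrightarrow> 0 \<le> Re (\<omega> x)" shows "pos (re_part x)"
proof -
  obtain \<omega> where w: "pure_state \<omega>" "Re (\<omega> (- x)) = upper (- x)" using pure_state_exists by blast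
  then have "state \<omega>" unfolding pure_state_def by simp
  then have "upper (- x) \<le> 0" using w assms[OF w(1)] by (simp add: state_minus)
  then show ?thesis by (simp add: upper_le_iff re_part_minus)
qed

section \<open>Slice maps\<close>

text \<open>A device for prescribing a functional on a subspace: \<open>coupling\<close> uses it to
  pin the values at all \<open>a \<otimes> 1\<close>. The zero conditions keep the infimum at the
  origin from being negative.\<close>

lemma sublinear_INF:
  fixes F :: "'a::real_vector \<Rightarrow> 'b::real_vector \<Rightarrow> real"
  assumes add: "\<And>x y a b. F (x + y) (a + b) \<le> F x a + F y b"
    and scale: "\<And>c x a. c > 0 \<Longrightarrow> F (c *\<^sub>R x) (c *\<^sub>R a) = c * F x a"
    and bdd: "\<And>x. bdd_below (range (F x))"
    and zero: "F 0 0 = 0" "\<And>a. 0 \<le> F 0 a"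
  shows "sublinear (\<lambda>x. INF a. F x a)"
  unfolding sublinear_def
proof (intro conjI allI impI)
  fix x y
  have "(INF a. F (x + y) a) - F y b \<le> (INF a. F x a)" for b
  proof (rule cINF_greatest)
    fix a
    have "(INF a. F (x + y) a) \<le> F (x + y) (a + b)" by (rule cINF_lower[OF bdd]) simp
    then show "(INF a. F (x + y) a) - F y b \<le> F x a" using add[of x y a b] by simp
  qed simp
  then have "(INF a. F (x + y) a) - (INF a. F x a) \<le> (INF a. F y a)"
    by (intro cINF_greatest) (auto simp: algebra_simps)
  then show "(INF a. F (x + y) a) \<le> (INF a. F x a) + (INF a. F y a)" by simp
next
  fix c :: real and x assume c: "c \<ge> 0"
  show "(INF a. F (c *\<^sub>R x) a) = c * (INF a. F x a)"
  proof (cases "c = 0")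
    case True
    have "(INF a. F 0 a) \<le> F 0 0" by (rule cINF_lower[OF bdd]) simp
    then have "(INF a. F 0 a) = 0"
      using zero by (intro antisym cINF_greatest) auto
    then show ?thesis using True by simp
  next
    case False
    have le: "(INF a. F (d *\<^sub>R z) a) \<le> d * (INF a. F z a)" if d: "d > 0" for d z
    proof -
      have "(INF a. F (d *\<^sub>R z) a) / d \<le> (INF a. F z a)"
      proof (rule cINF_greatest)
        fix a
        have "(INF a. F (d *\<^sub>R z) a) \<le> F (d *\<^sub>R z) (d *\<^sub>R a)" by (rule cINF_lower[OF bdd]) simp
        then show "(INF a. F (d *\<^sub>R z) a) / d \<le> F z a" using d scale[OF d] by (simp add: field_simps)
      qed simp
      then show ?thesis using d by (simp add: field_simps)
    qed
    have "(INF a. F ((1/c) *\<^sub>R (c *\<^sub>R x)) a) \<le> (1/c) * (INF a. F (c *\<^sub>R x) a)"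
      by (rule le) (use False c in simp)
    then show ?thesis using le[of c x] False c by (simp add: field_simps)
  qed
qed

text \<open>A relation is extended rather than a map because elements of a tensor product have many
  expansions; the norm bound, applied to differences, gives single-valuedness and continuity
  together.\<close>

lemma dense_contraction_extension:
  fixes G :: "('a::real_normed_vector \<times> 'b::banach) set"
  assumes add: "\<And>x y x' y'. (x, y) \<in> G \<Longrightarrow> (x', y') \<in> G \<Longrightarrow> (x + x', y + y') \<in> G"
    and scale: "\<And>r x y. (x, y) \<in> G \<Longrightarrow> (r *\<^sub>R x, r *\<^sub>R y) \<in> G"
    and bound: "\<And>x y. (x, y) \<in> G \<Longrightarrow> norm y \<le> norm x"
    and dense: "closure (fst ` G) = UNIV"
  obtains F where "bounded_linear F" "\<And>x y. (x, y) \<in> G \<Longrightarrow> F x = y" "\<And>x. norm (F x) \<le> norm x"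
proof -
  define H where "H z w \<longleftrightarrow> (\<exists>x y. (\<forall>n::nat. (x n, y n) \<in> G) \<and> x \<longlonglongrightarrow> z \<and> y \<longlonglongrightarrow> w)" for z w
  have diff: "(x - x', y - y') \<in> G" if "(x, y) \<in> G" "(x', y') \<in> G" for x y x' y'
    using add[OF that(1) scale[OF that(2), of "-1"]] by simp
  have ex: "\<exists>w. H z w" for z
  proof -
    have "z \<in> closure (fst ` G)" using dense by simp
    then obtain x where x: "\<forall>n. x n \<in> fst ` G" "x \<longlonglongrightarrow> z" using closure_sequential by blast
    then have "\<forall>n. \<exists>y. (x n, y) \<in> G" by force
    then obtain y where y: "\<And>n. (x n, y n) \<in> G" by metis
    have "Cauchy x" using x by (simp add: LIMSEQ_imp_Cauchy)
    have "Cauchy y"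
    proof (rule CauchyI)
      fix e :: real assume "e > 0"
      then obtain M where "\<forall>m\<ge>M. \<forall>n\<ge>M. norm (x m - x n) < e" using \<open>Cauchy x\<close> CauchyD by blast
      then show "\<exists>M. \<forall>m\<ge>M. \<forall>n\<ge>M. norm (y m - y n) < e"
        using bound[OF diff[OF y y]] by (meson le_less_trans)
    qed
    then obtain w where "y \<longlonglongrightarrow> w" using Cauchy_convergent convergent_def by blast
    then show ?thesis unfolding H_def using x y by blast
  qed
  have Hbound: "norm w \<le> norm z" if "H z w" for z w
  proof -
    obtain x y where xy: "\<And>n::nat. (x n, y n) \<in> G" "x \<longlonglongrightarrow> z" "y \<longlonglongrightarrow> w" using \<open>H z w\<close> unfolding H_def by blast
    show ?thesis
      by (rule LIMSEQ_le[OF tendsto_norm[OF xy(3)] tendsto_norm[OF xy(2)]]) (use bound xy in blast)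
  qed
  have Hadd: "H (z + z') (w + w')" if h: "H z w" "H z' w'" for z z' w w'
  proof -
    obtain x y x' y' where "\<And>n::nat. (x n, y n) \<in> G" "x \<longlonglongrightarrow> z" "y \<longlonglongrightarrow> w"
      "\<And>n::nat. (x' n, y' n) \<in> G" "x' \<longlonglongrightarrow> z'" "y' \<longlonglongrightarrow> w'" using h unfolding H_def by blast
    then show ?thesis unfolding H_def
      by (intro exI[of _ "\<lambda>n. x n + x' n"] exI[of _ "\<lambda>n. y n + y' n"]) (auto intro: add tendsto_add)
  qed
  have Hscale: "H (r *\<^sub>R z) (r *\<^sub>R w)" if h: "H z w" for r z w
  proof -
    obtain x y where "\<And>n::nat. (x n, y n) \<in> G" "x \<longlonglongrightarrow> z" "y \<longlonglongrightarrow> w" using h unfolding H_def by blast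
    then show ?thesis unfolding H_def
      by (intro exI[of _ "\<lambda>n. r *\<^sub>R x n"] exI[of _ "\<lambda>n. r *\<^sub>R y n"]) (auto intro: scale tendsto_intros)
  qed
  have uniq: "w = w'" if "H z w" "H z w'" for z w w'
    using Hbound[OF Hadd[OF that(1) Hscale[OF that(2), of "-1"]]] by simp
  define F where "F z = (SOME w. H z w)" for z
  have HF: "H z (F z)" for z unfolding F_def using ex by (rule someI_ex)
  have "bounded_linear F"
  proof (rule bounded_linear_intro[where K = 1])
    show "F (x + y) = F x + F y" for x y using uniq[OF HF Hadd[OF HF HF]] .
    show "F (r *\<^sub>R x) = r *\<^sub>R F x" for r x using uniq[OF HF Hscale[OF HF]] .
    show "norm (F x) \<le> norm x * 1" for x using Hbound[OF HF] by simp
  qed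
  moreover have "F x = y" if "(x, y) \<in> G" for x y
  proof -
    have "H x y" unfolding H_def using that
      by (intro exI[of _ "\<lambda>_. x"] exI[of _ "\<lambda>_. y"]) auto
    then show ?thesis using uniq HF by blast
  qed
  ultimately show ?thesis using that Hbound[OF HF] by blast
qed

section \<open>Product states on a tensor product\<close>

context
  fixes t :: "'a::cstar_algebra \<Rightarrow> 'b::cstar_algebra \<Rightarrow> 'c::cstar_algebra"
  assumes t: "min_tensor t"
begin

lemma t_add_left: "t (a + a') b = t a b + t a' b"
  and t_add_right: "t a (b + b') = t a b + t a b'"
  and t_scaleC_left: "t (c *\<^sub>C a) b = c *\<^sub>C t a b"
  and t_scaleC_right: "t a (c *\<^sub>C b) = c *\<^sub>C t a b"
  and t_mult: "t a b * t a' b' = t (a * a') (b * b')"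
  and t_star: "star (t a b) = t (star a) (star b)"
  and t_one: "t 1 1 = 1"
  and t_independent: "finite B \<Longrightarrow> cvec.independent B \<Longrightarrow> (\<Sum>b\<in>B. t (f b) b) = 0 \<Longrightarrow>
    b \<in> B \<Longrightarrow> f b = 0"
  and t_dense: "closure (cvec.span {t a b |a b. True}) = UNIV"
  and t_least: "cstar_norm_on (cvec.span {t a b |a b. True}) p \<Longrightarrow>
    x \<in> cvec.span {t a b |a b. True} \<Longrightarrow> norm x \<le> p x"
proof -
  note t' = t[unfolded min_tensor_def]
  show "t (a + a') b = t a b + t a' b" "t a (b + b') = t a b + t a b'"
    "t (c *\<^sub>C a) b = c *\<^sub>C t a b" "t a (c *\<^sub>C b) = c *\<^sub>C t a b"
    "t a b * t a' b' = t (a * a') (b * b')" "star (t a b) = t (star a) (star b)" "t 1 1 = 1"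
    using t' by auto
  show "finite B \<Longrightarrow> cvec.independent B \<Longrightarrow> (\<Sum>b\<in>B. t (f b) b) = 0 \<Longrightarrow> b \<in> B \<Longrightarrow> f b = 0"
    using t' by blast
  show "closure (cvec.span {t a b |a b. True}) = UNIV" using t' by blast
  show "cstar_norm_on (cvec.span {t a b |a b. True}) p \<Longrightarrow>
    x \<in> cvec.span {t a b |a b. True} \<Longrightarrow> norm x \<le> p x" using t' by blast
qed

lemma t_scaleR_left: "t (r *\<^sub>R a) b = r *\<^sub>R t a b"
  and t_scaleR_right: "t a (r *\<^sub>R b) = r *\<^sub>R t a b"
  by (metis scaleC_of_real t_scaleC_left, metis scaleC_of_real t_scaleC_right)

lemma t_minus_left: "t (- a) b = - t a b" and t_minus_right: "t a (- b) = - t a b"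
  using t_scaleR_left[of "-1"] t_scaleR_right[of _ "-1"] by simp_all

lemma t_zero_left [simp]: "t 0 b = 0" and t_zero_right [simp]: "t a 0 = 0"
  using t_scaleR_left[of 0 a b] t_scaleR_right[of a 0 b] by (metis scaleR_zero_left t_scaleR_left,
    metis scaleR_zero_left)

lemma t_diff_left: "t (a - a') b = t a b - t a' b"
  and t_diff_right: "t a (b - b') = t a b - t a b'"
  using t_add_left[of a "- a'" b] t_add_right[of a b "- b'"]
  by (simp_all add: t_minus_left t_minus_right)

lemma t_sum_left: "t (sum f A) b = (\<Sum>i\<in>A. t (f i) b)"
  by (induction A rule: infinite_finite_induct) (auto simp: t_add_left)

lemma t_sum_right: "t a (sum f A) = (\<Sum>i\<in>A. t a (f i))"
  by (induction A rule: infinite_finite_induct) (auto simp: t_add_right)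

lemma t_eq_zeroD: "t a b = 0 \<Longrightarrow> b \<noteq> 0 \<Longrightarrow> a = 0"
  using t_independent[of "{b}" "\<lambda>_. a" b] by (simp add: cvec.dependent_single)

lemma span_tensor_sum:
  "x \<in> cvec.span {t a b |a b. True} \<Longrightarrow> \<exists>(n::nat) a b. x = (\<Sum>i<n. t (a i) (b i))"
proof (induction rule: cvec.span_induct_alt)
  case base
  show ?case by (intro exI[of _ 0]) simp
next
  case (step c x y)
  then obtain a0 b0 n a b where x: "x = t a0 b0" and y: "y = (\<Sum>i<n::nat. t (a i) (b i))" by auto
  have "(\<Sum>i<Suc n. t ((a(n := c *\<^sub>C a0)) i) ((b(n := b0)) i)) = c *\<^sub>C x + y"
    unfolding x y by (simp add: t_scaleC_left add.commute)
  then show ?case by metis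
qed

lemma tensor_eqI:
  assumes F: "bounded_linear F" and G: "bounded_linear G" and eq: "\<And>a b. F (t a b) = G (t a b)"
  shows "F z = G z"
proof -
  have "cvec.span {t a b |a b. True} \<subseteq> {z. F z = G z}"
  proof
    fix x assume "x \<in> cvec.span {t a b |a b. True}"
    then obtain n a b where "x = (\<Sum>i<n::nat. t (a i) (b i))" using span_tensor_sum by blast
    then show "x \<in> {z. F z = G z}"
      using eq by (simp add: linear_sum[OF bounded_linear.linear[OF F]]
        linear_sum[OF bounded_linear.linear[OF G]])
  qed
  moreover have "closed {z. F z = G z}"
    by (intro closed_Collect_eq linear_continuous_on F G)
  ultimately show ?thesis using t_dense closure_minimal by blast
qed

lemma pos_tensor: assumes "pos u" "pos v" shows "pos (t u v)"
proof -
  obtain s r where "star s = s" "u = s * s" "star r = r" "v = r * r"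
    using assms unfolding pos_def by blast
  then have "star (t s r) = t s r" "t u v = t s r * t s r" by (auto simp: t_star t_mult)
  then show ?thesis unfolding pos_def by blast
qed

lemma re_part_t_left: "re_part (t a 1) = t (re_part a) 1"
  and re_part_t_right: "re_part (t 1 b) = t 1 (re_part b)"
  by (simp_all add: re_part_def t_star t_add_left t_add_right t_scaleR_left t_scaleR_right)

text \<open>The joint spectrum of \<open>a \<otimes> 1\<close> and \<open>1 \<otimes> b\<close> is the product of the spectra: otherwise bump functions
  of \<open>a\<close> and \<open>b\<close> would have a vanishing tensor product.\<close>

lemma pos_tensor_diff:
  assumes a: "star a = a" and b: "star b = b" and pos: "pos (t a 1 - t 1 b)"
  shows "pos (a - upper b *\<^sub>R 1)"
proof (rule ccontr)
  assume neg: "\<not> pos (a - upper b *\<^sub>R 1)"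
  define x where "x = a - upper b *\<^sub>R 1"
  \<comment> \<open>\<open>- m\<close> is the bottom of the spectrum of \<open>x\<close>, negative
    by assumption. The shifts \<open>x'\<close> and \<open>y\<close> of \<open>a\<close> and
    \<open>- b\<close> are positive with 0 in their spectra.\<close>
  define m where "m = upper (- x)"
  define x' y where "x' = x + m *\<^sub>R 1" and "y = upper b *\<^sub>R 1 - b"
  have sx: "star x = x" unfolding x_def using a by (simp add: star_diff)
  have m: "m > 0"
  proof (rule ccontr)
    assume "\<not> m > 0"
    then have "pos (0 *\<^sub>R 1 - re_part (- x))" unfolding m_def by (simp only: upper_le_iff[symmetric])
    then show False using neg unfolding x_def[symmetric]
      by (simp add: re_part_minus re_part_self_adjoint[OF sx])
  qed
  \<comment> \<open>Window width: two windows allow an error of \<open>2 d\<close>, which has to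
    stay below \<open>m\<close>.\<close>
  define d where "d = m / 4"
  have sa: "star (d *\<^sub>R 1 - x') = d *\<^sub>R 1 - x'" "star (d *\<^sub>R 1 - y) = d *\<^sub>R 1 - y"
    unfolding x'_def y_def using sx b by (auto simp: star_diff star_add)
  \<comment> \<open>\<open>p\<close>, and likewise \<open>q\<close> below, is the positive part of a
    window: a bump supported where \<open>x'\<close> (respectively \<open>y\<close>) is less than
    \<open>d\<close>.\<close>
  obtain p n where p: "star p = p" "d *\<^sub>R 1 - x' = p - n" "p * n = 0" "n * p = 0"
    "pos (p * p * p)" "pos (p + n)" using jordan_decomposition[OF sa(1)] by metis
  obtain q k where q: "star q = q" "d *\<^sub>R 1 - y = q - k" "q * k = 0" "k * q = 0"
    "pos (q * q * q)" "pos (q + k)" using jordan_decomposition[OF sa(2)] by metis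
  have "p \<noteq> 0"
  proof
    assume "p = 0"
    then have "pos (x' - d *\<^sub>R 1)" using p by (metis add_0 diff_0 minus_diff_eq neg_equal_iff_equal)
    then have "pos ((m - d) *\<^sub>R 1 - re_part (- x))" unfolding x'_def
      by (simp add: re_part_minus re_part_self_adjoint[OF sx] algebra_simps)
    then have "m \<le> m - d" unfolding m_def by (rule upper_le)
    then show False using m unfolding d_def by simp
  qed
  have "q \<noteq> 0"
  proof
    assume "q = 0"
    then have "pos (y - d *\<^sub>R 1)" using q by (metis add_0 diff_0 minus_diff_eq neg_equal_iff_equal)
    then have "pos ((upper b - d) *\<^sub>R 1 - re_part b)" unfolding y_def
      by (simp add: re_part_self_adjoint[OF b] algebra_simps)
    then have "upper b \<le> upper b - d" by (rule upper_le)
    then show False using m unfolding d_def by simp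
  qed
  define w where "w = t p q"
  have sw: "star w = w" unfolding w_def using p q by (simp add: t_star)
  have px: "p * x' * p = d *\<^sub>R (p * p) - p * p * p"
  proof -
    have "p * (d *\<^sub>R 1 - x') * p = p * p * p" unfolding p(2) using p(3,4) by (simp add: algebra_simps)
    then show ?thesis by (simp add: algebra_simps)
  qed
  have qy: "q * y * q = d *\<^sub>R (q * q) - q * q * q"
  proof -
    have "q * (d *\<^sub>R 1 - y) * q = q * q * q" unfolding q(2) using q(3,4) by (simp add: algebra_simps)
    then show ?thesis by (simp add: algebra_simps)
  qed
  have z: "t a 1 - t 1 b = t x' 1 + t 1 y - m *\<^sub>R 1"
    unfolding x'_def y_def x_def
    by (simp add: t_add_left t_diff_left t_diff_right t_scaleR_left t_scaleR_right t_one)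
  \<comment> \<open>On the support of \<open>w\<close> the difference
    \<open>a \<otimes> 1 - 1 \<otimes> b = x' + y - m\<close> is at most
    \<open>2 d - m = - m/2\<close>, yet it is assumed positive; so \<open>w = 0\<close>.\<close>
  have "w * (t a 1 - t 1 b) * w = t (p * x' * p) (q * q) + t (p * p) (q * y * q) - m *\<^sub>R (w * w)"
    unfolding z w_def by (simp add: distrib_left distrib_right left_diff_distrib right_diff_distrib t_mult)
  also have "\<dots> = (d - m + d) *\<^sub>R (w * w) - t (p * p * p) (q * q) - t (p * p) (q * q * q)"
    unfolding px qy w_def by (simp add: t_diff_left t_diff_right t_scaleR_left t_scaleR_right t_mult
      algebra_simps) (metis mult_2_right scaleR_left_distrib)
  finally have eq: "w * (t a 1 - t 1 b) * w
      = (d - m + d) *\<^sub>R (w * w) - t (p * p * p) (q * q) - t (p * p) (q * q * q)" .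
  have sq: "pos (p * p)" "pos (q * q)" "pos (w * w)" unfolding pos_def using p q sw by blast+
  have "pos (w * (t a 1 - t 1 b) * w)" using pos_conj[OF pos, of w] sw by simp
  then have "pos ((w * (t a 1 - t 1 b) * w) + t (p * p * p) (q * q) + t (p * p) (q * q * q))"
    using sq p q by (intro pos_add pos_tensor)
  then have "pos ((d - m + d) *\<^sub>R (w * w))" unfolding eq by (simp add: algebra_simps)
  moreover have "d - m + d = - (m / 2)" unfolding d_def by simp
  ultimately have "pos (- ((m / 2) *\<^sub>R (w * w)))" by (simp only: scaleR_minus_left)
  moreover have "pos ((m / 2) *\<^sub>R (w * w))" using sq m by (intro pos_scaleR) auto
  ultimately have "(m / 2) *\<^sub>R (w * w) = 0" by (intro pos_antisym)
  then have "w = 0" using m norm_mult_self[OF sw] by simp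
  then show False using t_eq_zeroD \<open>p \<noteq> 0\<close> \<open>q \<noteq> 0\<close> unfolding w_def by blast
qed

text \<open>The lower bound that makes the functional in \<open>coupling\<close> finite. For the
  real parts, positivity of \<open>l + a \<otimes> 1 - 1 \<otimes> b\<close> is split by
  \<open>pos_tensor_diff\<close> into \<open>l + a\<close> lying above the scalar
  \<open>upper b\<close>; then \<omega> is applied.\<close>

lemma upper_tensor:
  assumes "state \<omega>"
  shows "upper b \<le> upper (t 1 b - t a 1) + Re (\<omega> a)"
proof -
  let ?l = "upper (t 1 b - t a 1)"
  have "pos (?l *\<^sub>R 1 - re_part (t 1 b - t a 1))" by (rule pos_upper)
  also have "?l *\<^sub>R 1 - re_part (t 1 b - t a 1) = t (?l *\<^sub>R 1 + re_part a) 1 - t 1 (re_part b)"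
    using re_part_add[of "t 1 b" "- t a 1"]
    by (simp add: re_part_minus re_part_t_left re_part_t_right t_add_left t_scaleR_left t_one)
  finally have "pos ((?l *\<^sub>R 1 + re_part a) - upper (re_part b) *\<^sub>R 1)"
    by (rule pos_tensor_diff[rotated 2]) (simp_all add: star_add)
  moreover have "upper (re_part b) = upper b"
    unfolding upper_def re_part_self_adjoint[OF star_re_part] ..
  ultimately have "pos ((?l - upper b) *\<^sub>R 1 - re_part (- a))"
    by (simp add: re_part_minus algebra_simps)
  then have "Re (\<omega> (- a)) \<le> ?l - upper b" using upper_le state_le_upper[OF assms, of "- a"] by fastforce
  then show ?thesis by (simp add: state_minus[OF assms])
qed

text \<open>Hahn-Banach with a bound that encodes the marginal: functionals below \<open>q\<close>
  lie below \<open>upper\<close>, hence give states, and agree with \<omega> on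
  \<open>a \<otimes> 1\<close> because both \<open>a\<close> and \<open>- a\<close> may be
  subtracted. By \<open>upper_tensor\<close>, \<open>q\<close> is at least \<open>upper b\<close> at
  \<open>1 \<otimes> b\<close>.\<close>

lemma coupling:
  assumes w: "state \<omega>"
  obtains \<tau> where "state \<tau>" "\<And>a. \<tau> (t a 1) = \<omega> a" "upper b \<le> Re (\<tau> (t 1 b))"
proof -
  define q where "q x = (INF a. upper (x - t a 1) + Re (\<omega> a))" for x
  have bdd: "bdd_below (range (\<lambda>a. upper (x - t a 1) + Re (\<omega> a)))" for x
  proof (rule bdd_belowI2)
    fix a
    have "0 \<le> upper (- t a 1) + Re (\<omega> a)" using upper_tensor[OF w, of 0 a] by simp
    then show "- upper (- x) \<le> upper (x - t a 1) + Re (\<omega> a)"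
      using upper_add[of "x - t a 1" "- x"] by simp
  qed
  have q: "sublinear q" unfolding q_def
  proof (rule sublinear_INF)
    show "upper (x + y - t (a + a') 1) + Re (\<omega> (a + a')) \<le>
        upper (x - t a 1) + Re (\<omega> a) + (upper (y - t a' 1) + Re (\<omega> a'))" for x y a a'
      using upper_add[of "x - t a 1" "y - t a' 1"]
      by (simp add: t_add_left state_add[OF w] algebra_simps)
    show "upper (c *\<^sub>R x - t (c *\<^sub>R a) 1) + Re (\<omega> (c *\<^sub>R a)) = c * (upper (x - t a 1) + Re (\<omega> a))"
      if "c > 0" for c x a
      using that upper_scaleR[of c "x - t a 1"]
      by (simp add: t_scaleR_left state_scaleR[OF w] algebra_simps)
    show "0 \<le> upper (0 - t a 1) + Re (\<omega> a)" for a using upper_tensor[OF w, of 0 a] by simp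
  qed (use bdd in \<open>simp_all add: state_zero[OF w]\<close>)
  obtain f where f: "linear f" "\<And>x. f x \<le> q x" "f (t 1 b) = q (t 1 b)"
    using sublinear_extreme[OF q] by metis
  have qle: "q x \<le> upper (x - t a 1) + Re (\<omega> a)" for x a
    unfolding q_def by (rule cINF_lower[OF bdd]) simp
  have fu: "f x \<le> upper x" for x using f(2)[of x] qle[of x 0] by (simp add: state_zero[OF w])
  have fa: "f (t a 1) = Re (\<omega> a)" for a
    using f(2)[of "t a 1"] qle[of "t a 1" a] f(2)[of "- t a 1"] qle[of "- t a 1" "- a"]
    by (simp add: linear_neg[OF f(1)] t_minus_left state_minus[OF w])
  let ?t = "\<lambda>x. Complex (f x) (- f (\<i> *\<^sub>C x))"
  show ?thesis
  proof (rule that)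
    show "state ?t" by (rule stateI_upper[OF f(1) fu])
    show "?t (t a 1) = \<omega> a" for a
      using fa[of a] fa[of "\<i> *\<^sub>C a"] by (simp add: t_scaleC_left state_scaleC[OF w] complex_eq_iff)
    show "upper b \<le> Re (?t (t 1 b))"
      using upper_tensor[OF w, of b] unfolding complex.sel f(3) q_def by (intro cINF_greatest) auto
  qed
qed

text \<open>For \<open>b\<close> between 0 and 1 the functionals \<open>\<tau> (t a b)\<close> and
  \<open>\<tau> (t a (1 - b))\<close> of \<open>a\<close> add up to \<omega>, so purity makes both
  multiples of \<omega>. General \<open>b\<close> follow by affine rescaling and by real and
  imaginary parts.\<close>

lemma pure_marginal:
  assumes pure: "pure_state \<omega>" and tau: "state \<tau>" and marg: "\<And>a. \<tau> (t a 1) = \<omega> a"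
  shows "\<tau> (t a b) = \<omega> a * \<tau> (t 1 b)"
proof -
  have w: "state \<omega>" using pure unfolding pure_state_def by simp
  \<comment> \<open>Adding a multiple of \<omega> brings the mass to 1 without division by
    \<open>\<tau> (t 1 c)\<close>, which may vanish.\<close>
  have st: "state (\<lambda>a. \<tau> (t a c) + of_real r * \<omega> a)"
    if c: "pos c" and r: "r \<ge> 0" "Re (\<tau> (t 1 c)) + r = 1" for c r
    unfolding state_def
  proof (intro conjI allI)
    fix x y k
    show "\<tau> (t (x + y) c) + of_real r * \<omega> (x + y) =
        \<tau> (t x c) + of_real r * \<omega> x + (\<tau> (t y c) + of_real r * \<omega> y)"
      by (simp add: t_add_left state_add[OF tau] state_add[OF w] algebra_simps)
    show "\<tau> (t (k *\<^sub>C x) c) + of_real r * \<omega> (k *\<^sub>C x) = k * (\<tau> (t x c) + of_real r * \<omega> x)"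
      by (simp add: t_scaleC_left state_scaleC[OF tau] state_scaleC[OF w] algebra_simps)
    have "star (t 1 c) = t 1 c" using pos_star[OF c] by (simp add: t_star)
    from state_self_adjoint[OF tau this] r(2)
    show "\<tau> (t 1 c) + of_real r * \<omega> 1 = 1"
      by (metis mult.right_neutral of_real_1 of_real_add state_one[OF w])
    have "star (t x c) = t (star x) c" using pos_star[OF c] by (simp add: t_star)
    then have "\<tau> (t (star x) c) = cnj (\<tau> (t x c))" by (metis state_star[OF tau])
    then show "\<tau> (t (star x) c) + of_real r * \<omega> (star x) = cnj (\<tau> (t x c) + of_real r * \<omega> x)"
      by (simp add: state_star[OF w])
    show "0 \<le> Re (\<tau> (t (star x * x) c) + of_real r * \<omega> (star x * x))"
      using state_pos[OF tau pos_tensor[OF pos_star_mult_self c], of x] state_square[OF w, of x] r(1)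
      by simp
  qed
  have unit: "\<tau> (t a b) = \<omega> a * \<tau> (t 1 b)" if b: "pos b" "pos (1 - b)" for b
  proof -
    define l where "l = Re (\<tau> (t 1 b))"
    have t1b: "\<tau> (t 1 b) = of_real l" unfolding l_def
      by (rule state_self_adjoint[OF tau]) (simp add: t_star pos_star[OF b(1)])
    have t1b': "\<tau> (t x (1 - b)) = \<omega> x - \<tau> (t x b)" for x
      by (simp add: t_diff_right state_diff[OF tau] marg)
    have l: "0 \<le> l" "l \<le> 1"
      using state_pos[OF tau pos_tensor[OF pos_one b(1)]] state_pos[OF tau pos_tensor[OF pos_one b(2)]]
      unfolding t1b' t1b by (simp_all add: state_one[OF w])
    have "(\<lambda>a. \<tau> (t a b) + of_real (1 - l) * \<omega> a) = \<omega>"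
    proof (rule pure[unfolded pure_state_def, THEN conjunct2, rule_format])
      show "state (\<lambda>a. \<tau> (t a b) + of_real (1 - l) * \<omega> a)"
        by (rule st) (use b l t1b in auto)
      show "state (\<lambda>a. \<tau> (t a (1 - b)) + of_real l * \<omega> a)"
        by (rule st) (use b l t1b' t1b state_one[OF w] in auto)
      show "\<omega> x = (\<tau> (t x b) + of_real (1 - l) * \<omega> x + (\<tau> (t x (1 - b)) + of_real l * \<omega> x)) / 2" for x
        unfolding t1b' by (simp add: algebra_simps)
    qed
    then show ?thesis using t1b by (simp add: fun_eq_iff algebra_simps) (metis add_diff_cancel_left'
      diff_add_cancel)
  qed
  have sa: "\<tau> (t a b) = \<omega> a * \<tau> (t 1 b)" if b: "star b = b" for b
  proof -
    \<comment> \<open>The 1 excludes \<open>K = 0\<close>. As \<open>- K \<le> b \<le> K\<close>,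
      the element \<open>(K + b) / (2 K)\<close> lies between 0 and 1.\<close>
    define K where "K = norm b + 1"
    have K: "K > 0" unfolding K_def by (simp add: add_nonneg_pos)
    define b' where "b' = (1 / (2 * K)) *\<^sub>R (K *\<^sub>R 1 + b)"
    have K1: "K *\<^sub>R 1 + b = (norm b *\<^sub>R 1 + b) + 1" "K *\<^sub>R 1 - b = (norm b *\<^sub>R 1 - b) + 1"
      unfolding K_def by (auto simp: algebra_simps)
    have "pos (K *\<^sub>R 1 + b)" "pos (K *\<^sub>R 1 - b)"
      unfolding K1 by (intro pos_add pos_norm_plus pos_norm_minus pos_one b)+
    moreover have "1 - b' = (1 / (2 * K)) *\<^sub>R (K *\<^sub>R 1 - b)"
      unfolding b'_def using K by (simp add: algebra_simps) (simp flip: scaleR_left_distrib)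
    ultimately have "pos b'" "pos (1 - b')" unfolding b'_def[symmetric] using K
      by (auto simp: b'_def intro!: pos_scaleR)
    then have u: "\<tau> (t a b') = \<omega> a * \<tau> (t 1 b')" by (rule unit)
    have "b = (2 * K) *\<^sub>R b' - K *\<^sub>R 1" unfolding b'_def using K by simp
    then have "t x b = (2 * K) *\<^sub>R t x b' - K *\<^sub>R t x 1" for x
      by (simp add: t_diff_right t_scaleR_right)
    then have eq: "\<tau> (t x b) = of_real (2 * K) * \<tau> (t x b') - of_real K * \<omega> x" for x
      by (simp add: state_diff[OF tau] state_scaleR[OF tau] marg)
    show ?thesis unfolding eq u by (simp add: state_one[OF w] algebra_simps)
  qed
  obtain p q where pq: "star p = p" "star q = q" "b = p + \<i> *\<^sub>C q" using scaleC_re_im by blast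
  then show ?thesis using sa[OF pq(1)] sa[OF pq(2)]
    by (simp add: t_add_right t_scaleC_right state_add[OF tau] state_scaleC[OF tau] algebra_simps)
qed

text \<open>First for a pure \<rho>: couplings with first marginal \<rho> factorize, so the slice
  \<open>y\<close> of the positive element has \<open>upper (- y) \<le> 0\<close> and any \<phi> is
  nonnegative on it. Hence the slice \<open>z\<close> by \<phi> is nonnegative at all pure states,
  and so at \<omega>. The constant \<open>c\<close> lets the same statement yield upper
  bounds.\<close>

lemma product_state_nonneg:
  assumes "finite I" and phi: "state \<phi>" and w: "state \<omega>"
    and pos: "pos (c *\<^sub>R 1 + (\<Sum>i\<in>I. t (a i) (b i)))"
  shows "0 \<le> c + Re (\<Sum>i\<in>I. \<omega> (a i) * \<phi> (b i))"
proof -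
  let ?x = "c *\<^sub>R 1 + (\<Sum>i\<in>I. t (a i) (b i))"
  have pure: "0 \<le> c + Re (\<Sum>i\<in>I. \<rho> (a i) * \<phi> (b i))" if rho: "pure_state \<rho>" for \<rho>
  proof -
    have r: "state \<rho>" using rho unfolding pure_state_def by simp
    define y where "y = c *\<^sub>R 1 + (\<Sum>i\<in>I. \<rho> (a i) *\<^sub>C b i)"
    obtain \<tau> where tau: "state \<tau>" "\<And>a. \<tau> (t a 1) = \<rho> a" "upper (- y) \<le> Re (\<tau> (t 1 (- y)))"
      using coupling[OF r] by metis
    have "(\<Sum>i\<in>I. \<tau> (t (a i) (b i))) = (\<Sum>i\<in>I. \<rho> (a i) * \<tau> (t 1 (b i)))"
      by (intro sum.cong refl pure_marginal[OF rho tau(1,2)])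
    then have "\<tau> ?x = \<tau> (t 1 y)"
      unfolding y_def
      by (simp add: t_add_right t_sum_right t_scaleR_right t_scaleC_right t_one state_add[OF tau(1)]
        state_sum[OF tau(1)] state_scaleC[OF tau(1)])
    then have "upper (- y) \<le> 0"
      using tau(3) state_pos[OF tau(1) pos] by (simp add: t_minus_right state_minus[OF tau(1)])
    then have "0 \<le> Re (\<phi> y)" using state_le_upper[OF phi, of "- y"] by (simp add: state_minus[OF phi])
    then show ?thesis
      unfolding y_def by (simp add: state_add[OF phi] state_scaleR[OF phi] state_one[OF phi]
        state_sum[OF phi] state_scaleC[OF phi])
  qed
  define z where "z = c *\<^sub>R 1 + (\<Sum>i\<in>I. \<phi> (b i) *\<^sub>C a i)"
  have z: "\<rho> z = of_real c + (\<Sum>i\<in>I. \<rho> (a i) * \<phi> (b i))" if "state \<rho>" for \<rho>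
    unfolding z_def using that by (simp add: state_add state_scaleR state_one state_sum state_scaleC
      mult.commute)
  have "pos (re_part z)"
  proof (rule pos_if_states)
    fix \<rho> :: "'a \<Rightarrow> complex" assume "pure_state \<rho>"
    then show "0 \<le> Re (\<rho> z)" using pure[of \<rho>] z[of \<rho>] unfolding pure_state_def by simp
  qed
  then have "upper (- z) \<le> 0" by (simp add: upper_le_iff re_part_minus)
  then have "0 \<le> Re (\<omega> z)" using state_le_upper[OF w, of "- z"] by (simp add: state_minus[OF w])
  then show ?thesis using z[OF w] by simp
qed

text \<open>The functional \<omega> \<otimes> \<phi> at \<open>star x * x\<close> and at
  \<open>norm x\<close> squared minus \<open>star x * x\<close>, spelled out in sums because it is
  not yet defined on the algebra.\<close>

lemma product_state_square:
  assumes I: "finite I" and phi: "state \<phi>" and w: "state \<omega>"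
  shows "0 \<le> Re (\<Sum>i\<in>I. \<Sum>j\<in>I. \<omega> (star (a i) * a j) * \<phi> (star (b i) * b j))"
    and "Re (\<Sum>i\<in>I. \<Sum>j\<in>I. \<omega> (star (a i) * a j) * \<phi> (star (b i) * b j))
      \<le> (norm (\<Sum>i\<in>I. t (a i) (b i)))\<^sup>2"
proof -
  let ?x = "\<Sum>i\<in>I. t (a i) (b i)"
  have xx: "star ?x * ?x = (\<Sum>(i,j)\<in>I \<times> I. t (star (a i) * a j) (star (b i) * b j))"
    unfolding star_sum by (simp add: t_star sum_product t_mult sum.cartesian_product)
  have "pos (0 *\<^sub>R 1 + (\<Sum>k\<in>I \<times> I. t (star (a (fst k)) * a (snd k)) (star (b (fst k)) * b (snd k))))"
    using pos_star_mult_self[of ?x] unfolding xx by (simp add: case_prod_beta)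
  from product_state_nonneg[OF _ phi w this]
  show "0 \<le> Re (\<Sum>i\<in>I. \<Sum>j\<in>I. \<omega> (star (a i) * a j) * \<phi> (star (b i) * b j))"
    using I by (simp add: sum.cartesian_product case_prod_beta)
  have "pos ((norm ?x)\<^sup>2 *\<^sub>R 1 +
      (\<Sum>k\<in>I \<times> I. t (- (star (a (fst k)) * a (snd k))) (star (b (fst k)) * b (snd k))))"
    using pos_norm_sq_minus[of ?x] unfolding xx
    by (simp add: case_prod_beta t_minus_left sum_negf del: Re_sum)
  from product_state_nonneg[OF _ phi w this]
  show "Re (\<Sum>i\<in>I. \<Sum>j\<in>I. \<omega> (star (a i) * a j) * \<phi> (star (b i) * b j)) \<le> (norm ?x)\<^sup>2"
    using I by (simp add: sum.cartesian_product case_prod_beta state_minus[OF w] sum_negf del: Re_sum)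
qed

text \<open>With \<open>y\<close> the slice of \<open>x\<close>, positivity of \<omega> \<otimes>
  \<phi> at the square of \<open>x - y \<otimes> 1\<close> says that
  \<open>\<omega> (star y * y)\<close> is at most the value at \<open>star x * x\<close>.\<close>

lemma slice_bound:
  fixes I :: "nat set"
  assumes I: "finite I" and phi: "state \<phi>"
  shows "norm (\<Sum>i\<in>I. \<phi> (b i) *\<^sub>C a i) \<le> norm (\<Sum>i\<in>I. t (a i) (b i))"
proof (rule norm_le_if_states)
  fix \<omega> :: "'a \<Rightarrow> complex" assume w: "state \<omega>"
  let ?y = "\<Sum>i\<in>I. \<phi> (b i) *\<^sub>C a i"
  let ?S = "\<Sum>i\<in>I. \<Sum>j\<in>I. \<omega> (star (a i) * a j) * \<phi> (star (b i) * b j)"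
  \<comment> \<open>The index \<open>None\<close> carries the extra term
    \<open>- y \<otimes> 1\<close>.\<close>
  define a' where "a' k = (case k of None \<Rightarrow> - ?y | Some i \<Rightarrow> a i)" for k
  define b' where "b' k = (case k of None \<Rightarrow> 1 | Some i \<Rightarrow> b i)" for k
  have sumK: "(\<Sum>k\<in>insert None (Some ` I). g k) = g None + (\<Sum>i\<in>I. g (Some i))"
    for g :: "nat option \<Rightarrow> complex"
    using I by (simp add: sum.insert_remove sum.reindex)
  have y1: "(\<Sum>j\<in>I. \<omega> (star (- ?y) * a j) * \<phi> (star 1 * b j)) = - \<omega> (star ?y * ?y)"
  proof -
    have "star ?y * ?y = (\<Sum>j\<in>I. \<phi> (b j) *\<^sub>C (star ?y * a j))"
      by (simp add: sum_distrib_left mult_scaleC_right)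
    then have "\<omega> (star ?y * ?y) = (\<Sum>j\<in>I. \<phi> (b j) * \<omega> (star ?y * a j))"
      by (simp only: state_sum[OF w] state_scaleC[OF w])
    then show ?thesis by (simp add: state_minus[OF w] sum_negf mult.commute)
  qed
  have y2: "(\<Sum>i\<in>I. \<omega> (star (a i) * (- ?y)) * \<phi> (star (b i) * 1)) = - \<omega> (star ?y * ?y)"
  proof -
    have "star ?y * ?y = (\<Sum>i\<in>I. cnj (\<phi> (b i)) *\<^sub>C (star (a i) * ?y))"
      unfolding star_sum by (simp add: sum_distrib_right star_scaleC mult_scaleC_left)
    then have "\<omega> (star ?y * ?y) = (\<Sum>i\<in>I. cnj (\<phi> (b i)) * \<omega> (star (a i) * ?y))"
      by (simp only: state_sum[OF w] state_scaleC[OF w])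
    then show ?thesis by (simp add: state_minus[OF w] sum_negf state_star[OF phi] mult.commute)
  qed
  have "(\<Sum>i\<in>insert None (Some ` I). \<Sum>j\<in>insert None (Some ` I).
      \<omega> (star (a' i) * a' j) * \<phi> (star (b' i) * b' j)) = ?S - \<omega> (star ?y * ?y)"
    unfolding sumK by (simp only: a'_def b'_def option.case sum.distrib y1 y2)
      (simp add: state_one[OF phi])
  then have "Re (\<omega> (star ?y * ?y)) \<le> Re ?S"
    using product_state_square(1)[OF _ phi w, of "insert None (Some ` I)" a' b'] I
    by (simp del: Re_sum)
  also have "\<dots> \<le> (norm (\<Sum>i\<in>I. t (a i) (b i)))\<^sup>2" by (rule product_state_square(2)[OF I phi w])
  finally show "Re (\<omega> (star ?y * ?y)) \<le> (norm (\<Sum>i\<in>I. t (a i) (b i)))\<^sup>2" .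
qed simp

end

text \<open>\<open>slice t \<phi>\<close> is the slice map \<open>id \<otimes> \<phi>\<close>.\<close>

definition slice :: "('a::cstar_algebra \<Rightarrow> 'b::cstar_algebra \<Rightarrow> 'c::cstar_algebra) \<Rightarrow>
    ('b \<Rightarrow> complex) \<Rightarrow> 'c \<Rightarrow> 'a" where
  "slice t \<phi> = (SOME F. bounded_linear F \<and> (\<forall>a b. F (t a b) = \<phi> b *\<^sub>C a))"

context
  fixes t :: "'a::cstar_algebra \<Rightarrow> 'b::cstar_algebra \<Rightarrow> 'c::cstar_algebra" and \<phi> :: "'b \<Rightarrow> complex"
  assumes t: "min_tensor t" and phi: "state \<phi>"
begin

lemma slice_exists: "\<exists>F. bounded_linear F \<and> (\<forall>a b. F (t a b) = \<phi> b *\<^sub>C a)"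
proof -
  define G where "G = {(\<Sum>i<n::nat. t (a i) (b i), \<Sum>i<n. \<phi> (b i) *\<^sub>C a i) |n a b. True}"
  have mem: "(\<Sum>i<n::nat. t (a i) (b i), \<Sum>i<n. \<phi> (b i) *\<^sub>C a i) \<in> G" for n a b
    unfolding G_def by blast
  obtain F where F: "bounded_linear F" "\<And>x y. (x, y) \<in> G \<Longrightarrow> F x = y"
  proof (rule dense_contraction_extension[of G])
    fix x y x' y' assume "(x, y) \<in> G" "(x', y') \<in> G"
    then obtain n a b n' a' b' where e: "x = (\<Sum>i<n::nat. t (a i) (b i))" "y = (\<Sum>i<n. \<phi> (b i) *\<^sub>C a i)"
      "x' = (\<Sum>i<n'::nat. t (a' i) (b' i))" "y' = (\<Sum>i<n'. \<phi> (b' i) *\<^sub>C a' i)"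
      unfolding G_def by auto
    define a2 b2 where "a2 i = (if i < n then a i else a' (i - n))"
      and "b2 i = (if i < n then b i else b' (i - n))" for i
    have split: "(\<Sum>i<n + n'. g i) = (\<Sum>i<n. g i) + (\<Sum>i<n'. g (n + i))" for g :: "nat \<Rightarrow> 'd::comm_monoid_add"
      by (induction n') (simp_all add: add.assoc)
    have "x + x' = (\<Sum>i<n + n'. t (a2 i) (b2 i))" "y + y' = (\<Sum>i<n + n'. \<phi> (b2 i) *\<^sub>C a2 i)"
      unfolding split e a2_def b2_def by simp_all
    then show "(x + x', y + y') \<in> G" by (metis mem)
  next
    fix r x y assume "(x, y) \<in> G"
    then obtain n a b where e: "x = (\<Sum>i<n::nat. t (a i) (b i))" "y = (\<Sum>i<n. \<phi> (b i) *\<^sub>C a i)"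
      unfolding G_def by auto
    have "r *\<^sub>R x = (\<Sum>i<n. t (r *\<^sub>R a i) (b i))" "r *\<^sub>R y = (\<Sum>i<n. \<phi> (b i) *\<^sub>C (r *\<^sub>R a i))"
      unfolding e scaleR_sum_right
      by (simp_all add: t_scaleR_left[OF t] linear_scale[OF bounded_linear.linear[OF bounded_linear_scaleC]])
    then show "(r *\<^sub>R x, r *\<^sub>R y) \<in> G" by (metis mem)
  next
    fix x y assume "(x, y) \<in> G"
    then show "norm y \<le> norm x" unfolding G_def using slice_bound[OF t _ phi] by auto
  next
    have "cvec.span {t a b |a b. True} \<subseteq> fst ` G"
      using span_tensor_sum[OF t] unfolding G_def by (force simp: image_iff)
    then show "closure (fst ` G) = UNIV" using t_dense[OF t] closure_mono by blast
  qed blast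
  have "F (t a b) = \<phi> b *\<^sub>C a" for a b
  proof (rule F(2))
    show "(t a b, \<phi> b *\<^sub>C a) \<in> G" using mem[where n = 1 and a = "\<lambda>_. a" and b = "\<lambda>_. b"] by simp
  qed
  then show ?thesis using F(1) by blast
qed

lemma bounded_linear_slice: "bounded_linear (slice t \<phi>)"
  and slice_tensor [simp]: "slice t \<phi> (t a b) = \<phi> b *\<^sub>C a"
  using someI_ex[OF slice_exists] unfolding slice_def by auto

lemmas slice_add = linear_add[OF bounded_linear.linear[OF bounded_linear_slice]]
  and slice_diff = linear_diff[OF bounded_linear.linear[OF bounded_linear_slice]]
  and slice_sum = linear_sum[OF bounded_linear.linear[OF bounded_linear_slice]]

lemma slice_one [simp]: "slice t \<phi> 1 = 1"
  using slice_tensor[of 1 1] by (simp add: t_one[OF t] state_one[OF phi] del: slice_tensor)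

lemma slice_mult_left: "slice t \<phi> (t x 1 * z) = x * slice t \<phi> z"
  by (rule tensor_eqI[OF t])
    (auto simp: t_mult[OF t] mult_scaleC_right intro: bounded_linear_compose[OF bounded_linear_slice]
      bounded_linear_compose[OF bounded_linear_mult_right] bounded_linear_mult_right bounded_linear_slice)

lemma slice_mult_right: "slice t \<phi> (z * t x 1) = slice t \<phi> z * x"
  by (rule tensor_eqI[OF t])
    (auto simp: t_mult[OF t] mult_scaleC_left intro: bounded_linear_compose[OF bounded_linear_slice]
      bounded_linear_compose[OF bounded_linear_mult_left] bounded_linear_mult_left bounded_linear_slice)

lemma slice_star: "slice t \<phi> (star z) = star (slice t \<phi> z)"
  by (rule tensor_eqI[OF t])
    (auto simp: t_star[OF t] star_scaleC state_star[OF phi] intro: bounded_linear_compose[OF bounded_linear_slice]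
      bounded_linear_compose[OF bounded_linear_star] bounded_linear_star bounded_linear_slice)

lemma slice_scaleC: "slice t \<phi> (c *\<^sub>C z) = c *\<^sub>C slice t \<phi> z"
  by (rule tensor_eqI[OF t])
    (auto simp: t_scaleC_left[OF t, symmetric] scaleC_scaleC mult.commute
      intro: bounded_linear_compose[OF bounded_linear_slice]
      bounded_linear_compose[OF bounded_linear_scaleC] bounded_linear_scaleC bounded_linear_slice)

text \<open>This is the product state \<omega> \<otimes> \<phi>: positive on finite sums of
  elementary tensors, and elsewhere by density and continuity.\<close>

lemma state_slice: assumes w: "state \<omega>" shows "state (\<lambda>z. \<omega> (slice t \<phi> z))"
  unfolding state_def
proof (intro conjI allI)
  fix x y c
  show "\<omega> (slice t \<phi> (x + y)) = \<omega> (slice t \<phi> x) + \<omega> (slice t \<phi> y)"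
    by (simp add: slice_add state_add[OF w])
  show "\<omega> (slice t \<phi> (c *\<^sub>C x)) = c * \<omega> (slice t \<phi> x)"
    by (simp add: slice_scaleC state_scaleC[OF w])
  show "\<omega> (slice t \<phi> 1) = 1" by (simp add: state_one[OF w])
  show "\<omega> (slice t \<phi> (star x)) = cnj (\<omega> (slice t \<phi> x))"
    by (simp add: slice_star state_star[OF w])
  have "x \<in> closure (cvec.span {t a b |a b. True})" using t_dense[OF t] by simp
  then obtain s where s: "\<forall>n. s n \<in> cvec.span {t a b |a b. True}" "s \<longlonglongrightarrow> x"
    using closure_sequential by blast
  have sq: "0 \<le> Re (\<omega> (slice t \<phi> (star y * y)))" if "y \<in> cvec.span {t a b |a b. True}" for y
  proof -
    obtain n a b where y: "y = (\<Sum>i<n::nat. t (a i) (b i))" using span_tensor_sum[OF t \<open>y \<in> _\<close>] by blast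
    have "star y * y = (\<Sum>i<n. \<Sum>j<n. t (star (a i) * a j) (star (b i) * b j))"
      unfolding y star_sum by (simp add: t_star[OF t] sum_product t_mult[OF t])
    then have "\<omega> (slice t \<phi> (star y * y)) = (\<Sum>i<n. \<Sum>j<n. \<omega> (star (a i) * a j) * \<phi> (star (b i) * b j))"
      by (simp add: slice_sum state_sum[OF w] state_scaleC[OF w] mult.commute)
    then show ?thesis using product_state_square(1)[OF t _ phi w, of "{..<n}" a b] by simp
  qed
  have "(\<lambda>n. Re (\<omega> (slice t \<phi> (star (s n) * s n)))) \<longlonglongrightarrow> Re (\<omega> (slice t \<phi> (star x * x)))"
    by (intro tendsto_Re bounded_linear.tendsto[OF state_bounded_linear[OF w]] s(2)
      bounded_linear.tendsto[OF bounded_linear_slice] tendsto_mult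
      bounded_linear.tendsto[OF bounded_linear_star])
  then show "0 \<le> Re (\<omega> (slice t \<phi> (star x * x)))"
    by (rule LIMSEQ_le_const) (use s(1) sq in blast)
qed

end

text \<open>Independence is the clause that distinguishes the factors. The right entries are
  expanded in a basis \<open>C\<close> of their span, and collecting terms along \<open>C\<close>
  reduces the claim to the independence of \<open>B\<close> itself.\<close>

lemma min_tensor_flip:
  assumes t: "min_tensor t" shows "min_tensor (\<lambda>b a. t a b)"
  unfolding min_tensor_def
proof (intro conjI allI impI ballI)
  have eq: "{t b a |a b. True} = {t a b |a b. True}" by auto
  show "closure (cvec.span {t b a |a b. True}) = UNIV" unfolding eq by (rule t_dense[OF t])
  fix p x assume "cstar_norm_on (cvec.span {t b a |a b. True}) p" "x \<in> cvec.span {t b a |a b. True}"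
  then show "norm x \<le> p x" unfolding eq by (rule t_least[OF t])
next
  fix B f b assume B: "finite B" "cvec.independent B" and sum: "(\<Sum>b\<in>B. t b (f b)) = 0" and b: "b \<in> B"
  obtain C where C: "C \<subseteq> f ` B" "cvec.independent C" "f ` B \<subseteq> cvec.span C"
    using cvec.maximal_independent_subset[of "f ` B"] by blast
  have fC: "finite C" using C(1) B(1) finite_surj by blast
  have "\<forall>b\<in>B. \<exists>r. f b = (\<Sum>c\<in>C. r c *\<^sub>C c)"
    using C(3) cvec.span_finite[OF fC] by auto
  then obtain r where r: "\<And>b. b \<in> B \<Longrightarrow> f b = (\<Sum>c\<in>C. r b c *\<^sub>C c)" by metis
  have "(\<Sum>b\<in>B. t b (f b)) = (\<Sum>b\<in>B. \<Sum>c\<in>C. t (r b c *\<^sub>C b) c)"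
    by (intro sum.cong refl) (simp add: r t_sum_right[OF t] t_scaleC_left[OF t] t_scaleC_right[OF t])
  also have "\<dots> = (\<Sum>c\<in>C. t (\<Sum>b\<in>B. r b c *\<^sub>C b) c)"
    by (subst sum.swap) (simp add: t_sum_left[OF t])
  finally have "(\<Sum>b\<in>B. r b c *\<^sub>C b) = 0" if "c \<in> C" for c
    using t_independent[OF t fC C(2), of "\<lambda>c. \<Sum>b\<in>B. r b c *\<^sub>C b" c] sum that by simp
  then have "r b c = 0" if "c \<in> C" for c
    using cvec.independentD[OF B(2) B(1) order_refl, of "\<lambda>b. r b c" b] that b by simp
  then show "f b = 0" using r[OF b] by simp
qed (simp_all add: t_add_left[OF t] t_add_right[OF t] t_scaleC_left[OF t] t_scaleC_right[OF t]
  t_mult[OF t] t_star[OF t] t_one[OF t])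

lemma slice_fubini:
  assumes t: "min_tensor t" and phi: "state \<phi>" and w: "state \<omega>"
  shows "\<phi> (slice (\<lambda>b a. t a b) \<omega> z) = \<omega> (slice t \<phi> z)"
proof (rule tensor_eqI[OF t])
  note f = min_tensor_flip[OF t]
  show "bounded_linear (\<lambda>z. \<phi> (slice (\<lambda>b a. t a b) \<omega> z))"
    by (rule bounded_linear_compose[OF state_bounded_linear[OF phi] bounded_linear_slice[OF f w]])
  show "bounded_linear (\<lambda>z. \<omega> (slice t \<phi> z))"
    by (rule bounded_linear_compose[OF state_bounded_linear[OF w] bounded_linear_slice[OF t phi]])
  show "\<phi> (slice (\<lambda>b a. t a b) \<omega> (t a b)) = \<omega> (slice t \<phi> (t a b))" for a b
    using slice_tensor[OF f w] by (simp add: slice_tensor[OF t phi] state_scaleC[OF phi] state_scaleC[OF w])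
qed

section \<open>The Haar state\<close>

text \<open>The real part is positive with both signs, hence 0; the same for \<open>i x\<close>
  takes care of the imaginary part.\<close>

lemma states_separate:
  assumes "\<And>\<omega> :: 'a::cstar_algebra \<Rightarrow> complex. state \<omega> \<Longrightarrow> \<omega> x = 0" shows "x = 0"
proof -
  have z: "re_part y = 0" if "\<And>\<omega> :: 'a \<Rightarrow> complex. state \<omega> \<Longrightarrow> Re (\<omega> y) = 0" for y
  proof (rule pos_antisym)
    show "pos (re_part y)" using that by (intro pos_if_states) (simp add: pure_state_def)
    have "pos (re_part (- y))"
      using that by (intro pos_if_states) (simp add: pure_state_def state_minus)
    then show "pos (- re_part y)" by (simp add: re_part_minus)
  qed
  have "re_part x = 0" by (rule z) (simp add: assms)
  moreover have "re_part (\<i> *\<^sub>C x) = 0" by (rule z) (simp add: assms state_scaleC)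
  then have "\<i> *\<^sub>C x - \<i> *\<^sub>C star x = 0" by (simp add: re_part_def star_scaleC)
  then have "star x = x" by (simp flip: cvec.scale_right_diff_distrib)
  ultimately show ?thesis by (simp add: re_part_self_adjoint)
qed

lemma pos_slice:
  assumes t: "min_tensor t" and phi: "state \<phi>" and z: "pos z" shows "pos (slice t \<phi> z)"
proof -
  have "star (slice t \<phi> z) = slice t \<phi> z"
    using slice_star[OF t phi, of z] pos_star[OF z] by simp
  moreover have "pos (re_part (slice t \<phi> z))"
    using state_pos[OF state_slice[OF t phi] z] by (intro pos_if_states) (simp add: pure_state_def)
  ultimately show ?thesis by (simp add: re_part_self_adjoint)
qed

text \<open>Contractivity is read off from an identity that homomorphisms preserve:
  \<open>norm x\<close> squared minus \<open>star x * x\<close> is a square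
  \<open>s * s\<close>.\<close>

lemma star_hom_bounded_linear:
  fixes f :: "'a::cstar_algebra \<Rightarrow> 'b::cstar_algebra"
  assumes f: "star_hom f" shows "bounded_linear f"
proof (rule bounded_linear_intro[where K = 1])
  show "f (x + y) = f x + f y" for x y using f unfolding star_hom_def by blast
  have sc: "f (c *\<^sub>C x) = c *\<^sub>C f x" for c x using f unfolding star_hom_def by blast
  then show scR: "f (r *\<^sub>R x) = r *\<^sub>R f x" for r x by (metis scaleC_of_real)
  fix x :: 'a
  obtain s where s: "star s = s" "(norm x)\<^sup>2 *\<^sub>R 1 - star x * x = s * s"
    using pos_norm_sq_minus[of x] unfolding pos_def by blast
  have "star x * x + s * s = (norm x)\<^sup>2 *\<^sub>R 1" using s(2) by (simp add: algebra_simps)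
  then have "star (f x) * f x + f s * f s = (norm x)\<^sup>2 *\<^sub>R 1"
    using f scR unfolding star_hom_def by metis
  then have "(norm x)\<^sup>2 *\<^sub>R 1 - star (f x) * f x = f s * f s" by (simp add: algebra_simps)
  moreover have "star (f s) = f s" using f s unfolding star_hom_def by metis
  ultimately have "pos ((norm x)\<^sup>2 *\<^sub>R 1 - star (f x) * f x)" unfolding pos_def by blast
  then have "(norm (f x))\<^sup>2 \<le> (norm x)\<^sup>2"
    using norm_le_of_pos[OF pos_star_mult_self] cstar_identity by metis
  then show "norm (f x) \<le> norm x * 1" by (simp add: power2_le_iff_abs_le)
qed

lemma bounded_linear_tensor:
  assumes t: "min_tensor t" shows "bounded_linear (t x)"
proof -
  have "star_hom (t 1)" unfolding star_hom_def
    by (simp add: t_add_right[OF t] t_scaleC_right[OF t] t_mult[OF t] t_star[OF t] t_one[OF t])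
  then have "bounded_linear (\<lambda>y. t x 1 * t 1 y)"
    by (intro bounded_linear_compose[OF bounded_linear_mult_right] star_hom_bounded_linear)
  then show ?thesis by (simp add: t_mult[OF t])
qed

lemma state_star_hom: "state \<omega> \<Longrightarrow> star_hom f \<Longrightarrow> state (\<lambda>x. \<omega> (f x))"
  unfolding state_def star_hom_def by simp

text \<open>The scalar in \<open>eq\<close> is there because the span is complex while
  \<open>F\<close> and \<open>G\<close> are only real-linear.\<close>

lemma dense_eqI:
  assumes dense: "closure (cvec.span S) = UNIV" and F: "bounded_linear F" and G: "bounded_linear G"
    and eq: "\<And>c x. x \<in> S \<Longrightarrow> F (c *\<^sub>C x) = G (c *\<^sub>C x)"
  shows "F z = G z"
proof -
  interpret F: bounded_linear F by (rule F)
  interpret G: bounded_linear G by (rule G)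
  have "x \<in> cvec.span S \<Longrightarrow> F x = G x" for x
    by (induction rule: cvec.span_induct_alt) (auto simp: F.zero G.zero F.add G.add eq)
  then have "cvec.span S \<subseteq> {z. F z = G z}" by blast
  moreover have "closed {z. F z = G z}"
    by (intro closed_Collect_eq linear_continuous_on F G)
  ultimately show ?thesis using dense closure_minimal by blast
qed

text \<open>Banach-Alaoglu: by \<open>state_norm\<close> the states form a pointwise closed subset
  of a product of discs.\<close>

lemma compact_states: "compact {\<omega> :: 'a::cstar_algebra \<Rightarrow> complex. state \<omega>}"
proof -
  let ?K = "Pi\<^sub>E UNIV (\<lambda>x::'a. cball (0::complex) (norm x))"
  have "compactin (product_topology (\<lambda>_. euclidean) UNIV) ?K"
    by (subst compactin_PiE) (simp add: compactin_euclidean_iff)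
  then have "compact ?K" by (simp add: euclidean_product_topology compactin_euclidean_iff)
  moreover have "closed {\<omega> :: 'a \<Rightarrow> complex. state \<omega>}"
    unfolding state_def
    by (intro closed_Collect_conj closed_Collect_all closed_Collect_eq closed_Collect_le
      continuous_intros continuous_on_product_coordinates)
  ultimately have "compact (?K \<inter> {\<omega>. state \<omega>})" by (rule compact_Int_closed)
  moreover have "{\<omega>. state \<omega>} \<subseteq> ?K" using state_norm by (auto simp: PiE_def)
  ultimately show ?thesis by (simp add: Int_absorb1)
qed

lemma state_average:
  fixes \<omega> :: "'i \<Rightarrow> 'a::cstar_algebra \<Rightarrow> complex"
  assumes "finite I" "I \<noteq> {}" and st: "\<And>i. i \<in> I \<Longrightarrow> state (\<omega> i)"
  shows "state (\<lambda>x. (\<Sum>i\<in>I. \<omega> i x) / of_nat (card I))"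
proof -
  have c: "card I > 0" using assms by (simp add: card_gt_0_iff)
  show ?thesis unfolding state_def
  proof (intro conjI allI)
    fix x y k
    show "(\<Sum>i\<in>I. \<omega> i (x + y)) / of_nat (card I) =
        (\<Sum>i\<in>I. \<omega> i x) / of_nat (card I) + (\<Sum>i\<in>I. \<omega> i y) / of_nat (card I)"
      by (simp add: state_add[OF st] sum.distrib add_divide_distrib)
    show "(\<Sum>i\<in>I. \<omega> i (k *\<^sub>C x)) / of_nat (card I) = k * ((\<Sum>i\<in>I. \<omega> i x) / of_nat (card I))"
      by (simp add: state_scaleC[OF st] sum_distrib_left)
    show "(\<Sum>i\<in>I. \<omega> i 1) / of_nat (card I) = 1" using c by (simp add: state_one[OF st])
    show "(\<Sum>i\<in>I. \<omega> i (star x)) / of_nat (card I) = cnj ((\<Sum>i\<in>I. \<omega> i x) / of_nat (card I))"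
      by (simp add: state_star[OF st])
    have "0 \<le> Re (\<Sum>i\<in>I. \<omega> i (star x * x))"
      unfolding Re_sum by (rule sum_nonneg) (rule state_square[OF st])
    then show "0 \<le> Re ((\<Sum>i\<in>I. \<omega> i (star x * x)) / of_nat (card I))"
      by (metis Re_divide_of_nat divide_nonneg_nonneg of_nat_0_le_iff)
  qed
qed

text \<open>For \<open>t\<close> as in a compact quantum group, \<open>conv t \<Delta> \<phi>\<close> is \<open>(id \<otimes> \<phi>) \<Delta>\<close>; for the flipped tensor
  product it is \<open>(\<phi> \<otimes> id) \<Delta>\<close>.\<close>

definition conv :: "('q::cstar_algebra \<Rightarrow> 'q \<Rightarrow> 't::cstar_algebra) \<Rightarrow> ('q \<Rightarrow> 't) \<Rightarrow>
    ('q \<Rightarrow> complex) \<Rightarrow> 'q \<Rightarrow> 'q" where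
  "conv t \<Delta> \<phi> a = slice t \<phi> (\<Delta> a)"

section \<open>Convolution operators and invariant states\<close>

context compact_quantum_group
begin

abbreviation (input) "t' \<equiv> \<lambda>b a. t a b"

lemmas tens = tensor(1)

lemma tens': "min_tensor t'"
  by (rule min_tensor_flip[OF tens])

lemma comult_mult: "\<Delta> (x * y) = \<Delta> x * \<Delta> y"
  and comult_one [simp]: "\<Delta> 1 = 1"
  and comult_star: "\<Delta> (star x) = star (\<Delta> x)"
  and comult_scaleC: "\<Delta> (c *\<^sub>C x) = c *\<^sub>C \<Delta> x"
proof -
  note hom = comult_hom[unfolded star_hom_def]
  show "\<Delta> (x * y) = \<Delta> x * \<Delta> y" "\<Delta> 1 = 1" "\<Delta> (star x) = star (\<Delta> x)" "\<Delta> (c *\<^sub>C x) = c *\<^sub>C \<Delta> x"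
    using hom by simp_all
qed

lemma bounded_linear_comult: "bounded_linear \<Delta>"
  by (rule star_hom_bounded_linear[OF comult_hom])

lemmas comult_sum = linear_sum[OF bounded_linear.linear[OF bounded_linear_comult]]

text \<open>Exchanging the legs exchanges \<open>tl\<close> with \<open>tr\<close> and the two
  density conditions, so that one-sided results transfer to the other side.\<close>

lemma flipped: "compact_quantum_group t' (\<lambda>z c. tr c z) (\<lambda>a z. tl z a) \<Delta>"
proof -
  obtain D\<^sub>1 D\<^sub>2 where "star_hom D\<^sub>1" "star_hom D\<^sub>2" "\<forall>a b. D\<^sub>1 (t a b) = tl (\<Delta> a) b"
    "\<forall>a b. D\<^sub>2 (t a b) = tr a (\<Delta> b)" "D\<^sub>1 \<circ> \<Delta> = D\<^sub>2 \<circ> \<Delta>" using coassoc by blast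
  then have "\<exists>D\<^sub>1 D\<^sub>2. star_hom D\<^sub>1 \<and> star_hom D\<^sub>2 \<and> (\<forall>a b. D\<^sub>1 (t b a) = tr b (\<Delta> a)) \<and>
      (\<forall>a b. D\<^sub>2 (t b a) = tl (\<Delta> b) a) \<and> D\<^sub>1 \<circ> \<Delta> = D\<^sub>2 \<circ> \<Delta>"
    by (intro exI[of _ D\<^sub>2] exI[of _ D\<^sub>1]) auto
  then show ?thesis
    by (rule compact_quantum_group.intro[OF min_tensor_flip[OF tensor(1)] min_tensor_flip[OF tensor(3)]
        min_tensor_flip[OF tensor(2)] _ comult_hom _ dense_left dense_right, rotated])
      (simp add: tensor_assoc)
qed

lemma dense_left_eqI:
  assumes F: "bounded_linear F" and G: "bounded_linear G"
    and eq: "\<And>a b. F (t a 1 * \<Delta> b) = G (t a 1 * \<Delta> b)"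
  shows "F z = G z"
proof (rule dense_eqI[OF dense_left F G])
  fix c x assume "x \<in> {t a 1 * \<Delta> b |a b. True}"
  then obtain a b where "x = t a 1 * \<Delta> b" by blast
  then have "c *\<^sub>C x = t (c *\<^sub>C a) 1 * \<Delta> b" by (simp add: t_scaleC_left[OF tens] mult_scaleC_left)
  then show "F (c *\<^sub>C x) = G (c *\<^sub>C x)" using eq by simp
qed

lemma dense_left_star_eqI:
  assumes F: "bounded_linear F" and G: "bounded_linear G"
    and eq: "\<And>a b. F (\<Delta> b * t a 1) = G (\<Delta> b * t a 1)"
  shows "F z = G z"
proof -
  have "F (star z) = G (star z)" for z
  proof (rule dense_left_eqI[where F = "\<lambda>z. F (star z)" and G = "\<lambda>z. G (star z)"])
    show "bounded_linear (\<lambda>z. F (star z))" "bounded_linear (\<lambda>z. G (star z))"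
      by (intro bounded_linear_compose[OF F] bounded_linear_compose[OF G] bounded_linear_star)+
    show "F (star (t a 1 * \<Delta> b)) = G (star (t a 1 * \<Delta> b))" for a b
      by (simp add: star_mult t_star[OF tens] eq flip: comult_star)
  qed
  then show ?thesis by (metis star_star)
qed

text \<open>Coassociativity with the last leg sliced off: \<open>E\<close> is the identity tensored
  with \<open>y \<mapsto> (id \<otimes> \<phi>)((1 \<otimes> d) \<Delta>(y))\<close>. For
  \<open>d = 1\<close> this is convolution by \<phi>; in \<open>coisometric_isometric\<close>
  \<open>d\<close> is a matrix coefficient.\<close>

lemma comult_slice:
  assumes phi: "state \<phi>"
  obtains E where "bounded_linear E" "\<And>x y. E (t x y) = t x (slice t \<phi> (t 1 d * \<Delta> y))"
    "\<And>a. \<Delta> (slice t \<phi> (t 1 d * \<Delta> a)) = E (\<Delta> a)"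
proof -
  obtain D\<^sub>1 D\<^sub>2 where D: "star_hom D\<^sub>1" "star_hom D\<^sub>2" "\<And>a b. D\<^sub>1 (t a b) = tl (\<Delta> a) b"
    "\<And>a b. D\<^sub>2 (t a b) = tr a (\<Delta> b)" "\<And>a. D\<^sub>1 (\<Delta> a) = D\<^sub>2 (\<Delta> a)"
    using coassoc by (metis comp_apply)
  note sl = bounded_linear_slice[OF tensor(2) phi] slice_tensor[OF tensor(2) phi]
  note bl1 = star_hom_bounded_linear[OF D(1)] and bl2 = star_hom_bounded_linear[OF D(2)]
  have s1: "slice tl \<phi> (tr x z) = t x (slice t \<phi> z)" for x z
  proof (rule tensor_eqI[OF tens, where F = "\<lambda>z. slice tl \<phi> (tr x z)" and G = "\<lambda>z. t x (slice t \<phi> z)"])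
    show "bounded_linear (\<lambda>z. slice tl \<phi> (tr x z))"
    proof (rule bounded_linear_compose[OF sl(1)])
      show "bounded_linear (tr x)" by (rule bounded_linear_tensor[OF tensor(3)])
    qed
    show "bounded_linear (\<lambda>z. t x (slice t \<phi> z))"
      by (rule bounded_linear_compose[OF bounded_linear_tensor[OF tens] bounded_linear_slice[OF tens phi]])
    show "slice tl \<phi> (tr x (t a b)) = t x (slice t \<phi> (t a b))" for a b
      by (simp add: tensor_assoc[symmetric] sl(2) slice_tensor[OF tens phi] t_scaleC_right[OF tens])
  qed
  have s2: "\<Delta> (slice t \<phi> z) = slice tl \<phi> (D\<^sub>1 z)" for z
  proof (rule tensor_eqI[OF tens, where F = "\<lambda>z. \<Delta> (slice t \<phi> z)" and G = "\<lambda>z. slice tl \<phi> (D\<^sub>1 z)"])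
    show "bounded_linear (\<lambda>z. \<Delta> (slice t \<phi> z))"
      by (rule bounded_linear_compose[OF bounded_linear_comult bounded_linear_slice[OF tens phi]])
    show "bounded_linear (\<lambda>z. slice tl \<phi> (D\<^sub>1 z))" by (rule bounded_linear_compose[OF sl(1) bl1])
    show "\<Delta> (slice t \<phi> (t a b)) = slice tl \<phi> (D\<^sub>1 (t a b))" for a b
      by (simp add: D(3) sl(2) slice_tensor[OF tens phi] comult_scaleC)
  qed
  have tl1: "tl 1 d = tr 1 (t 1 d)" using tensor_assoc[of 1 1 d] by (simp add: t_one[OF tens])
  have D1mult: "D\<^sub>1 (x * y) = D\<^sub>1 x * D\<^sub>1 y" for x y using D(1) unfolding star_hom_def by blast
  show ?thesis
  proof (rule that[of "\<lambda>z. slice tl \<phi> (tl 1 d * D\<^sub>2 z)"])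
    show "bounded_linear (\<lambda>z. slice tl \<phi> (tl 1 d * D\<^sub>2 z))"
      by (intro bounded_linear_compose[OF sl(1)] bounded_linear_compose[OF bounded_linear_mult_right] bl2)
    show "slice tl \<phi> (tl 1 d * D\<^sub>2 (t x y)) = t x (slice t \<phi> (t 1 d * \<Delta> y))" for x y
      unfolding tl1 D(4) t_mult[OF tensor(3)] s1 by simp
    show "\<Delta> (slice t \<phi> (t 1 d * \<Delta> a)) = slice tl \<phi> (tl 1 d * D\<^sub>2 (\<Delta> a))" for a
      unfolding s2 D1mult D(3,5) by simp
  qed
qed

lemma comult_conv:
  assumes phi: "state \<phi>"
  obtains E where "bounded_linear E" "\<And>x y. E (t x y) = t x (conv t \<Delta> \<phi> y)"
    "\<And>a. \<Delta> (conv t \<Delta> \<phi> a) = E (\<Delta> a)"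
  using comult_slice[OF phi, of 1] unfolding conv_def by (simp add: t_one[OF tens]) metis

lemma conv_fubini: "state \<phi> \<Longrightarrow> state \<omega> \<Longrightarrow> \<phi> (conv t' \<Delta> \<omega> a) = \<omega> (conv t \<Delta> \<phi> a)"
  unfolding conv_def by (rule slice_fubini[OF tens])

lemma state_conv: "state \<omega> \<Longrightarrow> state \<phi> \<Longrightarrow> state (\<lambda>a. \<omega> (conv t \<Delta> \<phi> a))"
  unfolding conv_def by (rule state_star_hom[OF state_slice[OF tens] comult_hom])

lemma bounded_linear_conv: "state \<phi> \<Longrightarrow> bounded_linear (conv t \<Delta> \<phi>)"
  unfolding conv_def
  by (rule bounded_linear_compose[OF bounded_linear_slice[OF tens] bounded_linear_comult])

text \<open>The state on the right is the convolution product of \<omega> and \<phi>.\<close>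

lemma conv_conv:
  assumes phi: "state \<phi>" and w: "state \<omega>"
  shows "conv t \<Delta> \<omega> (conv t \<Delta> \<phi> a) = conv t \<Delta> (\<lambda>x. \<omega> (conv t \<Delta> \<phi> x)) a"
proof -
  obtain E where E: "bounded_linear E" "\<And>x y. E (t x y) = t x (conv t \<Delta> \<phi> y)"
    "\<And>a. \<Delta> (conv t \<Delta> \<phi> a) = E (\<Delta> a)" using comult_conv[OF phi] by metis
  note st = state_conv[OF w phi]
  have "slice t \<omega> (E z) = slice t (\<lambda>x. \<omega> (conv t \<Delta> \<phi> x)) z" for z
    by (rule tensor_eqI[OF tens bounded_linear_compose[OF bounded_linear_slice[OF tens w] E(1)]
          bounded_linear_slice[OF tens st]])
      (simp add: E(2) slice_tensor[OF tens w] slice_tensor[OF tens st])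
  then show ?thesis unfolding conv_def[of _ _ \<omega>] conv_def[of _ _ "\<lambda>x. \<omega> (conv t \<Delta> \<phi> x)"] E(3) .
qed

lemma conv_commute:
  assumes phi: "state \<phi>" and w: "state \<omega>"
  shows "conv t' \<Delta> \<omega> (conv t \<Delta> \<phi> a) = conv t \<Delta> \<phi> (conv t' \<Delta> \<omega> a)"
proof -
  obtain E where E: "bounded_linear E" "\<And>x y. E (t x y) = t x (conv t \<Delta> \<phi> y)"
    "\<And>a. \<Delta> (conv t \<Delta> \<phi> a) = E (\<Delta> a)" using comult_conv[OF phi] by metis
  have sc: "conv t \<Delta> \<phi> (c *\<^sub>C x) = c *\<^sub>C conv t \<Delta> \<phi> x" for c x
    unfolding conv_def comult_scaleC by (rule slice_scaleC[OF tens phi])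
  have "slice t' \<omega> (E z) = conv t \<Delta> \<phi> (slice t' \<omega> z)" for z
    by (rule tensor_eqI[OF tens bounded_linear_compose[OF bounded_linear_slice[OF tens' w] E(1)]
          bounded_linear_compose[OF bounded_linear_conv[OF phi] bounded_linear_slice[OF tens' w]]])
      (simp add: E(2) slice_tensor[OF tens' w] sc)
  then show ?thesis unfolding conv_def[of t' _ \<omega>] E(3) .
qed

text \<open>With \<open>x = (id \<otimes> h) \<Delta>(b)\<close>, the positive element \<open>|\<Delta>(x) - x \<otimes> 1|\<^sup>2\<close> is null for \<open>h \<otimes> \<omega>\<close>, hence for
  \<open>h \<otimes> \<rho>\<close>; then the cancellation property applies.\<close>

lemma dominated_invariant:
  assumes h: "state h" and w: "state \<omega>" and r: "state \<rho>"
    and hR: "\<And>a. h (conv t \<Delta> \<omega> a) = h a" and hL: "\<And>a. h (conv t' \<Delta> \<omega> a) = h a"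
    and dom: "\<And>x. Re (\<rho> (star x * x)) \<le> K * Re (\<omega> (star x * x))"
  shows "h (conv t' \<Delta> \<rho> a) = h a"
proof -
  let ?r = "\<lambda>x. \<rho> (conv t \<Delta> h x)"
  have str: "state ?r" by (rule state_conv[OF r h])
  \<comment> \<open>By Fubini, \<open>hL\<close> says that the convolution product of \<omega> and
    \<open>h\<close> is \<open>h\<close>.\<close>
  have "\<omega> (conv t \<Delta> h x) = h x" for x using conv_fubini[OF h w] hL by simp
  then have fix_w: "conv t \<Delta> \<omega> (conv t \<Delta> h b) = conv t \<Delta> h b" for b
    using conv_conv[OF h w] by simp
  have key: "h (c * conv t \<Delta> ?r b) = h (c * conv t \<Delta> h b)" for c b
  proof -
    define x where "x = conv t \<Delta> h b"
    define z where "z = \<Delta> x - t x 1"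
    have wx: "slice t \<omega> (\<Delta> x) = x" using fix_w[of b] unfolding x_def conv_def[of t \<Delta> \<omega>] .
    have "star z * z = \<Delta> (star x * x) - \<Delta> (star x) * t x 1 - t (star x) 1 * \<Delta> x + t (star x * x) 1"
      unfolding z_def by (simp add: star_diff t_star[OF tens] comult_mult comult_star t_mult[OF tens]
        algebra_simps)
    then have "slice t \<omega> (star z * z) = conv t \<Delta> \<omega> (star x * x) - star x * x"
      using wx by (simp add: slice_add[OF tens w] slice_diff[OF tens w] slice_mult_left[OF tens w]
        slice_mult_right[OF tens w] slice_tensor[OF tens w] state_one[OF w] conv_def
        comult_star slice_star[OF tens w])
    then have hw0: "h (slice t \<omega> (star z * z)) = 0" using hR by (simp add: state_diff[OF h])
    \<comment> \<open>Slicing with \<open>h\<close> first yields a positive element of the algebra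
      itself, where \<rho> can be compared with \<omega>.\<close>
    obtain s where s: "star s = s" "slice t' h (star z * z) = s * s"
      using pos_slice[OF tens' h pos_star_mult_self, of z] unfolding pos_def by blast
    have "Re (h (slice t \<rho> (star z * z))) = Re (\<rho> (star s * s))"
      using slice_fubini[OF tens r h, of "star z * z"] s by simp
    also have "\<dots> \<le> K * Re (\<omega> (star s * s))" by (rule dom)
    also have "\<omega> (star s * s) = h (slice t \<omega> (star z * z))"
      using slice_fubini[OF tens w h, of "star z * z"] s by simp
    finally have "Re (h (slice t \<rho> (star z * z))) \<le> 0" using hw0 by simp
    then have "h (slice t \<rho> (t c 1 * z)) = 0"
      by (rule state_null_left[OF state_slice[OF tens r h]])
    moreover have "slice t \<rho> (t c 1 * z) = c * conv t \<Delta> \<rho> x - c * x"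
      unfolding z_def slice_mult_left[OF tens r] slice_diff[OF tens r] conv_def
      by (simp add: slice_tensor[OF tens r] state_one[OF r] right_diff_distrib)
    moreover have "conv t \<Delta> \<rho> x = conv t \<Delta> ?r b" unfolding x_def by (rule conv_conv[OF h r])
    ultimately show ?thesis unfolding x_def by (simp add: state_diff[OF h])
  qed
  \<comment> \<open>\<open>key\<close> covers the elements
    \<open>(c \<otimes> 1) \<Delta>(b)\<close>, whose span is dense; so the equality may be
    evaluated at \<open>1 \<otimes> a\<close>.\<close>
  have "h (slice t ?r z) = h (slice t h z)" for z
  proof (rule dense_left_eqI)
    show "bounded_linear (\<lambda>z. h (slice t ?r z))" "bounded_linear (\<lambda>z. h (slice t h z))"
      by (intro bounded_linear_compose[OF state_bounded_linear[OF h]] bounded_linear_slice tens str h)+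
    show "h (slice t ?r (t c 1 * \<Delta> b)) = h (slice t h (t c 1 * \<Delta> b))" for c b
      by (simp only: slice_mult_left[OF tens str] slice_mult_left[OF tens h]
        key[of c b, unfolded conv_def[of t \<Delta> ?r b] conv_def[of t \<Delta> h b]])
  qed
  from this[of "t 1 a"] have "?r a = h a"
    by (simp add: slice_tensor[OF tens str] slice_tensor[OF tens h] state_scaleC[OF h] state_one[OF h])
  then show ?thesis using conv_fubini[OF h r] by simp
qed

text \<open>Cesaro means of the convolution powers of \<omega> are invariant up to
  \<open>2 norm a / (n + 1)\<close>, and compactness gives a state in all the sets
  \<open>A n\<close>. Convolution on either side moves a power of \<omega> to the next one, so the
  same means serve both sides.\<close>

lemma invariant_state_single:
  assumes w: "state \<omega>"
  obtains h where "state h" "\<And>a. h (conv t \<Delta> \<omega> a) = h a" "\<And>a. h (conv t' \<Delta> \<omega> a) = h a"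
proof -
  let ?R = "conv t \<Delta> \<omega>" and ?L = "conv t' \<Delta> \<omega>"
  define A where "A n = {h. (\<forall>a. cmod (h (?R a) - h a) \<le> 2 * norm a / Suc n) \<and>
      (\<forall>a. cmod (h (?L a) - h a) \<le> 2 * norm a / Suc n)}" for n
  have A_anti: "A m \<subseteq> A n" if "n \<le> m" for m n
  proof -
    have "2 * norm (a::'q) / Suc m \<le> 2 * norm a / Suc n" for a using that by (intro divide_left_mono) auto
    then show ?thesis unfolding A_def by (auto intro: order_trans)
  qed
  define W where "W k a = \<omega> ((?R ^^ k) a)" for k a
  have W: "state (W k)" for k
  proof (induction k)
    case 0
    have "W 0 = \<omega>" unfolding W_def by auto
    then show ?case using w by simp
  next
    case (Suc k)
    have "W (Suc k) = (\<lambda>a. W k (?R a))" unfolding W_def by (simp add: funpow_swap1)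
    then show ?case using state_conv[OF Suc w] by simp
  qed
  have WR: "W k (?R a) = W (Suc k) a" for k a unfolding W_def by (simp add: funpow_swap1)
  have WL: "W k (?L a) = W (Suc k) a" for k a
  proof -
    have "(?R ^^ k) (?L a) = ?L ((?R ^^ k) a)"
      by (induction k) (simp_all add: conv_commute[OF w w])
    then show ?thesis unfolding W_def using conv_fubini[OF w w] by simp
  qed
  have ne: "{h. state h} \<inter> A n \<noteq> {}" for n
  proof -
    define s where "s a = (\<Sum>k\<in>{..n}. W k a) / of_nat (card {..n})" for a
    have st: "state s" unfolding s_def by (rule state_average) (auto intro: W)
    have bd: "cmod (s (f a) - s a) \<le> 2 * norm a / Suc n"
      if f: "\<And>k a. W k (f a) = W (Suc k) a" for f a
    proof -
      have "s (f a) - s a = (\<Sum>k\<le>n. W (Suc k) a - W k a) / of_nat (Suc n)"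
        unfolding s_def f by (simp add: sum_subtractf diff_divide_distrib)
      also have "(\<Sum>k\<le>n. W (Suc k) a - W k a) = W (Suc n) a - W 0 a"
        by (induction n) simp_all
      finally have "cmod (s (f a) - s a) = cmod (W (Suc n) a - W 0 a) / Suc n"
        by (simp add: norm_divide del: of_nat_Suc)
      also have "cmod (W (Suc n) a - W 0 a) \<le> 2 * norm a"
        using norm_triangle_ineq4[of "W (Suc n) a" "W 0 a"] state_norm[OF W, of "Suc n" a]
          state_norm[OF W, of 0 a] by linarith
      finally show ?thesis by (simp add: divide_right_mono)
    qed
    have "s \<in> A n" unfolding A_def using bd[OF WR] bd[OF WL] by blast
    then show ?thesis using st by blast
  qed
  have "{h. state h} \<inter> (\<Inter>n\<in>UNIV. A n) \<noteq> {}"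
  proof (rule compact_imp_fip_image[OF compact_states])
    show "closed (A n)" for n unfolding A_def
      by (intro closed_Collect_conj closed_Collect_all closed_Collect_le continuous_intros
        continuous_on_product_coordinates)
    fix I :: "nat set" assume I: "finite I"
    show "{h. state h} \<inter> (\<Inter>n\<in>I. A n) \<noteq> {}"
    proof (cases "I = {}")
      case True then show ?thesis using ne[of 0] by blast
    next
      case False
      have "A (Max I) \<subseteq> A n" if "n \<in> I" for n using A_anti[OF Max_ge[OF I that]] .
      then have "A (Max I) \<subseteq> (\<Inter>n\<in>I. A n)" by blast
      then show ?thesis using ne[of "Max I"] by blast
    qed
  qed
  then obtain h where h: "state h" "\<And>n. h \<in> A n" by blast
  have z: "d = 0" if "\<And>n. cmod d \<le> 2 * norm a / Suc n" for d and a :: 'q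
  proof -
    have "(\<lambda>n. 2 * norm a * (1 / real (Suc n))) \<longlonglongrightarrow> 2 * norm a * 0"
      by (intro tendsto_mult tendsto_const LIMSEQ_Suc lim_1_over_n)
    then have "cmod d \<le> 2 * norm a * 0" by (rule LIMSEQ_le_const) (use that in auto)
    then show ?thesis by simp
  qed
  have "h (?R a) - h a = 0" "h (?L a) - h a = 0" for a
    by (rule z[of _ a], use h(2) in \<open>unfold A_def, blast\<close>)+
  then show ?thesis using that[OF h(1)] by simp
qed

text \<open>Up to the factor \<open>card I\<close>, the average of finitely many states dominates
  each of them; so a state invariant for the average is invariant for all of them by
  \<open>dominated_invariant\<close>. The finite intersection property then reaches all states at
  once.\<close>

lemma left_invariant_state:
  obtains h where "state h" "\<And>a. conv t \<Delta> h a = h a *\<^sub>C 1"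
proof -
  define B :: "('q \<Rightarrow> complex) \<Rightarrow> ('q \<Rightarrow> complex) set"
    where "B \<rho> = {h. \<forall>a. h (conv t' \<Delta> \<rho> a) = h a}" for \<rho>
  have "{h. state h} \<inter> (\<Inter>\<rho>\<in>{\<rho>. state \<rho>}. B \<rho>) \<noteq> {}"
  proof (rule compact_imp_fip_image[OF compact_states])
    show "closed (B \<rho>)" for \<rho> unfolding B_def
      by (intro closed_Collect_all closed_Collect_eq continuous_on_product_coordinates)
    fix I :: "('q \<Rightarrow> complex) set" assume I: "finite I" "I \<subseteq> {\<rho>. state \<rho>}"
    show "{h. state h} \<inter> (\<Inter>\<rho>\<in>I. B \<rho>) \<noteq> {}"
    proof (cases "I = {}")
      case True
      obtain h :: "'q \<Rightarrow> complex" where "pure_state h" using pure_state_exists by blast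
      then show ?thesis using True unfolding pure_state_def by auto
    next
      case False
      define \<omega> where "\<omega> x = (\<Sum>\<rho>\<in>I. \<rho> x) / of_nat (card I)" for x
      have w: "state \<omega>" unfolding \<omega>_def by (rule state_average) (use I False in auto)
      obtain h where h: "state h" "\<And>a. h (conv t \<Delta> \<omega> a) = h a" "\<And>a. h (conv t' \<Delta> \<omega> a) = h a"
        using invariant_state_single[OF w] by metis
      have "h \<in> B \<rho>" if r: "\<rho> \<in> I" for \<rho>
      proof -
        have "Re (\<rho> (star x * x)) \<le> real (card I) * Re (\<omega> (star x * x))" for x
        proof -
          have "Re (\<rho> (star x * x)) \<le> (\<Sum>\<rho>\<in>I. Re (\<rho> (star x * x)))"
            using I by (intro member_le_sum r) (auto intro: state_square)
          also have "\<dots> = real (card I) * Re (\<omega> (star x * x))"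
          proof -
            have "of_nat (card I) * \<omega> (star x * x) = (\<Sum>\<rho>\<in>I. \<rho> (star x * x))"
              unfolding \<omega>_def using I False by simp
            then have "Re (of_nat (card I) * \<omega> (star x * x)) = (\<Sum>\<rho>\<in>I. Re (\<rho> (star x * x)))"
              by (metis Re_sum)
            then show ?thesis by simp
          qed
          finally show ?thesis .
        qed
        then show ?thesis unfolding B_def
          using dominated_invariant[OF h(1) w _ h(2,3)] I r by blast
      qed
      then show ?thesis using h(1) by blast
    qed
  qed
  then obtain h where h: "state h" "\<And>\<rho> a. state \<rho> \<Longrightarrow> h (conv t' \<Delta> \<rho> a) = h a"
    unfolding B_def by blast
  have "conv t \<Delta> h a - h a *\<^sub>C 1 = 0" for a
    by (rule states_separate)
      (simp add: state_diff state_scaleC state_one h(2) flip: conv_fubini[OF h(1)])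
  then show ?thesis using that[OF h(1)] by simp
qed

end

text \<open>A state invariant on one side and one invariant on the other coincide, by Fubini for the
  pair \<open>h\<close>, \<open>k\<close>.\<close>

theorem (in compact_quantum_group) haar_state:
  obtains h where "state h" "\<And>a. conv t \<Delta> h a = h a *\<^sub>C 1" "\<And>a. conv (\<lambda>b a. t a b) \<Delta> h a = h a *\<^sub>C 1"
proof -
  obtain h where h: "state h" "\<And>a. conv t \<Delta> h a = h a *\<^sub>C 1" using left_invariant_state by blast
  obtain k where k: "state k" "\<And>a. conv t' \<Delta> k a = k a *\<^sub>C 1"
    using compact_quantum_group.left_invariant_state[OF flipped] by blast
  have "h a = k a" for a
    using conv_fubini[OF h(1) k(1), of a] unfolding h(2) k(2)
    by (simp add: state_scaleC[OF h(1)] state_scaleC[OF k(1)] state_one[OF h(1)] state_one[OF k(1)])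
  then have "h = k" by auto
  then show ?thesis using that h k(2) by blast
qed

section \<open>Coisometric comultiplicative matrices are isometric\<close>

text \<open>The vectors \<open>X = (id \<otimes> h)((1 \<otimes> d) \<Delta>(a))\<close> satisfy \<open>(1 \<otimes> d) \<Delta>(X) = X \<otimes> 1\<close>. Invariance of \<open>h\<close> turns this
  into \<open>f X = 0\<close> for the projection \<open>f = 1 - d\<^sup>* d\<close>; by cancellation \<open>\<Delta>(a)\<close> may be replaced by \<open>1 \<otimes> b\<close>, so that
  \<open>f h(d b) = 0\<close> for all \<open>b\<close>.\<close>

lemma (in compact_quantum_group) coisometric_isometric:
  fixes d :: "nat \<Rightarrow> nat \<Rightarrow> 'q" and P :: "nat \<Rightarrow> nat \<Rightarrow> complex"
  assumes com: "\<And>i j. i < n \<Longrightarrow> j < n \<Longrightarrow> \<Delta> (d i j) = (\<Sum>r<n. t (d i r) (d r j))"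
    and co: "\<And>i s. i < n \<Longrightarrow> s < n \<Longrightarrow> (\<Sum>j<n. d i j * star (d s j)) = P i s *\<^sub>C 1"
    and Pd: "\<And>i j. i < n \<Longrightarrow> j < n \<Longrightarrow> (\<Sum>r<n. P i r *\<^sub>C d r j) = d i j"
    and dP: "\<And>i j. i < n \<Longrightarrow> j < n \<Longrightarrow> (\<Sum>r<n. P r j *\<^sub>C d i r) = d i j"
    and ids: "i < n" "s < n"
  shows "(\<Sum>k<n. star (d k i) * d k s) = P i s *\<^sub>C 1"
proof -
  obtain h where h: "state h" "\<And>a. conv t \<Delta> h a = h a *\<^sub>C 1" "\<And>a. conv t' \<Delta> h a = h a *\<^sub>C 1"
    using haar_state by blast
  note slR = bounded_linear_slice[OF tens h(1)] and slL = bounded_linear_slice[OF tens' h(1)]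
  define p where "p r s = (\<Sum>k<n. star (d k r) * d k s)" for r s
  define f where "f r s = (if r = s then 1 else 0) - p r s" for r s
  have sp: "star (p r s) = p s r" for r s
    unfolding p_def star_sum by (simp add: star_mult star_star)
  have pp: "(\<Sum>i<n. p r i * p i s) = p r s" if "s < n" for r s
  proof -
    have "(\<Sum>i<n. p r i * p i s) = (\<Sum>i<n. \<Sum>k<n. \<Sum>l<n. star (d k r) * (d k i * star (d l i)) * d l s)"
      unfolding p_def by (simp add: sum_product mult.assoc)
    also have "\<dots> = (\<Sum>k<n. \<Sum>i<n. \<Sum>l<n. star (d k r) * (d k i * star (d l i)) * d l s)"
      by (rule sum.swap)
    also have "\<dots> = (\<Sum>k<n. \<Sum>l<n. \<Sum>i<n. star (d k r) * (d k i * star (d l i)) * d l s)"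
      by (intro sum.cong refl sum.swap)
    also have "\<dots> = (\<Sum>k<n. \<Sum>l<n. star (d k r) * (\<Sum>i<n. d k i * star (d l i)) * d l s)"
      by (simp add: sum_distrib_left sum_distrib_right)
    also have "\<dots> = (\<Sum>k<n. star (d k r) * (\<Sum>l<n. P k l *\<^sub>C d l s))"
      by (simp add: co sum_distrib_left mult_scaleC_left mult_scaleC_right)
    also have "\<dots> = p r s" unfolding p_def using that by (simp add: Pd)
    finally show ?thesis .
  qed
  have ff: "(\<Sum>i<n. star (f i r) * f i s) = f r s" if rs: "r < n" "s < n" for r s
  proof -
    have "star (f i r) * f i s = (if i = r then f i s else 0) - (if i = s then p r i else 0) + p r i * p i s" for i
      unfolding f_def by (auto simp: star_diff sp algebra_simps)
    then have "(\<Sum>i<n. star (f i r) * f i s) = f r s - p r s + (\<Sum>i<n. p r i * p i s)"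
      using rs by (simp add: sum.distrib sum_subtractf)
    then show ?thesis using pp rs by simp
  qed
  have quad: "(\<Sum>i<n. star (\<Sum>r<n. t 1 (g i r) * D r) * (\<Sum>s<n. t 1 (g i s) * D s)) =
      (\<Sum>r<n. \<Sum>s<n. star (D r) * t 1 (\<Sum>i<n. star (g i r) * g i s) * D s)"
    for g :: "nat \<Rightarrow> nat \<Rightarrow> 'q" and D :: "nat \<Rightarrow> 't"
  proof -
    have "(\<Sum>i<n. star (\<Sum>r<n. t 1 (g i r) * D r) * (\<Sum>s<n. t 1 (g i s) * D s)) =
        (\<Sum>i<n. \<Sum>r<n. \<Sum>s<n. star (D r) * (t 1 (star (g i r)) * t 1 (g i s)) * D s)"
      by (simp add: star_sum star_mult t_star[OF tens] sum_product mult.assoc)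
    also have "\<dots> = (\<Sum>r<n. \<Sum>i<n. \<Sum>s<n. star (D r) * (t 1 (star (g i r)) * t 1 (g i s)) * D s)"
      by (rule sum.swap)
    also have "\<dots> = (\<Sum>r<n. \<Sum>s<n. \<Sum>i<n. star (D r) * (t 1 (star (g i r)) * t 1 (g i s)) * D s)"
      by (intro sum.cong refl sum.swap)
    finally show ?thesis
      by (simp add: t_mult[OF tens] t_sum_right[OF tens] sum_distrib_left sum_distrib_right)
  qed
  have slice_zero: "(\<Sum>r<n. h (d r j * b) *\<^sub>C f i r) = 0" if i: "i < n" and j: "j < n" for i j b
  proof -
    define X where "X r a = slice t h (t 1 (d r j) * \<Delta> a)" for r a
    have blX: "bounded_linear (X r)" for r unfolding X_def
      by (intro bounded_linear_compose[OF slR] bounded_linear_compose[OF bounded_linear_mult_right]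
        bounded_linear_comult)
    have "\<exists>E. bounded_linear E \<and> (\<forall>x y. E (t x y) = t x (X r y)) \<and> (\<forall>a. \<Delta> (X r a) = E (\<Delta> a))" for r
      using comult_slice[OF h(1), of "d r j"] unfolding X_def by metis
    then obtain E where E: "\<And>r. bounded_linear (E r)" "\<And>r x y. E r (t x y) = t x (X r y)"
      "\<And>r a. \<Delta> (X r a) = E r (\<Delta> a)" by metis
    \<comment> \<open>Invariance of \<open>h\<close> at \<open>d i j * a\<close>, with \<Delta>
      expanded by \<open>com\<close>.\<close>
    have one: "(\<Sum>r<n. d i r * X r a) = h (d i j * a) *\<^sub>C 1" if "i < n" for i a
    proof -
      have "(\<Sum>r<n. d i r * X r a) = slice t h (\<Sum>r<n. t (d i r) (d r j) * \<Delta> a)"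
        unfolding X_def slice_sum[OF tens h(1)] slice_mult_left[OF tens h(1), symmetric]
        by (simp add: t_mult[OF tens] flip: mult.assoc)
      also have "(\<Sum>r<n. t (d i r) (d r j) * \<Delta> a) = \<Delta> (d i j * a)"
        using that j by (simp add: comult_mult com sum_distrib_right)
      finally show ?thesis using h(2) unfolding conv_def by simp
    qed
    \<comment> \<open>\<open>one\<close> tensored with the identity; at
      \<open>z = \<Delta>(a)\<close> it becomes a relation for
      \<open>\<Delta>(X r a)\<close>.\<close>
    have two: "(\<Sum>r<n. t 1 (d i r) * E r z) = t (slice t h (t 1 (d i j) * z)) 1" if "i < n" for i z
    proof (rule tensor_eqI[OF tens, where F = "\<lambda>z. \<Sum>r<n. t 1 (d i r) * E r z"
          and G = "\<lambda>z. t (slice t h (t 1 (d i j) * z)) 1"])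
      show "bounded_linear (\<lambda>z. \<Sum>r<n. t 1 (d i r) * E r z)"
        by (intro bounded_linear_sum bounded_linear_compose[OF bounded_linear_mult_right] E(1))
      show "bounded_linear (\<lambda>z. t (slice t h (t 1 (d i j) * z)) 1)"
        by (intro bounded_linear_compose[OF bounded_linear_tensor[OF tens']]
          bounded_linear_compose[OF slR] bounded_linear_mult_right)
      fix x y
      have "(\<Sum>r<n. t 1 (d i r) * E r (t x y)) = t x (\<Sum>r<n. d i r * X r y)"
        by (simp add: E(2) t_mult[OF tens] t_sum_right[OF tens])
      then show "(\<Sum>r<n. t 1 (d i r) * E r (t x y)) = t (slice t h (t 1 (d i j) * t x y)) 1"
        using one[OF that] by (simp add: t_mult[OF tens] slice_tensor[OF tens h(1)]
          t_scaleC_left[OF tens] t_scaleC_right[OF tens])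
    qed
    then have twoX: "(\<Sum>r<n. t 1 (d i r) * \<Delta> (X r a)) = t (X i a) 1" if "i < n" for i a
      using that unfolding E(3) X_def[of i] by simp
    define Y where "Y i a = (\<Sum>r<n. t 1 (f i r) * \<Delta> (X r a))" for i a
    \<comment> \<open>As \<open>f\<close> is a projection, the sum is
      \<open>star (\<Delta> X) (1 \<otimes> (1 - p)) (\<Delta> X)\<close>, and \<open>twoX\<close>
      evaluates the part with \<open>p\<close>. The resulting difference vanishes under
      \<open>h \<otimes> id\<close> by invariance.\<close>
    have YY: "(\<Sum>i<n. star (Y i a) * Y i a) =
        (\<Sum>i<n. \<Delta> (star (X i a) * X i a) - t (star (X i a) * X i a) 1)" for a
    proof -
      let ?D = "\<lambda>r. \<Delta> (X r a)"
      have "(\<Sum>i<n. star (Y i a) * Y i a) = (\<Sum>r<n. \<Sum>s<n. star (?D r) * t 1 (f r s) * ?D s)"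
        unfolding Y_def quad by (intro sum.cong refl) (simp add: ff)
      also have "\<dots> = (\<Sum>r<n. \<Sum>s<n. (if r = s then star (?D r) * ?D s else 0) - star (?D r) * t 1 (p r s) * ?D s)"
        unfolding f_def by (intro sum.cong refl) (auto simp: t_diff_right[OF tens] t_one[OF tens]
          t_minus_right[OF tens] t_zero_right[OF tens] algebra_simps)
      also have "\<dots> = (\<Sum>r<n. star (?D r) * ?D r) - (\<Sum>r<n. \<Sum>s<n. star (?D r) * t 1 (p r s) * ?D s)"
        by (simp add: sum_subtractf)
      also have "(\<Sum>r<n. \<Sum>s<n. star (?D r) * t 1 (p r s) * ?D s) =
          (\<Sum>i<n. star (\<Sum>r<n. t 1 (d i r) * ?D r) * (\<Sum>s<n. t 1 (d i s) * ?D s))"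
        unfolding quad p_def ..
      also have "\<dots> = (\<Sum>i<n. t (star (X i a) * X i a) 1)"
        by (simp add: twoX t_star[OF tens] t_mult[OF tens])
      finally show ?thesis by (simp add: comult_mult comult_star sum_subtractf)
    qed
    have LY: "slice t' h (t c 1 * Y i a) = 0" if i: "i < n" for i a c
    proof (rule states_separate)
      fix \<phi> :: "'q \<Rightarrow> complex" assume phi: "state \<phi>"
      note st = state_slice[OF tens' h(1) phi]
      have hL: "slice t' h (\<Delta> x) = slice t' h (t x 1)" for x
        using h(3)[of x] slice_tensor[OF tens' h(1), of x 1] unfolding conv_def by simp
      have "slice t' h (\<Sum>i<n. star (Y i a) * Y i a) = 0"
        unfolding YY by (simp add: slice_sum[OF tens' h(1)] slice_diff[OF tens' h(1)] hL)
      then have "\<phi> (slice t' h (\<Sum>i<n. star (Y i a) * Y i a)) = 0" by (simp add: state_zero[OF phi])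
      then have "(\<Sum>i<n. Re (\<phi> (slice t' h (star (Y i a) * Y i a)))) = 0"
        by (simp add: state_sum[OF st] flip: Re_sum)
      then have "Re (\<phi> (slice t' h (star (Y i a) * Y i a))) = 0"
        using i by (subst (asm) sum_nonneg_eq_0_iff) (auto intro: state_square[OF st])
      then show "\<phi> (slice t' h (t c 1 * Y i a)) = 0" by (intro state_null_left[OF st]) simp
    qed
    \<comment> \<open>\<open>E r\<close> acts on the second leg only, so it commutes with slicing
      the first.\<close>
    have LE: "slice t' h (t c 1 * E r z) = X r (slice t' h (t c 1 * z))" for c r z
    proof (rule tensor_eqI[OF tens, where F = "\<lambda>z. slice t' h (t c 1 * E r z)"
          and G = "\<lambda>z. X r (slice t' h (t c 1 * z))"])
      show "bounded_linear (\<lambda>z. slice t' h (t c 1 * E r z))"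
        by (intro bounded_linear_compose[OF slL] bounded_linear_compose[OF bounded_linear_mult_right] E(1))
      show "bounded_linear (\<lambda>z. X r (slice t' h (t c 1 * z)))"
        by (intro bounded_linear_compose[OF blX] bounded_linear_compose[OF slL] bounded_linear_mult_right)
      have "X r (k *\<^sub>C y) = k *\<^sub>C X r y" for k y
        unfolding X_def by (simp add: comult_scaleC mult_scaleC_right slice_scaleC[OF tens h(1)])
      then show "slice t' h (t c 1 * E r (t x y)) = X r (slice t' h (t c 1 * t x y))" for x y
        by (simp add: E(2) t_mult[OF tens] slice_tensor[OF tens' h(1)])
    qed
    \<comment> \<open>By density of the elements \<open>(c \<otimes> 1) \<Delta>(a)\<close>, the
      argument of \<open>X r\<close> may be the slice of any \<open>z\<close>;
      \<open>z = 1 \<otimes> q\<close> makes it \<open>q\<close>.\<close>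
    have three: "(\<Sum>r<n. f i r * X r q) = 0" if i: "i < n" for i q
    proof -
      have "(\<Sum>r<n. f i r * X r (slice t' h z)) = 0" for z
      proof (rule dense_left_eqI[where F = "\<lambda>z. \<Sum>r<n. f i r * X r (slice t' h z)" and G = "\<lambda>_. 0"])
        show "bounded_linear (\<lambda>z. \<Sum>r<n. f i r * X r (slice t' h z))"
          by (intro bounded_linear_sum bounded_linear_compose[OF bounded_linear_mult_right]
            bounded_linear_compose[OF blX] slL)
        show "bounded_linear (\<lambda>_. 0)" by (rule bounded_linear_zero)
        fix c a
        have "t c 1 * Y i a = (\<Sum>r<n. t 1 (f i r) * (t c 1 * E r (\<Delta> a)))"
          unfolding Y_def E(3) sum_distrib_left by (simp add: t_mult[OF tens] flip: mult.assoc)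
        then have "slice t' h (t c 1 * Y i a) = (\<Sum>r<n. f i r * X r (slice t' h (t c 1 * \<Delta> a)))"
          by (simp add: slice_sum[OF tens' h(1)] slice_mult_left[OF tens' h(1)] LE)
        then show "(\<Sum>r<n. f i r * X r (slice t' h (t c 1 * \<Delta> a))) = 0" using LY[OF i] by simp
      qed
      from this[of "t 1 q"] show ?thesis
        by (simp add: slice_tensor[OF tens' h(1)] state_one[OF h(1)])
    qed
    \<comment> \<open>The same move with the elements \<open>\<Delta>(b) (a \<otimes> 1)\<close>
      removes the \<Delta> inside \<open>X\<close>.\<close>
    have "(\<Sum>r<n. f i r * slice t h (t 1 (d r j) * z)) = 0" for z
    proof (rule dense_left_star_eqI[where F = "\<lambda>z. \<Sum>r<n. f i r * slice t h (t 1 (d r j) * z)"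
          and G = "\<lambda>_. 0"])
      show "bounded_linear (\<lambda>z. \<Sum>r<n. f i r * slice t h (t 1 (d r j) * z))"
        by (intro bounded_linear_sum bounded_linear_compose[OF bounded_linear_mult_right]
          bounded_linear_compose[OF slR] bounded_linear_mult_right)
      show "bounded_linear (\<lambda>_. 0)" by (rule bounded_linear_zero)
      fix a b
      have "(\<Sum>r<n. f i r * slice t h (t 1 (d r j) * (\<Delta> b * t a 1))) = (\<Sum>r<n. f i r * X r b) * a"
        unfolding X_def
        by (simp add: slice_mult_right[OF tens h(1)] sum_distrib_right flip: mult.assoc)
      then show "(\<Sum>r<n. f i r * slice t h (t 1 (d r j) * (\<Delta> b * t a 1))) = 0"
        using three[OF i] by simp
    qed
    from this[of "t 1 b"] show ?thesis
      by (simp add: t_mult[OF tens] slice_tensor[OF tens h(1)] mult_scaleC_right)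
  qed
  \<comment> \<open>Taking \<open>b = star (d s j)\<close> and summing over \<open>j\<close>,
    \<open>co\<close> turns \<open>slice_zero\<close> into \<open>f P = 0\<close>. As
    \<open>p P = p\<close> by \<open>dP\<close>, this says \<open>P = p\<close>.\<close>
  have "(\<Sum>r<n. P r s *\<^sub>C f i r) = (\<Sum>r<n. (\<Sum>j<n. h (d r j * star (d s j))) *\<^sub>C f i r)"
    using ids by (intro sum.cong refl)
      (simp add: co state_scaleC[OF h(1)] state_one[OF h(1)] flip: state_sum[OF h(1)])
  also have "\<dots> = (\<Sum>j<n. \<Sum>r<n. h (d r j * star (d s j)) *\<^sub>C f i r)"
    by (subst sum.swap) (simp add: cvec.scale_sum_left)
  also have "\<dots> = 0" using ids by (simp add: slice_zero)
  finally have "(\<Sum>r<n. P r s *\<^sub>C f i r) = 0" .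
  moreover have "P r s *\<^sub>C f i r = (if i = r then P r s *\<^sub>C 1 else 0) - P r s *\<^sub>C p i r" for r
    unfolding f_def by (simp add: cvec.scale_right_diff_distrib)
  moreover have "(\<Sum>r<n. P r s *\<^sub>C p i r) = p i s"
  proof -
    have "(\<Sum>r<n. P r s *\<^sub>C p i r) = (\<Sum>k<n. star (d k i) * (\<Sum>r<n. P r s *\<^sub>C d k r))"
      unfolding p_def cvec.scale_sum_right by (subst sum.swap) (simp add: sum_distrib_left mult_scaleC_right)
    then show ?thesis unfolding p_def using ids by (simp add: dP)
  qed
  ultimately show ?thesis using ids unfolding p_def by (simp add: sum_subtractf)
qed

section \<open>Matrices over C*-algebras\<close>

lemma dim_adj [simp]: "dim_row (adj u) = dim_col u" "dim_col (adj u) = dim_row u"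
  by (simp_all add: adj_def)

lemma adj_carrier [simp]: "adj u \<in> carrier_mat n m \<longleftrightarrow> u \<in> carrier_mat m n"
  by (metis carrier_matD carrier_matI dim_adj)

lemma index_adj [simp]: "i < dim_col u \<Longrightarrow> j < dim_row u \<Longrightarrow> adj u $$ (i, j) = star (u $$ (j, i))"
  by (simp add: adj_def)

lemma adj_adj [simp]: "adj (adj u) = u"
  by (rule eq_matI) (auto simp: star_star)

lemma index_mult_sum:
  "i < dim_row A \<Longrightarrow> j < dim_col B \<Longrightarrow> dim_col A = dim_row B \<Longrightarrow>
    (A * B) $$ (i, j) = (\<Sum>k<dim_row B. A $$ (i, k) * B $$ (k, j))"
  by (simp add: scalar_prod_def lessThan_atLeast0)

lemma adj_mult: "dim_col A = dim_row B \<Longrightarrow> adj (A * B) = adj B * adj A"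
  by (rule eq_matI) (auto simp: index_mult_sum star_sum star_mult simp del: index_mult_mat(1))

lemma adj_one [simp]: "adj (1\<^sub>m n) = 1\<^sub>m n"
  by (rule eq_matI) auto

lemma adj_minus: "A \<in> carrier_mat n m \<Longrightarrow> B \<in> carrier_mat n m \<Longrightarrow> adj (A - B) = adj A - adj B"
  by (rule eq_matI) (auto simp: star_diff)

lemma dim_cmat [simp]: "dim_row (cmat T) = dim_row T" "dim_col (cmat T) = dim_col T"
  by (simp_all add: cmat_def)

lemma cmat_carrier [simp]: "cmat T \<in> carrier_mat n m \<longleftrightarrow> T \<in> carrier_mat n m"
  by (metis carrier_matD carrier_matI dim_cmat)

lemma index_cmat [simp]: "i < dim_row T \<Longrightarrow> j < dim_col T \<Longrightarrow> cmat T $$ (i, j) = T $$ (i, j) *\<^sub>C 1"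
  by (simp add: cmat_def)

lemma cmat_one [simp]: "cmat (1\<^sub>m n) = 1\<^sub>m n"
  by (rule eq_matI) auto

lemma cmat_zero [simp]: "cmat (0\<^sub>m n m) = 0\<^sub>m n m"
  by (rule eq_matI) auto

lemma cmat_mult: "dim_col S = dim_row T \<Longrightarrow> cmat (S * T) = cmat S * cmat T"
  by (rule eq_matI) (auto simp: index_mult_sum cvec.scale_sum_left mult_scaleC_left scaleC_scaleC
    simp del: index_mult_mat(1))

lemma cmat_minus: "S \<in> carrier_mat n m \<Longrightarrow> T \<in> carrier_mat n m \<Longrightarrow> cmat (S - T) = cmat S - cmat T"
  by (rule eq_matI) (auto simp: cvec.scale_left_diff_distrib)

lemma adj_cmat: "adj (cmat T) = cmat (adj T)"
  by (rule eq_matI) (auto simp: star_scaleC star_complex_def)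

context compact_quantum_group
begin

abbreviation "rep \<equiv> representation t \<Delta>"
abbreviation "comul \<equiv> comultiplicative t \<Delta>"
abbreviation "irrep \<equiv> irreducible_rep t \<Delta>"

lemma comulD: "comul u \<Longrightarrow> i < dim_row u \<Longrightarrow> j < dim_row u \<Longrightarrow>
    \<Delta> (u $$ (i, j)) = (\<Sum>r<dim_row u. t (u $$ (i, r)) (u $$ (r, j)))"
  and comul_carrier: "comul u \<Longrightarrow> u \<in> carrier_mat (dim_row u) (dim_row u)"
  unfolding comultiplicative_def by auto

lemma repD: assumes "rep u"
  shows "comul u" "u \<in> carrier_mat (dim_row u) (dim_row u)"
    "u * adj u = 1\<^sub>m (dim_row u)" "adj u * u = 1\<^sub>m (dim_row u)"
  using assms unfolding representation_def comultiplicative_def by auto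

text \<open>The key to complete reducibility: invariance of the complement of \<open>P\<close> already implies that of \<open>P\<close>,
  because \<open>(P \<otimes> 1) u\<close> is a coisometric comultiplicative matrix.\<close>

lemma invariant_projection_commutes:
  assumes u: "rep u" and P: "P \<in> carrier_mat (dim_row u) (dim_row u)" "P * P = P" "adj P = P"
    and inv: "cmat P * u = cmat P * u * cmat P"
  shows "cmat P * u = u * cmat P"
proof -
  define n where "n = dim_row u"
  have U: "u \<in> carrier_mat n n" "u * adj u = 1\<^sub>m n" "adj u * u = 1\<^sub>m n"
    unfolding n_def by (fact repD[OF u])+
  have Pc: "P \<in> carrier_mat n n" using P unfolding n_def by simp
  then have Pq: "(cmat P :: 'q mat) \<in> carrier_mat n n" "adj (cmat P :: 'q mat) = cmat P"
    "cmat P * cmat P = (cmat P :: 'q mat)"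
    using P by (auto simp: adj_cmat simp flip: cmat_mult)
  \<comment> \<open>\<open>inv\<close> gives \<open>d P = d\<close>, so \<open>P\<close> may be
    inserted between the legs of \<open>\<Delta>(d)\<close>; unitarity of \<open>u\<close> gives
    \<open>d adj d = P\<close>.\<close>
  define d where "d = cmat P * u"
  have D: "d \<in> carrier_mat n n" unfolding d_def using Pq U by simp
  have ad: "adj d = adj u * cmat P" unfolding d_def using Pq U by (simp add: adj_mult)
  have "d * adj d = cmat P * (u * adj u) * cmat P"
    unfolding ad unfolding d_def using Pq(1) U(1)
    by (simp add: assoc_mult_mat[of _ n n _ n _ n])
  then have dd: "d * adj d = cmat P" using U Pq by simp
  have dP: "d * cmat P = d" unfolding d_def using inv by simp
  have Pd: "cmat P * d = d" unfolding d_def using Pq U by (simp flip: assoc_mult_mat[of _ n n _ n _ n])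
  have d_entry: "d $$ (i, j) = (\<Sum>k<n. P $$ (i, k) *\<^sub>C u $$ (k, j))" if "i < n" "j < n" for i j
    unfolding d_def using that Pc U(1)
    by (simp add: index_mult_sum mult_scaleC_left del: index_mult_mat(1))
  have d_entry': "d $$ (i, j) = (\<Sum>k<n. P $$ (k, j) *\<^sub>C d $$ (i, k))" if "i < n" "j < n" for i j
    by (subst dP[symmetric], insert that Pc D)
      (simp add: index_mult_sum mult_scaleC_right del: index_mult_mat(1))
  have "(\<Sum>k<n. star (d $$ (k, i)) * d $$ (k, s)) = P $$ (i, s) *\<^sub>C 1" if ids: "i < n" "s < n" for i s
  proof (rule coisometric_isometric[where d = "\<lambda>i j. d $$ (i, j)" and P = "\<lambda>i j. P $$ (i, j)"])
    fix i j assume ij: "i < n" "j < n"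
    show "(\<Sum>r<n. P $$ (r, j) *\<^sub>C d $$ (i, r)) = d $$ (i, j)" using d_entry'[OF ij] by simp
    have "(cmat P * d) $$ (i, j) = (\<Sum>r<n. P $$ (i, r) *\<^sub>C d $$ (r, j))"
      using ij Pc D by (simp add: index_mult_sum mult_scaleC_left del: index_mult_mat(1))
    then show "(\<Sum>r<n. P $$ (i, r) *\<^sub>C d $$ (r, j)) = d $$ (i, j)" unfolding Pd by simp
    have "(d * adj d) $$ (i, j) = (\<Sum>k<n. d $$ (i, k) * star (d $$ (j, k)))"
      using ij D by (simp add: index_mult_sum del: index_mult_mat(1))
    then show "(\<Sum>k<n. d $$ (i, k) * star (d $$ (j, k))) = P $$ (i, j) *\<^sub>C 1"
      unfolding dd using ij Pc by simp
    have "\<Delta> (d $$ (i, j)) = (\<Sum>k<n. P $$ (i, k) *\<^sub>C (\<Sum>r<n. t (u $$ (k, r)) (u $$ (r, j))))"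
      using ij comulD[OF repD(1)[OF u]] unfolding n_def[symmetric]
      by (simp add: d_entry comult_sum comult_scaleC)
    also have "\<dots> = (\<Sum>r<n. \<Sum>k<n. t (P $$ (i, k) *\<^sub>C u $$ (k, r)) (u $$ (r, j)))"
      by (subst sum.swap) (simp add: cvec.scale_sum_right t_scaleC_left[OF tens])
    also have "\<dots> = (\<Sum>r<n. t (d $$ (i, r)) (u $$ (r, j)))"
      using ij by (simp add: d_entry t_sum_left[OF tens])
    also have "\<dots> = (\<Sum>r<n. \<Sum>s<n. t (P $$ (s, r) *\<^sub>C d $$ (i, s)) (u $$ (r, j)))"
      using ij by (intro sum.cong refl) (subst d_entry', simp_all add: t_sum_left[OF tens])
    also have "\<dots> = (\<Sum>s<n. \<Sum>r<n. t (d $$ (i, s)) (P $$ (s, r) *\<^sub>C u $$ (r, j)))"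
      by (subst sum.swap) (simp add: t_scaleC_left[OF tens] t_scaleC_right[OF tens])
    also have "\<dots> = (\<Sum>s<n. t (d $$ (i, s)) (d $$ (s, j)))"
      using ij by (intro sum.cong refl) (simp add: d_entry t_sum_right[OF tens])
    finally show "\<Delta> (d $$ (i, j)) = (\<Sum>r<n. t (d $$ (i, r)) (d $$ (r, j)))" .
  qed (use ids in auto)
  \<comment> \<open>This reads \<open>adj u P u = P\<close>; multiplication by \<open>u\<close> from
    the left gives the commutation.\<close>
  then have "adj d * d = cmat P"
    using D Pc by (intro eq_matI) (auto simp: index_mult_sum simp del: index_mult_mat(1))
  then have "adj u * (cmat P * (cmat P * u)) = cmat P"
    unfolding ad unfolding d_def using Pq U(1)
    by (simp add: assoc_mult_mat[of _ n n _ n _ n])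
  then have "adj u * (cmat P * u) = cmat P" using Pq U(1)
    by (simp flip: assoc_mult_mat[of "cmat P" n n "cmat P" n u n])
  then have "u * (adj u * (cmat P * u)) = u * cmat P" by simp
  then show ?thesis using U Pq by (simp flip: assoc_mult_mat[of u n n "adj u" n _ n])
qed

end

section \<open>Complex matrices\<close>

lemma mult_assoc_dim:
  fixes A B C :: "'a::semiring_0 mat"
  shows "dim_col A = dim_row B \<Longrightarrow> dim_col B = dim_row C \<Longrightarrow> A * B * C = A * (B * C)"
  by (intro assoc_mult_mat[of A "dim_row A" "dim_row B" B "dim_row C" C "dim_col C"] carrier_matI) auto

lemma mult_cancel_left:
  fixes A B C :: "'a::semiring_1 mat"
  assumes "A * B = 1\<^sub>m n" "dim_col A = dim_row B" "dim_row C = n"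
  shows "A * (B * C) = C"
proof -
  have "dim_col B = n" using arg_cong[OF assms(1), of dim_col] by simp
  then have "A * (B * C) = A * B * C" using assms by (intro mult_assoc_dim[symmetric]) auto
  also have "\<dots> = C" unfolding assms(1) by (rule left_mult_one_mat'[OF assms(3)])
  finally show ?thesis .
qed

lemma complement_idempotent:
  fixes E :: "'a::ring_1 mat"
  assumes E: "E \<in> carrier_mat n n" "E * E = E"
  shows "(1\<^sub>m n - E) * (1\<^sub>m n - E) = 1\<^sub>m n - E"
proof -
  have c: "1\<^sub>m n - E \<in> carrier_mat n n" by (rule minus_carrier_mat[OF E(1)])
  have "(1\<^sub>m n - E) * (1\<^sub>m n - E) = 1\<^sub>m n * (1\<^sub>m n - E) - E * (1\<^sub>m n - E)"
    by (rule minus_mult_distrib_mat[OF one_carrier_mat E(1) c])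
  also have "E * (1\<^sub>m n - E) = E * 1\<^sub>m n - E * E"
    by (rule mult_minus_distrib_mat[OF E(1) one_carrier_mat E(1)])
  also have "\<dots> = 0\<^sub>m n n" using E by simp
  also have "1\<^sub>m n * (1\<^sub>m n - E) - 0\<^sub>m n n = 1\<^sub>m n - E"
    unfolding left_mult_one_mat[OF c] by (rule eq_matI) (use E in auto)
  finally show ?thesis .
qed

text \<open>The trace. For a representation it is the character; for complex matrices it serves to
  compare dimensions.\<close>

definition chi :: "'a::comm_monoid_add mat \<Rightarrow> 'a" where
  "chi u = (\<Sum>i<dim_row u. u $$ (i, i))"

lemma chi_comm:
  fixes A B :: "complex mat"
  assumes "A \<in> carrier_mat n m" "B \<in> carrier_mat m n"
  shows "chi (A * B) = chi (B * A)"
proof -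
  have "chi (A * B) = (\<Sum>i<n. \<Sum>k<m. A $$ (i, k) * B $$ (k, i))"
    unfolding chi_def using assms by (simp add: index_mult_sum del: index_mult_mat(1))
  also have "\<dots> = (\<Sum>k<m. \<Sum>i<n. B $$ (k, i) * A $$ (i, k))"
    by (subst sum.swap) (simp add: mult.commute)
  also have "\<dots> = chi (B * A)"
    unfolding chi_def using assms by (simp add: index_mult_sum del: index_mult_mat(1))
  finally show ?thesis .
qed

lemma chi_one: "chi (1\<^sub>m n) = of_nat n"
  by (simp add: chi_def)

text \<open>The projection \<open>1 - V adj V\<close> has trace \<open>n - k\<close>, which is also
  a sum of squared moduli.\<close>

lemma isometry_dim_le:
  fixes V :: "complex mat"
  assumes V: "V \<in> carrier_mat n k" "adj V * V = 1\<^sub>m k"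
  shows "k \<le> n"
proof -
  define Q where "Q = 1\<^sub>m n - V * adj V"
  have Q: "Q \<in> carrier_mat n n" unfolding Q_def using V(1) by (intro minus_carrier_mat mult_carrier_mat[of _ n k]) auto
  have aV: "adj V \<in> carrier_mat k n" using V(1) by simp
  have VV: "V * adj V \<in> carrier_mat n n" using V(1) aV by (rule mult_carrier_mat)
  have "V * adj V * (V * adj V) = V * (adj V * V) * adj V"
    using V(1) aV by (simp add: mult_assoc_dim)
  then have idem: "V * adj V * (V * adj V) = V * adj V" using V aV by simp
  have "adj Q = Q" unfolding Q_def using VV V(1) aV by (simp add: adj_minus[of _ n n] adj_mult)
  moreover have "Q * Q = Q" unfolding Q_def by (rule complement_idempotent[OF VV idem])
  ultimately have "chi Q = (\<Sum>i<n. \<Sum>k<n. star (Q $$ (k, i)) * Q $$ (k, i))"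
    unfolding chi_def using Q by (metis (no_types, lifting) carrier_matD adj_def index_adj index_mult_sum sum.cong lessThan_iff dim_adj)
  also have "\<dots> = complex_of_real (\<Sum>i<n. \<Sum>k<n. (cmod (Q $$ (k, i)))\<^sup>2)"
    by (simp add: star_complex_def complex_norm_square mult.commute del: of_real_power)
  finally have "0 \<le> Re (chi Q)" by (simp add: sum_nonneg)
  moreover have "chi Q = chi (1\<^sub>m n :: complex mat) - chi (V * adj V)"
    unfolding Q_def chi_def using VV carrier_matD(1)[OF V(1)] by (simp add: sum_subtractf)
  moreover have "chi (V * adj V) = of_nat k"
    using chi_comm[OF V(1) aV] V(2) by (simp add: chi_one)
  ultimately show ?thesis by (simp add: chi_one)
qed

text \<open>Gram-Schmidt: \<open>V = B * C\<close> says that the orthonormal columns lie in the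
  range of \<open>B\<close>, and the last equation that they exhaust it.\<close>

lemma column_space_basis:
  fixes B :: "complex mat"
  assumes B: "B \<in> carrier_mat n m"
  obtains k V C where "V \<in> carrier_mat n k" "C \<in> carrier_mat m k" "adj V * V = 1\<^sub>m k"
    "V = B * C" "V * (adj V * B) = B"
proof -
  \<comment> \<open>Either the procedure has stopped, or \<open>k\<close> orthonormal columns have
    been found; \<open>k = n + 1\<close> rules out the second case.\<close>
  have step: "(\<exists>k V C. V \<in> carrier_mat n k \<and> C \<in> carrier_mat m k \<and> adj V * V = 1\<^sub>m k \<and> V = B * C \<and>
        V * (adj V * B) = B) \<or>
      (\<exists>V C. V \<in> carrier_mat n k \<and> C \<in> carrier_mat m k \<and> adj V * V = 1\<^sub>m k \<and> V = B * C)" for k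
  proof (induction k)
    case 0
    have z: "adj (0\<^sub>m n 0 :: complex mat) * 0\<^sub>m n 0 = 1\<^sub>m 0" "(0\<^sub>m n 0 :: complex mat) = B * 0\<^sub>m m 0"
      by (rule eq_matI; use B in simp)+
    show ?case
      by (intro disjI2 exI[of _ "0\<^sub>m n 0"] exI[of _ "0\<^sub>m m 0"] conjI zero_carrier_mat z)
  next
    case (Suc k)
    then consider (full) "\<exists>k V C. V \<in> carrier_mat n k \<and> C \<in> carrier_mat m k \<and> adj V * V = 1\<^sub>m k \<and>
        V = B * C \<and> V * (adj V * B) = B"
      | (more) V C where "V \<in> carrier_mat n k" "C \<in> carrier_mat m k" "adj V * V = 1\<^sub>m k" "V = B * C"
      by blast
    then show ?case
    proof cases
      case full then show ?thesis by blast
    next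
      case (more V C)
      have aV: "adj V \<in> carrier_mat k n" using more(1) by simp
      define R where "R = B - V * (adj V * B)"
      have aVB: "adj V * B \<in> carrier_mat k m" using aV B by (rule mult_carrier_mat)
      have VVB: "V * (adj V * B) \<in> carrier_mat n m" using more(1) aVB by (rule mult_carrier_mat)
      have R: "R \<in> carrier_mat n m" unfolding R_def by (rule minus_carrier_mat[OF VVB])
      show ?thesis
      proof (cases "R = 0\<^sub>m n m")
        case True
        have "V * (adj V * B) = B"
        proof (rule eq_matI)
          fix i j assume "i < dim_row B" "j < dim_col B"
          then show "(V * (adj V * B)) $$ (i, j) = B $$ (i, j)"
            using True B VVB unfolding R_def
            by (metis (no_types, lifting) carrier_matD eq_iff_diff_eq_0 index_minus_mat(1) index_zero_mat(1))
        qed (simp_all add: carrier_matD[OF B] carrier_matD[OF more(1)])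
        then show ?thesis using more by blast
      next
        case False
        then obtain i0 j where ij: "i0 < n" "j < m" "R $$ (i0, j) \<noteq> 0"
          using R by (metis carrier_matD eq_matI index_zero_mat)
        define N where "N = (\<Sum>i<n. (cmod (R $$ (i, j)))\<^sup>2)"
        have "(cmod (R $$ (i0, j)))\<^sup>2 \<le> N" unfolding N_def
          using ij by (intro member_le_sum) auto
        then have N: "N > 0" using ij(3) by (smt (verit) zero_less_norm_iff zero_less_power)
        \<comment> \<open>Normalizes the nonzero column \<open>j\<close> of the residual
          \<open>R\<close>. The new column is \<open>z = R c\<close>, and \<open>c'\<close> rewrites
          it as a combination of the columns of \<open>B\<close>.\<close>
        define al where "al = 1 / sqrt N"
        define c where "c = mat m 1 (\<lambda>(i, _). if i = j then complex_of_real al else 0)"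
        have c: "c \<in> carrier_mat m 1" unfolding c_def by simp
        define z where "z = R * c"
        have z: "z \<in> carrier_mat n 1" unfolding z_def using R c by (rule mult_carrier_mat)
        have zi: "z $$ (i, 0) = complex_of_real al * R $$ (i, j)" if "i < n" for i
        proof -
          have "z $$ (i, 0) = (\<Sum>l<m. R $$ (i, l) * (if l = j then complex_of_real al else 0))"
            unfolding z_def c_def using that R by (simp add: index_mult_sum del: index_mult_mat(1))
          also have "\<dots> = (\<Sum>l<m. if l = j then complex_of_real al * R $$ (i, l) else 0)"
            by (intro sum.cong) auto
          also have "\<dots> = complex_of_real al * R $$ (i, j)" using ij by simp
          finally show ?thesis .
        qed
        define c' where "c' = c - C * (adj V * (B * c))"
        have Bc: "B * c \<in> carrier_mat n 1" using B c by (rule mult_carrier_mat)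
        have aVBc: "adj V * (B * c) \<in> carrier_mat k 1" using aV Bc by (rule mult_carrier_mat)
        have c': "c' \<in> carrier_mat m 1" unfolding c'_def
          using c more(2) aVBc by (intro minus_carrier_mat mult_carrier_mat[of _ m k]) auto
        have "B * c' = B * c - B * (C * (adj V * (B * c)))"
          unfolding c'_def using B c more(2) aVBc
          by (intro mult_minus_distrib_mat[of _ n m]) (auto intro: mult_carrier_mat)
        also have "B * (C * (adj V * (B * c))) = V * (adj V * (B * c))"
          unfolding more(4) using B more(2) aVBc[unfolded more(4)] by (rule assoc_mult_mat[symmetric])
        also have "V * (adj V * (B * c)) = V * (adj V * B) * c"
          using more(1) aV B c aVB by (simp add: assoc_mult_mat[of _ n k _ m _ 1] assoc_mult_mat[of _ k n _ m _ 1])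
        also have "B * c - V * (adj V * B) * c = z"
          unfolding z_def R_def using B VVB c by (intro minus_mult_distrib_mat[symmetric])
        finally have Bc': "B * c' = z" .
        have "adj V * R = adj V * B - adj V * (V * (adj V * B))"
          unfolding R_def using aV B VVB by (rule mult_minus_distrib_mat)
        also have "adj V * (V * (adj V * B)) = adj V * B"
          using aV more(1,3) aVB by (simp add: assoc_mult_mat[symmetric, of _ k n _ k _ m])
        finally have "adj V * R = 0\<^sub>m k m" using aVB by simp
        then have Vz: "adj V * z = 0\<^sub>m k 1"
          unfolding z_def using aV R c by (simp add: assoc_mult_mat[symmetric, of _ k n _ m _ 1])
        have Vz': "(\<Sum>i<n. star (V $$ (i, a)) * z $$ (i, 0)) = 0" if "a < k" for a
        proof -
          have "(adj V * z) $$ (a, 0) = (\<Sum>i<n. star (V $$ (i, a)) * z $$ (i, 0))"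
            using that more(1) z by (simp add: index_mult_sum del: index_mult_mat(1))
          then show ?thesis using Vz that by simp
        qed
        have zz: "(\<Sum>i<n. star (z $$ (i, 0)) * z $$ (i, 0)) = 1"
        proof -
          have "(\<Sum>i<n. star (z $$ (i, 0)) * z $$ (i, 0)) =
              (\<Sum>i<n. complex_of_real (1 / N * (cmod (R $$ (i, j)))\<^sup>2))"
          proof (intro sum.cong refl)
            fix i assume "i \<in> {..<n}"
            then have "star (z $$ (i, 0)) * z $$ (i, 0) =
                complex_of_real (al * al) * (R $$ (i, j) * cnj (R $$ (i, j)))"
              using zi by (simp add: star_complex_def)
            also have "al * al = 1 / N" unfolding al_def using N by simp
            also have "R $$ (i, j) * cnj (R $$ (i, j)) = complex_of_real ((cmod (R $$ (i, j)))\<^sup>2)"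
              by (simp only: complex_norm_square)
            finally show "star (z $$ (i, 0)) * z $$ (i, 0) = complex_of_real (1 / N * (cmod (R $$ (i, j)))\<^sup>2)"
              by simp
          qed
          also have "\<dots> = complex_of_real (1 / N * N)" unfolding N_def by (simp add: sum_distrib_left)
          finally show ?thesis using N by simp
        qed
        define V' where "V' = mat n (Suc k) (\<lambda>(i, l). if l < k then V $$ (i, l) else z $$ (i, 0))"
        define C' where "C' = mat m (Suc k) (\<lambda>(i, l). if l < k then C $$ (i, l) else c' $$ (i, 0))"
        have "V' = B * C'"
        proof (rule eq_matI)
          fix i l assume "i < dim_row (B * C')" "l < dim_col (B * C')"
          then have il: "i < n" "l < Suc k" unfolding C'_def using B by auto
          have "V' $$ (i, l) = (if l < k then (B * C) $$ (i, l) else (B * c') $$ (i, 0))"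
            unfolding V'_def more(4)[symmetric] Bc' using il by simp
          also have "\<dots> = (B * C') $$ (i, l)"
            unfolding C'_def using il B more(2) c' by (auto simp: index_mult_sum simp del: index_mult_mat(1))
          finally show "V' $$ (i, l) = (B * C') $$ (i, l)" .
        qed (use B in \<open>auto simp: V'_def C'_def\<close>)
        moreover have "adj V' * V' = 1\<^sub>m (Suc k)"
        proof (rule eq_matI)
          fix a b assume "a < dim_row (1\<^sub>m (Suc k) :: complex mat)" "b < dim_col (1\<^sub>m (Suc k) :: complex mat)"
          then have ab: "a < Suc k" "b < Suc k" by auto
          have e: "(adj V' * V') $$ (a, b) = (\<Sum>i<n. star (V' $$ (i, a)) * V' $$ (i, b))"
            using ab by (simp add: index_mult_sum V'_def del: index_mult_mat(1))
          show "(adj V' * V') $$ (a, b) = 1\<^sub>m (Suc k) $$ (a, b)"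
          proof (cases "a < k"; cases "b < k")
            assume k: "a < k" "b < k"
            have "(adj V * V) $$ (a, b) = (\<Sum>i<n. star (V $$ (i, a)) * V $$ (i, b))"
              using k more(1) by (simp add: index_mult_sum del: index_mult_mat(1))
            then show ?thesis unfolding e using k more(3) by (simp add: V'_def)
          next
            assume k: "a < k" "\<not> b < k"
            then show ?thesis unfolding e using ab Vz'[of a] by (simp add: V'_def)
          next
            assume k: "\<not> a < k" "b < k"
            have "(\<Sum>i<n. star (z $$ (i, 0)) * V $$ (i, b)) = star (\<Sum>i<n. star (V $$ (i, b)) * z $$ (i, 0))"
              unfolding star_sum by (simp add: star_mult star_star)
            then show ?thesis unfolding e using ab k Vz'[of b] by (simp add: V'_def)
          next
            assume k: "\<not> a < k" "\<not> b < k"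
            then show ?thesis unfolding e using ab zz by (simp add: V'_def)
          qed
        qed (simp_all add: V'_def)
        moreover have "V' \<in> carrier_mat n (Suc k)" "C' \<in> carrier_mat m (Suc k)"
          unfolding V'_def C'_def by simp_all
        ultimately show ?thesis by blast
      qed
    qed
  qed
  have "\<not> (\<exists>V C. V \<in> carrier_mat n (Suc n) \<and> C \<in> carrier_mat m (Suc n) \<and> adj V * V = 1\<^sub>m (Suc n) \<and> V = B * C)"
    using isometry_dim_le by (metis Suc_n_not_le_n)
  then show ?thesis using step[of "Suc n"] that by blast
qed

text \<open>\<open>P V = V\<close> since the columns of \<open>V\<close> lie in the range of
  \<open>P\<close>; so \<open>P V adj V\<close> equals \<open>V adj V\<close> and, by the adjoint of
  the spanning relation, also \<open>P\<close>.\<close>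

lemma projection_isometry:
  fixes P :: "complex mat"
  assumes P: "P \<in> carrier_mat n n" "P * P = P" "adj P = P"
  obtains k V where "V \<in> carrier_mat n k" "adj V * V = 1\<^sub>m k" "V * adj V = P"
proof -
  obtain k V C where V: "V \<in> carrier_mat n k" "C \<in> carrier_mat n k" "adj V * V = 1\<^sub>m k"
    "V = P * C" "V * (adj V * P) = P" using column_space_basis[OF P(1)] by metis
  have aV: "adj V \<in> carrier_mat k n" using V(1) by simp
  have VVP: "V * adj V * P = P" using V(1,5) aV P(1) by (simp add: assoc_mult_mat[of _ n k _ n _ n])
  have "adj (V * adj V * P) = P * (V * adj V)" using V(1) P by (simp add: adj_mult)
  then have "P * (V * adj V) = P" unfolding VVP by (simp add: P)
  moreover have "P * V = V"
  proof -
    have "P * (P * C) = P * P * C" using P(1) V(2) by (simp add: assoc_mult_mat[of _ n n _ n _ k])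
    then show ?thesis unfolding V(4) P(2) .
  qed
  then have "P * (V * adj V) = V * adj V"
    using P(1) V(1) aV by (simp flip: assoc_mult_mat[of _ n n _ k _ n])
  ultimately show ?thesis using that V by simp
qed

text \<open>\<open>1 - P\<close> projects onto the range of \<open>adj N\<close>. The factorization
  \<open>1 - P = G * N\<close> is the point: it makes an intertwining relation for \<open>N\<close>
  applicable to \<open>1 - P\<close>.\<close>

lemma kernel_projection:
  fixes N :: "complex mat"
  assumes N: "N \<in> carrier_mat m n"
  obtains P G where "P \<in> carrier_mat n n" "P * P = P" "adj P = P" "N * P = 0\<^sub>m m n"
    "G \<in> carrier_mat n m" "1\<^sub>m n - P = G * N"
proof -
  have aN: "adj N \<in> carrier_mat n m" using N by simp
  obtain k V C where V: "V \<in> carrier_mat n k" "C \<in> carrier_mat m k" "adj V * V = 1\<^sub>m k"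
    "V = adj N * C" "V * (adj V * adj N) = adj N" using column_space_basis[OF aN] by metis
  have aV: "adj V \<in> carrier_mat k n" and aC: "adj C \<in> carrier_mat k m" using V by simp_all
  define E where "E = V * adj V"
  have E: "E \<in> carrier_mat n n" unfolding E_def using V(1) aV by (rule mult_carrier_mat)
  have EE: "E * E = E"
  proof -
    have "E * E = V * (adj V * V) * adj V" unfolding E_def
      using V(1) aV by (simp add: mult_assoc_dim)
    then show ?thesis using V aV unfolding E_def by simp
  qed
  have aE: "adj E = E" unfolding E_def using V(1) by (simp add: adj_mult)
  have "E * adj N = adj N" unfolding E_def using V(1,5) aV aN by (simp add: assoc_mult_mat[of _ n k _ n _ m])
  then have "adj (E * adj N) = N" by simp
  then have NE: "N * E = N" using E aN aE by (simp add: adj_mult)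
  have GN: "E = V * adj C * N"
  proof -
    have "adj V = adj C * N" unfolding V(4) using V(2) N by (simp add: adj_mult)
    then show ?thesis unfolding E_def using V(1) aC N by (simp add: assoc_mult_mat[of _ n k _ m _ n])
  qed
  show ?thesis
  proof (rule that[of "1\<^sub>m n - E" "V * adj C"])
    show "1\<^sub>m n - E \<in> carrier_mat n n" by (rule minus_carrier_mat[OF E])
    show "(1\<^sub>m n - E) * (1\<^sub>m n - E) = 1\<^sub>m n - E" by (rule complement_idempotent[OF E EE])
    show "adj (1\<^sub>m n - E) = 1\<^sub>m n - E" using E aE by (simp add: adj_minus[of _ n n])
    show "N * (1\<^sub>m n - E) = 0\<^sub>m m n" using N E NE by (simp add: mult_minus_distrib_mat[of _ m n _ n])
    show "V * adj C \<in> carrier_mat n m" using V(1) aC by (rule mult_carrier_mat)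
    have "1\<^sub>m n - (1\<^sub>m n - E) = E" by (rule eq_matI) (use E in auto)
    then show "1\<^sub>m n - (1\<^sub>m n - E) = V * adj C * N" using GN by simp
  qed
qed

text \<open>Associativity identifies the inverses; then the traces of \<open>A H\<close> and
  \<open>H A\<close> equate the dimensions.\<close>

lemma two_sided_inverse:
  fixes A :: "complex mat"
  assumes A: "A \<in> carrier_mat m n" and G: "G \<in> carrier_mat n m" "G * A = 1\<^sub>m n"
    and H: "H \<in> carrier_mat n m" "A * H = 1\<^sub>m m"
  shows "m = n" "G = H"
proof -
  have "G = G * (A * H)" using G H by simp
  also have "\<dots> = H" using assms by (intro mult_cancel_left[OF G(2)]) auto
  finally show "G = H" .
  then have "chi (1\<^sub>m m :: complex mat) = chi (1\<^sub>m n :: complex mat)"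
    using chi_comm[OF A H(1)] G H by simp
  then show "m = n" by (simp add: chi_one)
qed

section \<open>Equivalence of matrices\<close>

lemma equivalentI:
  fixes u v :: "'a::cstar_algebra mat"
  assumes "u \<in> carrier_mat n n" "v \<in> carrier_mat n n" "T \<in> carrier_mat n n" "S \<in> carrier_mat n n"
    "S * T = 1\<^sub>m n" "T * S = 1\<^sub>m n" "cmat T * u = v * cmat T"
  shows "equivalent u v"
proof -
  have "invertible_mat T" unfolding invertible_mat_def inverts_mat_def
    using assms by (intro conjI exI[of _ S]) (auto simp: square_mat.simps)
  then show ?thesis unfolding equivalent_def using assms by auto
qed

lemma equivalentE:
  assumes "equivalent u v"
  obtains T S where "T \<in> carrier_mat (dim_row v) (dim_row v)" "S \<in> carrier_mat (dim_row v) (dim_row v)"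
    "S * T = 1\<^sub>m (dim_row v)" "T * S = 1\<^sub>m (dim_row v)" "cmat T * u = v * cmat T" "dim_row u = dim_row v"
proof -
  obtain T where T: "T \<in> carrier_mat (dim_row v) (dim_row u)" "invertible_mat T"
    "cmat T * u = v * cmat T" "dim_row u = dim_row v" using assms unfolding equivalent_def by auto
  obtain S where S: "T * S = 1\<^sub>m (dim_row T)" "S * T = 1\<^sub>m (dim_row S)"
    using T(2) unfolding invertible_mat_def inverts_mat_def by blast
  have "dim_col S = dim_row T" "dim_row S = dim_col T"
    using arg_cong[OF S(1), of dim_col] arg_cong[OF S(2), of dim_col] by simp_all
  then have "S \<in> carrier_mat (dim_row v) (dim_row v)" using T by (intro carrier_matI) auto
  then show ?thesis using that T S by auto
qed

lemma equivalent_refl: "u \<in> carrier_mat n n \<Longrightarrow> equivalent u u"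
  by (rule equivalentI[where T = "1\<^sub>m n" and S = "1\<^sub>m n"]) auto

lemma cmat_inverse:
  "S \<in> carrier_mat n n \<Longrightarrow> T \<in> carrier_mat n n \<Longrightarrow> S * T = 1\<^sub>m n \<Longrightarrow> cmat S * cmat T = 1\<^sub>m n"
  by (metis carrier_matD cmat_mult cmat_one)

lemma equivalent_sym:
  assumes eq: "equivalent u v" and u: "u \<in> carrier_mat n n" and v: "v \<in> carrier_mat n n"
  shows "equivalent v (u :: 'a::cstar_algebra mat)"
proof -
  obtain T S where TS: "T \<in> carrier_mat n n" "S \<in> carrier_mat n n" "S * T = 1\<^sub>m n" "T * S = 1\<^sub>m n"
    "cmat T * u = v * cmat T" using equivalentE[OF eq] u v by (metis carrier_matD(1))
  define cT cS where "cT = (cmat T :: 'a mat)" and "cS = (cmat S :: 'a mat)"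
  have c: "cT \<in> carrier_mat n n" "cS \<in> carrier_mat n n" "cS * cT = 1\<^sub>m n" "cT * cS = 1\<^sub>m n" "cT * u = v * cT"
    unfolding cT_def cS_def using TS cmat_inverse by auto
  have "cS * v = cS * v * (cT * cS)" using c v by simp
  also have "\<dots> = cS * (v * cT) * cS" using c(1,2) v by (simp add: assoc_mult_mat[of _ n n _ n _ n])
  also have "\<dots> = (cS * cT) * u * cS" unfolding c(5)[symmetric] using c(1,2) u
    by (simp add: assoc_mult_mat[of _ n n _ n _ n])
  also have "\<dots> = u * cS" using c u by simp
  finally show ?thesis
    using TS u v unfolding cS_def by (intro equivalentI[where T = S and S = T]) auto
qed

lemma equivalent_trans:
  assumes eq: "equivalent u v" "equivalent v w"
    and u: "u \<in> carrier_mat n n" and v: "v \<in> carrier_mat n n" and w: "w \<in> carrier_mat n n"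
  shows "equivalent u (w :: 'a::cstar_algebra mat)"
proof -
  obtain T S where TS: "T \<in> carrier_mat n n" "S \<in> carrier_mat n n" "S * T = 1\<^sub>m n" "T * S = 1\<^sub>m n"
    "cmat T * u = v * cmat T" using equivalentE[OF eq(1)] u v by (metis carrier_matD(1))
  obtain T' S' where TS': "T' \<in> carrier_mat n n" "S' \<in> carrier_mat n n" "S' * T' = 1\<^sub>m n" "T' * S' = 1\<^sub>m n"
    "cmat T' * v = w * cmat T'" using equivalentE[OF eq(2)] v w by (metis carrier_matD(1))
  have c: "(cmat T :: 'a mat) \<in> carrier_mat n n" "(cmat T' :: 'a mat) \<in> carrier_mat n n" using TS TS' by auto
  show ?thesis
  proof (rule equivalentI[where T = "T' * T" and S = "S * S'"])
    show "S * S' * (T' * T) = 1\<^sub>m n"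
      using TS TS' by (simp add: mult_assoc_dim mult_cancel_left[OF TS'(3)])
    show "T' * T * (S * S') = 1\<^sub>m n"
      using TS TS' by (simp add: mult_assoc_dim mult_cancel_left[OF TS(4)])
    have "cmat (T' * T) * u = cmat T' * (cmat T * u)"
      using TS TS' u c by (simp add: cmat_mult assoc_mult_mat[of _ n n _ n _ n])
    also have "\<dots> = (cmat T' * v) * cmat T" unfolding TS(5) using c v by (simp add: assoc_mult_mat[of _ n n _ n _ n])
    also have "\<dots> = w * (cmat T' * cmat T)" unfolding TS'(5) using c w by (simp add: assoc_mult_mat[of _ n n _ n _ n])
    finally show "cmat (T' * T) * u = w * cmat (T' * T)" using TS TS' by (simp add: cmat_mult)
  qed (use u w TS TS' in auto)
qed

lemma equivalent_dim: "equivalent u v \<Longrightarrow> dim_row u = dim_row v"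
  unfolding equivalent_def by simp

lemma dsum_four_block: "dsum a b =
    four_block_mat a (0\<^sub>m (dim_row a) (dim_col b)) (0\<^sub>m (dim_row b) (dim_col a)) b"
  unfolding dsum_def diag_block_mat.simps(2)[of a "[b]"] diag_block_mat_singleton Let_def ..

lemma diag_block_mat_append_dsum: "diag_block_mat (vs @ ws) = dsum (diag_block_mat vs) (diag_block_mat ws)"
  unfolding dsum_four_block by (simp add: diag_block_mat_append Let_def)

lemma dsum_carrier [simp]:
  "a \<in> carrier_mat n n \<Longrightarrow> b \<in> carrier_mat m m \<Longrightarrow> dsum a b \<in> carrier_mat (n + m) (n + m)"
  unfolding dsum_four_block by simp

lemma dim_dsum [simp]: "dim_row (dsum a b) = dim_row a + dim_row b" "dim_col (dsum a b) = dim_col a + dim_col b"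
  unfolding dsum_four_block by simp_all

lemma equivalent_dsum:
  fixes a a' b b' :: "'a::cstar_algebra mat"
  assumes eq: "equivalent a a'" "equivalent b b'"
    and c: "a \<in> carrier_mat n n" "a' \<in> carrier_mat n n" "b \<in> carrier_mat m m" "b' \<in> carrier_mat m m"
  shows "equivalent (dsum a b) (dsum a' b')"
proof -
  obtain T S where TS: "T \<in> carrier_mat n n" "S \<in> carrier_mat n n" "S * T = 1\<^sub>m n" "T * S = 1\<^sub>m n"
    "cmat T * a = a' * cmat T" using equivalentE[OF eq(1)] c by (metis carrier_matD(1))
  obtain T' S' where TS': "T' \<in> carrier_mat m m" "S' \<in> carrier_mat m m" "S' * T' = 1\<^sub>m m" "T' * S' = 1\<^sub>m m"
    "cmat T' * b = b' * cmat T'" using equivalentE[OF eq(2)] c by (metis carrier_matD(1))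
  let ?T = "four_block_mat T (0\<^sub>m n m) (0\<^sub>m m n) T'" and ?S = "four_block_mat S (0\<^sub>m n m) (0\<^sub>m m n) S'"
  have cT: "cmat ?T = four_block_mat (cmat T) (0\<^sub>m n m) (0\<^sub>m m n) (cmat T')"
    by (rule eq_matI) (use TS TS' in auto)
  have q: "(cmat T :: 'a mat) \<in> carrier_mat n n" "(cmat T' :: 'a mat) \<in> carrier_mat m m" using TS TS' by auto
  show ?thesis
  proof (rule equivalentI[where T = ?T and S = ?S and n = "n + m"])
    show "?S * ?T = 1\<^sub>m (n + m)" using TS TS'
      by (subst mult_four_block_mat[of _ n n _ m _ m _ _ n _ m]) auto
    show "?T * ?S = 1\<^sub>m (n + m)" using TS TS'
      by (subst mult_four_block_mat[of _ n n _ m _ m _ _ n _ m]) auto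
    have "cmat ?T * dsum a b = four_block_mat (cmat T * a) (0\<^sub>m n m) (0\<^sub>m m n) (cmat T' * b)"
      unfolding cT dsum_four_block using q c
      by (subst mult_four_block_mat[of _ n n _ m _ m _ _ n _ m]) auto
    also have "\<dots> = dsum a' b' * cmat ?T"
      unfolding cT dsum_four_block TS(5) TS'(5) using q c
      by (subst mult_four_block_mat[of _ n n _ m _ m _ _ n _ m]) auto
    finally show "cmat ?T * dsum a b = dsum a' b' * cmat ?T" .
  qed (use c TS TS' in auto)
qed

section \<open>Complete reducibility and Schur's lemma\<close>

lemma index_cmat_mult:
  assumes "i < dim_row A" "j < dim_col X" "dim_col A = dim_row X"
  shows "(cmat A * X) $$ (i, j) = (\<Sum>a<dim_row X. A $$ (i, a) *\<^sub>C X $$ (a, j))"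
  using assms by (simp add: index_mult_sum mult_scaleC_left del: index_mult_mat(1))

lemma index_mult_cmat:
  assumes "i < dim_row X" "j < dim_col B" "dim_col X = dim_row B"
  shows "(X * cmat B) $$ (i, j) = (\<Sum>l<dim_row B. B $$ (l, j) *\<^sub>C X $$ (i, l))"
  using assms by (simp add: index_mult_sum mult_scaleC_right del: index_mult_mat(1))

lemma sum_lessThan_add: "(\<Sum>r<n + (m::nat). g r) = (\<Sum>r<n. g r) + (\<Sum>r<m. g (n + r) :: 'a::comm_monoid_add)"
  by (induction m) (simp_all add: add.assoc)

lemma minus_zero_mat: "X \<in> carrier_mat n m \<Longrightarrow> X - 0\<^sub>m n m = (X :: 'a::group_add mat)"
  by (rule eq_matI) auto

lemma eq_of_minus_mat_zero:
  fixes X Y :: "'a::group_add mat"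
  assumes "X \<in> carrier_mat n m" "Y \<in> carrier_mat n m" "X - Y = 0\<^sub>m n m"
  shows "X = Y"
proof (rule eq_matI)
  fix i j assume "i < dim_row Y" "j < dim_col Y"
  then have "(X - Y) $$ (i, j) = X $$ (i, j) - Y $$ (i, j)" "i < n" "j < m" using assms(1,2) by auto
  then have "X $$ (i, j) - Y $$ (i, j) = 0" using assms(3) by (metis index_zero_mat(1))
  then show "X $$ (i, j) = Y $$ (i, j)" by simp
qed (use assms in auto)

lemma scaleC_if:
  "(if Q then 1 else 0) *\<^sub>C x = (if Q then x else 0)"
  "(c * (if Q then 1 else 0)) *\<^sub>C x = (if Q then c *\<^sub>C x else 0)"
  by auto

text \<open>The trace identity survives because one factor has scalar entries; it fails in general
  for matrices over a noncommutative algebra.\<close>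

lemma chi_cmat_comm:
  fixes X :: "'a::cstar_algebra mat"
  assumes "T \<in> carrier_mat m n" "X \<in> carrier_mat n m"
  shows "chi (cmat T * X) = chi (X * cmat T)"
proof -
  have "chi (cmat T * X) = (\<Sum>i<m. \<Sum>a<n. T $$ (i, a) *\<^sub>C X $$ (a, i))"
    unfolding chi_def using assms by (simp add: index_cmat_mult del: index_mult_mat(1))
  also have "\<dots> = (\<Sum>a<n. \<Sum>i<m. T $$ (i, a) *\<^sub>C X $$ (a, i))" by (rule sum.swap)
  also have "\<dots> = chi (X * cmat T)"
    unfolding chi_def using assms by (simp add: index_mult_cmat del: index_mult_mat(1))
  finally show ?thesis .
qed

lemma chi_equivalent:
  fixes u v :: "'a::cstar_algebra mat"
  assumes eq: "equivalent u v" and u: "u \<in> carrier_mat n n" and v: "v \<in> carrier_mat n n"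
  shows "chi u = chi v"
proof -
  obtain T S where TS: "T \<in> carrier_mat n n" "S \<in> carrier_mat n n" "S * T = 1\<^sub>m n" "T * S = 1\<^sub>m n"
    "cmat T * u = v * cmat T" using equivalentE[OF eq] u v by (metis carrier_matD(1))
  have c: "(cmat T :: 'a mat) \<in> carrier_mat n n" "(cmat S :: 'a mat) \<in> carrier_mat n n" using TS by simp_all
  have q: "cmat T * cmat S = (1\<^sub>m n :: 'a mat)" "cmat S * cmat T = (1\<^sub>m n :: 'a mat)"
    using cmat_inverse[OF TS(1,2,4)] cmat_inverse[OF TS(2,1,3)] .
  have "v = v * cmat T * cmat S"
    using q(1) c v by (simp add: mult_assoc_dim[of v])
  then have "chi v = chi (cmat T * u * cmat S)" using TS(5) by simp
  also have "\<dots> = chi (cmat S * (cmat T * u))"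
    using chi_cmat_comm[OF TS(2), of "cmat T * u"] c u by (simp add: mult_carrier_mat[OF c(1) u])
  also have "cmat S * (cmat T * u) = u"
    using c u by (intro mult_cancel_left[OF q(2)]) auto
  finally show ?thesis by simp
qed

lemma chi_dsum:
  assumes "a \<in> carrier_mat n n" "b \<in> carrier_mat m m"
  shows "chi (dsum a b) = chi a + chi (b :: 'a::cstar_algebra mat)"
  unfolding chi_def dsum_four_block using assms by (simp add: sum_lessThan_add)

lemma equivalent_permutation:
  fixes v w :: "'a::cstar_algebra mat"
  assumes w: "w \<in> carrier_mat n n" and v: "v \<in> carrier_mat n n" and s: "bij_betw s {..<n} {..<n}"
    and eq: "\<And>i j. i < n \<Longrightarrow> j < n \<Longrightarrow> v $$ (i, j) = w $$ (s i, s j)"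
  shows "equivalent w v"
proof -
  define T where "T = mat n n (\<lambda>(i, j). if j = s i then 1 else 0 :: complex)"
  define S where "S = mat n n (\<lambda>(i, j). if i = s j then 1 else 0 :: complex)"
  have TS: "T \<in> carrier_mat n n" "S \<in> carrier_mat n n" unfolding T_def S_def by simp_all
  have sn: "s i < n" if "i < n" for i using s that bij_betwE by blast
  have inj: "s i = s j \<longleftrightarrow> i = j" if "i < n" "j < n" for i j
    using s that by (metis bij_betw_def inj_on_eq_iff lessThan_iff)
  have TS1: "T * S = 1\<^sub>m n"
  proof (rule eq_matI)
    fix i j assume "i < dim_row (1\<^sub>m n :: complex mat)" "j < dim_col (1\<^sub>m n :: complex mat)"
    then have ij: "i < n" "j < n" by auto
    have "(T * S) $$ (i, j) = (\<Sum>k<n. (if k = s i then 1 else 0) * (if k = s j then 1 else 0))"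
      unfolding T_def S_def using ij by (simp add: index_mult_sum del: index_mult_mat(1))
    also have "\<dots> = (\<Sum>k<n. if k = s i then (if i = j then 1 else 0) else 0)"
      using ij inj by (intro sum.cong) auto
    finally show "(T * S) $$ (i, j) = 1\<^sub>m n $$ (i, j)" using ij sn by simp
  qed (use TS in simp_all)
  have ST1: "S * T = 1\<^sub>m n" by (rule mat_mult_left_right_inverse[OF TS TS1])
  show ?thesis
  proof (rule equivalentI[OF w v TS ST1 TS1], rule eq_matI)
    fix i j assume "i < dim_row (v * cmat T)" "j < dim_col (v * cmat T)"
    then have ij: "i < n" "j < n" using v TS by auto
    obtain k where k: "k < n" "j = s k" using s ij(2) by (metis bij_betw_imp_surj_on imageE lessThan_iff)
    have "(cmat T * w) $$ (i, j) = (\<Sum>a<n. if a = s i then w $$ (a, j) else 0)"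
      using ij w TS by (subst index_cmat_mult) (auto simp: T_def scaleC_if intro!: sum.cong)
    also have "\<dots> = w $$ (s i, j)" using sn[OF ij(1)] by simp
    also have "\<dots> = (\<Sum>l<n. if l = k then v $$ (i, l) else 0)" using ij k eq by simp
    also have "\<dots> = (v * cmat T) $$ (i, j)"
      using ij v TS k inj by (subst index_mult_cmat) (auto simp: T_def scaleC_if intro!: sum.cong)
    finally show "(cmat T * w) $$ (i, j) = (v * cmat T) $$ (i, j)" .
  qed (use v w TS in auto)
qed

lemma dsum_assoc: "dsum (dsum a b) c = dsum a (dsum b c)"
proof -
  have "dsum (dsum a b) c = diag_block_mat ([a, b] @ [c])"
    unfolding diag_block_mat_append_dsum by (simp only: dsum_def diag_block_mat_singleton)
  also have "\<dots> = diag_block_mat ([a] @ [b, c])" by simp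
  also have "\<dots> = dsum a (dsum b c)"
    unfolding diag_block_mat_append_dsum by (simp only: dsum_def diag_block_mat_singleton)
  finally show ?thesis .
qed

lemma equivalent_dsum_swap:
  fixes a b :: "'a::cstar_algebra mat"
  assumes a: "a \<in> carrier_mat n n" and b: "b \<in> carrier_mat m m"
  shows "equivalent (dsum a b) (dsum b a)"
proof (rule equivalent_permutation[where s = "\<lambda>i. if i < m then n + i else i - m"])
  have "inj_on (\<lambda>i. if i < m then n + i else i - m) {..<n + m}"
    by (auto simp: inj_on_def split: if_splits)
  moreover have "(\<lambda>i. if i < m then n + i else i - m) ` {..<n + m} \<subseteq> {..<n + m}" by auto
  ultimately show "bij_betw (\<lambda>i. if i < m then n + i else i - m) {..<n + m} {..<n + m}"
    unfolding bij_betw_def using endo_inj_surj by blast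
  show "dsum a b \<in> carrier_mat (n + m) (n + m)" using a b by simp
  show "dsum b a \<in> carrier_mat (n + m) (n + m)" using dsum_carrier[OF b a] by (simp add: add.commute)
  show "dsum b a $$ (i, j) = dsum a b $$ (if i < m then n + i else i - m, if j < m then n + j else j - m)"
    if "i < n + m" "j < n + m" for i j
    unfolding dsum_four_block using that a b by auto
qed

context compact_quantum_group
begin

text \<open>For \<open>F = cmat A * w\<close> the comultiplication has the form
  \<open>F \<otimes> w\<close>. The hypothesis reads \<open>F = w' A\<close>, so \<open>A\<close>
  can be moved across the tensor sign and both legs become the compression
  \<open>w'\<close>.\<close>

lemma comul_compress:
  assumes w: "comul w" "w \<in> carrier_mat n n" and A: "A \<in> carrier_mat k n" and B: "B \<in> carrier_mat n k"
    and eq: "cmat A * w * cmat B * cmat A = cmat A * w"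
  shows "comul (cmat A * w * cmat B)"
proof -
  define F H w' where "F = cmat A * w" and "H = w * cmat B" and "w' = cmat A * w * cmat B"
  have c: "(cmat A :: 'q mat) \<in> carrier_mat k n" "(cmat B :: 'q mat) \<in> carrier_mat n k" using A B by simp_all
  have FH: "F \<in> carrier_mat k n" "H \<in> carrier_mat n k" "w' \<in> carrier_mat k k"
    unfolding F_def H_def w'_def using c w(2) by (auto intro!: mult_carrier_mat)
  have w'F: "w' = F * cmat B" and w'H: "w' = cmat A * H" and Fw': "F = w' * cmat A"
    unfolding w'_def F_def H_def using c w(2) eq by (simp_all add: mult_assoc_dim)
  have "\<Delta> (w' $$ (i, j)) = (\<Sum>s<k. t (w' $$ (i, s)) (w' $$ (s, j)))" if ij: "i < k" "j < k" for i j
  proof -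
    have DF: "\<Delta> (F $$ (i, l)) = (\<Sum>r<n. t (F $$ (i, r)) (w $$ (r, l)))" if l: "l < n" for l
    proof -
      have "\<Delta> (F $$ (i, l)) = (\<Sum>a<n. \<Sum>r<n. t (A $$ (i, a) *\<^sub>C w $$ (a, r)) (w $$ (r, l)))"
        unfolding F_def using ij l A w comulD[OF w(1)]
        by (simp add: index_cmat_mult comult_sum comult_scaleC cvec.scale_sum_right t_scaleC_left[OF tens]
          del: index_mult_mat(1))
      also have "\<dots> = (\<Sum>r<n. t (F $$ (i, r)) (w $$ (r, l)))"
        unfolding F_def using ij l A w
        by (subst sum.swap) (simp add: index_cmat_mult t_sum_left[OF tens] del: index_mult_mat(1))
      finally show ?thesis .
    qed
    have "\<Delta> (w' $$ (i, j)) = (\<Sum>l<n. B $$ (l, j) *\<^sub>C (\<Sum>r<n. t (F $$ (i, r)) (w $$ (r, l))))"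
      unfolding w'F using ij FH B DF
      by (simp add: index_mult_cmat comult_sum comult_scaleC del: index_mult_mat(1))
    also have "\<dots> = (\<Sum>r<n. \<Sum>l<n. t (F $$ (i, r)) (B $$ (l, j) *\<^sub>C w $$ (r, l)))"
      by (subst sum.swap) (simp add: cvec.scale_sum_right t_scaleC_right[OF tens])
    also have "\<dots> = (\<Sum>r<n. t (F $$ (i, r)) (H $$ (r, j)))"
      unfolding H_def using ij w B
      by (simp add: index_mult_cmat t_sum_right[OF tens] del: index_mult_mat(1))
    also have "\<dots> = (\<Sum>r<n. \<Sum>s<k. t (A $$ (s, r) *\<^sub>C w' $$ (i, s)) (H $$ (r, j)))"
      using ij A FH
      by (subst Fw') (simp add: index_mult_cmat t_sum_left[OF tens] del: index_mult_mat(1))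
    also have "\<dots> = (\<Sum>s<k. \<Sum>r<n. t (w' $$ (i, s)) (A $$ (s, r) *\<^sub>C H $$ (r, j)))"
      by (subst sum.swap) (simp add: t_scaleC_left[OF tens] t_scaleC_right[OF tens])
    also have "\<dots> = (\<Sum>s<k. t (w' $$ (i, s)) (w' $$ (s, j)))"
    proof (intro sum.cong refl)
      fix s assume "s \<in> {..<k}"
      then have "w' $$ (s, j) = (\<Sum>r<n. A $$ (s, r) *\<^sub>C H $$ (r, j))"
        unfolding w'H using ij A FH by (simp add: index_cmat_mult del: index_mult_mat(1))
      then show "(\<Sum>r<n. t (w' $$ (i, s)) (A $$ (s, r) *\<^sub>C H $$ (r, j))) = t (w' $$ (i, s)) (w' $$ (s, j))"
        by (simp add: t_sum_right[OF tens])
    qed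
    finally show ?thesis .
  qed
  then show ?thesis unfolding comultiplicative_def w'_def[symmetric]
    using carrier_matD[OF FH(3)] by simp
qed

lemma comul_dsum:
  assumes a: "comul a" and b: "comul b" shows "comul (dsum a b)"
proof -
  define n m where "n = dim_row a" and "m = dim_row b"
  have ac: "a \<in> carrier_mat n n" and bc: "b \<in> carrier_mat m m"
    using comul_carrier[OF a] comul_carrier[OF b] unfolding n_def m_def .
  have d0: "\<Delta> 0 = 0" using comult_scaleC[of 0 0] by simp
  have "\<Delta> (dsum a b $$ (i, j)) = (\<Sum>r<n + m. t (dsum a b $$ (i, r)) (dsum a b $$ (r, j)))"
    if "i < n + m" "j < n + m" for i j
    unfolding sum_lessThan_add dsum_four_block
    using that ac bc comulD[OF a] comulD[OF b] d0 t_zero_left[OF tens] t_zero_right[OF tens] by auto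
  then show ?thesis unfolding comultiplicative_def using ac bc by simp
qed

lemma comul_diag_block: "\<forall>v\<in>set vs. comul v \<Longrightarrow> comul (diag_block_mat vs)"
proof (induction vs)
  case Nil
  show ?case by (simp add: comultiplicative_def)
next
  case (Cons v vs)
  have "diag_block_mat ([v] @ vs) = dsum v (diag_block_mat vs)"
    unfolding diag_block_mat_append_dsum by (simp only: diag_block_mat_singleton)
  moreover have "comul (dsum v (diag_block_mat vs))" using Cons by (intro comul_dsum) simp_all
  ultimately show ?case by (simp only: append_Cons append_Nil)
qed

lemma irrepD: assumes "irrep u"
  shows "rep u" "0 < dim_row u" "u \<in> carrier_mat (dim_row u) (dim_row u)" "comul u"
    "\<And>P. P \<in> carrier_mat (dim_row u) (dim_row u) \<Longrightarrow> P * P = P \<Longrightarrow> adj P = P \<Longrightarrow>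
      u * cmat P = cmat P * u * cmat P \<Longrightarrow> P = 0\<^sub>m (dim_row u) (dim_row u) \<or> P = 1\<^sub>m (dim_row u)"
  using assms repD unfolding irreducible_rep_def by blast+

text \<open>The projection \<open>V adj V\<close> can be moved past \<open>w\<close> and absorbed by
  \<open>adj V * V = 1\<close>. This yields both unitarity relations and the identity that
  \<open>comul_compress\<close> needs.\<close>

lemma rep_compress:
  assumes w: "rep w" "w \<in> carrier_mat n n" and V: "V \<in> carrier_mat n k" "adj V * V = 1\<^sub>m k"
    and com: "cmat (V * adj V) * w = w * cmat (V * adj V)"
  shows "rep (cmat (adj V) * w * cmat V)"
    and "cmat (adj V) * w * cmat V * cmat (adj V) = cmat (adj V) * w"
proof -
  define cV cA where "cV = (cmat V :: 'q mat)" and "cA = (cmat (adj V) :: 'q mat)"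
  have aV: "adj V \<in> carrier_mat k n" using V(1) by simp
  have c: "cV \<in> carrier_mat n k" "cA \<in> carrier_mat k n" unfolding cV_def cA_def using V(1) aV by simp_all
  have ac: "adj cV = cA" "adj cA = cV" unfolding cV_def cA_def by (simp_all add: adj_cmat)
  have AV: "cA * cV = 1\<^sub>m k" unfolding cA_def cV_def using V aV by (simp flip: cmat_mult)
  have com': "cV * (cA * w) = w * (cV * cA)"
    using com V(1) aV w(2) c unfolding cV_def cA_def by (simp add: cmat_mult mult_assoc_dim)
  note wu = repD[OF w(1)]
  have awc: "adj w \<in> carrier_mat n n" using w(2) by simp
  have ww: "w * adj w = 1\<^sub>m n" "adj w * w = 1\<^sub>m n" using wu w(2) by auto
  have eq: "cA * w * cV * cA = cA * w"
  proof -
    have "cA * w * cV * cA = cA * (w * (cV * cA))" using c w(2) by (simp add: mult_assoc_dim)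
    also have "\<dots> = cA * (cV * (cA * w))" unfolding com' ..
    also have "\<dots> = cA * w" using AV c w(2) by (intro mult_cancel_left) auto
    finally show ?thesis .
  qed
  then show "cmat (adj V) * w * cmat V * cmat (adj V) = cmat (adj V) * w" unfolding cA_def cV_def .
  have comul: "comul (cA * w * cV)"
    using comul_compress[OF wu(1) w(2) aV V(1)] eq unfolding cA_def cV_def by simp
  have adj: "adj (cA * w * cV) = cA * adj w * cV"
    using c w(2) awc by (simp add: adj_mult ac mult_assoc_dim)
  have "cA * w * cV * (cA * adj w * cV) = (cA * w * cV * cA) * (adj w * cV)"
    using c w(2) awc by (simp add: mult_assoc_dim)
  also have "\<dots> = cA * (w * (adj w * cV))" unfolding eq using c w(2) awc by (simp add: mult_assoc_dim)
  also have "\<dots> = 1\<^sub>m k" using ww(1) c w(2) awc AV by (simp add: mult_cancel_left)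
  finally have 1: "cA * w * cV * adj (cA * w * cV) = 1\<^sub>m k" unfolding adj .
  have "adj (cA * w * cV * cA) = adj (cA * w)" unfolding eq ..
  then have eq': "cV * (cA * adj w * cV) = adj w * cV"
    using c w(2) awc by (simp add: adj_mult ac mult_assoc_dim)
  have "cA * adj w * cV * (cA * w * cV) = cA * adj w * (cV * (cA * w)) * cV"
    using c w(2) awc by (simp add: mult_assoc_dim)
  also have "\<dots> = cA * (adj w * (w * (cV * (cA * cV))))"
    unfolding com' using c w(2) awc by (simp add: mult_assoc_dim)
  also have "\<dots> = 1\<^sub>m k" using ww(2) c w(2) awc AV by (simp add: mult_cancel_left)
  finally have 2: "adj (cA * w * cV) * (cA * w * cV) = 1\<^sub>m k" unfolding adj .
  show "rep (cmat (adj V) * w * cmat V)"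
    unfolding representation_def using comul 1 2 aV unfolding cA_def cV_def by simp
qed

text \<open>Invariance of \<open>P\<close> amounts to \<open>(1 - P) w = (1 - P) w (1 - P)\<close>,
  the hypothesis of \<open>invariant_projection_commutes\<close> for the complement. So both
  projections commute with \<open>w\<close> and both compressions are unitary.\<close>

lemma rep_split:
  assumes w: "rep w" and P: "P \<in> carrier_mat (dim_row w) (dim_row w)" "P * P = P" "adj P = P"
    and inv: "w * cmat P = cmat P * w * cmat P"
    and nontriv: "P \<noteq> 0\<^sub>m (dim_row w) (dim_row w)" "P \<noteq> 1\<^sub>m (dim_row w)"
  obtains w\<^sub>1 w\<^sub>2 where "rep w\<^sub>1" "rep w\<^sub>2" "dim_row w\<^sub>1 < dim_row w" "dim_row w\<^sub>2 < dim_row w"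
    "equivalent w (dsum w\<^sub>1 w\<^sub>2)"
proof -
  define n where "n = dim_row w"
  have wc: "w \<in> carrier_mat n n" using repD(2)[OF w] unfolding n_def .
  have Pc: "P \<in> carrier_mat n n" using P unfolding n_def by simp
  define P' where "P' = 1\<^sub>m n - P"
  have P'c: "P' \<in> carrier_mat n n" unfolding P'_def by (rule minus_carrier_mat[OF Pc])
  have P'P': "P' * P' = P'" unfolding P'_def by (rule complement_idempotent[OF Pc P(2)])
  have aP': "adj P' = P'" unfolding P'_def using Pc P by (simp add: adj_minus[of _ n n])
  define cP where "cP = (cmat P :: 'q mat)"
  have cP: "cP \<in> carrier_mat n n" unfolding cP_def using Pc by simp
  have cP': "cmat P' = 1\<^sub>m n - cP" unfolding P'_def cP_def using Pc by (simp add: cmat_minus[of _ n n])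
  have cP'c: "1\<^sub>m n - cP \<in> carrier_mat n n" by (rule minus_carrier_mat[OF cP])
  have cw: "cP * w \<in> carrier_mat n n" and wP: "w * cP \<in> carrier_mat n n"
    using cP wc by (auto intro: mult_carrier_mat)
  have P'w: "(1\<^sub>m n - cP) * w = w - cP * w"
    using minus_mult_distrib_mat[OF one_carrier_mat cP wc] wc by simp
  have "(w - cP * w) * (1\<^sub>m n - cP) = (w - cP * w) - (w - cP * w) * cP"
    using mult_minus_distrib_mat[OF minus_carrier_mat[OF cw] one_carrier_mat cP, of w] wc cw by simp
  also have "(w - cP * w) * cP = w * cP - cP * w * cP" by (rule minus_mult_distrib_mat[OF wc cw cP])
  also have "\<dots> = 0\<^sub>m n n" using inv wP unfolding cP_def[symmetric] by simp
  finally have "(w - cP * w) * (1\<^sub>m n - cP) = w - cP * w"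
    using minus_zero_mat[OF minus_carrier_mat[OF cw]] by simp
  then have "cmat P' * w = cmat P' * w * cmat P'" unfolding cP' P'w by simp
  from invariant_projection_commutes[OF w _ P'P' aP' this] P'c
  have comP': "cmat P' * w = w * cmat P'" unfolding n_def by simp
  have comP: "cP * w = w * cP"
  proof (rule eq_matI)
    have "w * (1\<^sub>m n - cP) = w - w * cP" using mult_minus_distrib_mat[OF wc one_carrier_mat cP] wc by simp
    then have e: "w - cP * w = w - w * cP" using comP' unfolding cP' P'w by simp
    fix i j assume "i < dim_row (w * cP)" "j < dim_col (w * cP)"
    then have ij: "i < n" "j < n" using wc cP by auto
    have "(w - cP * w) $$ (i, j) = (w - w * cP) $$ (i, j)" using e by simp
    then show "(cP * w) $$ (i, j) = (w * cP) $$ (i, j)" using ij wc cP cw wP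
      by (simp del: index_mult_mat(1))
  qed (use wc cP in auto)
  obtain k V where V: "V \<in> carrier_mat n k" "adj V * V = 1\<^sub>m k" "V * adj V = P"
    using projection_isometry[OF Pc P(2,3)] by metis
  obtain k' V' where V': "V' \<in> carrier_mat n k'" "adj V' * V' = 1\<^sub>m k'" "V' * adj V' = P'"
    using projection_isometry[OF P'c P'P' aP'] by metis
  have aV: "adj V \<in> carrier_mat k n" and aV': "adj V' \<in> carrier_mat k' n" using V(1) V'(1) by simp_all
  have PP': "P + P' = 1\<^sub>m n" unfolding P'_def by (rule eq_matI) (use Pc in auto)
  have VV': "adj V * V' = 0\<^sub>m k k'"
  proof -
    have "P * P' = P * 1\<^sub>m n - P * P" unfolding P'_def by (rule mult_minus_distrib_mat[OF Pc one_carrier_mat Pc])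
    then have PP0: "P * P' = 0\<^sub>m n n" using Pc P(2) by simp
    have "adj V * V' = adj V * (V * (adj V * (V' * (adj V' * V'))))"
      using V V' aV aV' by (simp add: mult_cancel_left[OF V(2)])
    also have "\<dots> = adj V * (P * P') * V'"
      unfolding V(3)[symmetric] V'(3)[symmetric] using V(1) V'(1) aV aV' by (simp add: mult_assoc_dim)
    also have "\<dots> = 0\<^sub>m k k'" unfolding PP0 using aV V'(1) by simp
    finally show ?thesis .
  qed
  have V'V: "adj V' * V = 0\<^sub>m k' k"
  proof -
    have "adj (adj V * V') = adj V' * V" using V(1) V'(1) by (simp add: adj_mult)
    moreover have "adj (0\<^sub>m k k' :: complex mat) = 0\<^sub>m k' k" by (rule eq_matI) auto
    ultimately show ?thesis unfolding VV' by simp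
  qed
  \<comment> \<open>\<open>adj V\<close> stacked on \<open>adj V'\<close>, with inverse
    \<open>V\<close> beside \<open>V'\<close>; the empty blocks only serve to write these as
    four-block matrices.\<close>
  let ?T = "four_block_mat (adj V) (0\<^sub>m k 0) (adj V') (0\<^sub>m k' 0)"
  let ?S = "four_block_mat V V' (0\<^sub>m 0 k) (0\<^sub>m 0 k')"
  have Tc: "?T \<in> carrier_mat (k + k') n" and Sc: "?S \<in> carrier_mat n (k + k')"
    using V(1) V'(1) by (auto intro!: carrier_matI)
  have "?T * ?S = four_block_mat (adj V * V + 0\<^sub>m k 0 * 0\<^sub>m 0 k) (adj V * V' + 0\<^sub>m k 0 * 0\<^sub>m 0 k')
      (adj V' * V + 0\<^sub>m k' 0 * 0\<^sub>m 0 k) (adj V' * V' + 0\<^sub>m k' 0 * 0\<^sub>m 0 k')"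
    by (rule mult_four_block_mat) (use V(1) V'(1) in auto)
  also have "\<dots> = 1\<^sub>m (k + k')" unfolding V(2) V'(2) VV' V'V by simp
  finally have TS: "?T * ?S = 1\<^sub>m (k + k')" .
  have ST: "?S * ?T = 1\<^sub>m n"
  proof -
    have "?S * ?T = four_block_mat (V * adj V + V' * adj V') (V * 0\<^sub>m k 0 + V' * 0\<^sub>m k' 0)
        (0\<^sub>m 0 k * adj V + 0\<^sub>m 0 k' * adj V') (0\<^sub>m 0 k * 0\<^sub>m k 0 + 0\<^sub>m 0 k' * 0\<^sub>m k' 0)"
      by (rule mult_four_block_mat) (use V(1) V'(1) in auto)
    also have "\<dots> = 1\<^sub>m n" unfolding V(3) V'(3) PP'
      by (rule eq_matI) (use V(1) V'(1) in auto)
    finally show ?thesis .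
  qed
  have nk: "n = k + k'" using two_sided_inverse(1)[OF Tc Sc ST Sc TS] by simp
  have k0: "k \<noteq> 0"
  proof
    assume "k = 0"
    then have "V * adj V = 0\<^sub>m n n" using V(1)
      by (intro eq_matI) (auto simp: index_mult_sum simp del: index_mult_mat(1))
    then show False using nontriv V(3) unfolding n_def by simp
  qed
  have k'0: "k' \<noteq> 0"
  proof
    assume "k' = 0"
    then have "P' = 0\<^sub>m n n" unfolding V'(3)[symmetric] using V'(1)
      by (intro eq_matI) (auto simp: index_mult_sum simp del: index_mult_mat(1))
    then have "P = 1\<^sub>m n" using PP' Pc by simp
    then show False using nontriv unfolding n_def by simp
  qed
  define w1 w2 where "w1 = cmat (adj V) * w * cmat V" and "w2 = cmat (adj V') * w * cmat V'"
  have r1: "rep w1" "w1 * cmat (adj V) = cmat (adj V) * w" unfolding w1_def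
    using rep_compress[OF w wc V(1,2)] comP V(3) unfolding cP_def by auto
  have r2: "rep w2" "w2 * cmat (adj V') = cmat (adj V') * w" unfolding w2_def
    using rep_compress[OF w wc V'(1,2)] comP' V'(3) by auto
  have w12: "w1 \<in> carrier_mat k k" "w2 \<in> carrier_mat k' k'"
    unfolding w1_def w2_def using V(1) V'(1) by auto
  have cT: "cmat ?T = four_block_mat (cmat (adj V)) (0\<^sub>m k 0) (cmat (adj V')) (0\<^sub>m k' 0 :: 'q mat)"
    by (rule eq_matI) (use V(1) V'(1) in auto)
  have w4: "w = four_block_mat w (0\<^sub>m n 0) (0\<^sub>m 0 n) (0\<^sub>m 0 0)"
    by (rule eq_matI) (use wc in auto)
  have "equivalent w (dsum w1 w2)"
  proof (rule equivalentI[where T = ?T and S = ?S and n = n])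
    have "cmat ?T * w = four_block_mat (cmat (adj V) * w) (0\<^sub>m k 0) (cmat (adj V') * w) (0\<^sub>m k' 0)"
      unfolding cT by (subst w4, subst mult_four_block_mat[of _ k n _ 0 _ k' _ _ n _ 0])
        (use V(1) V'(1) wc in \<open>auto intro!: eq_matI\<close>)
    also have "\<dots> = dsum w1 w2 * cmat ?T"
      unfolding cT dsum_four_block r1(2)[symmetric] r2(2)[symmetric]
      by (subst mult_four_block_mat[of _ k k _ k' _ k' _ _ n _ 0])
        (use V(1) V'(1) w12 in \<open>auto intro!: eq_matI\<close>)
    finally show "cmat ?T * w = dsum w1 w2 * cmat ?T" .
    show "dsum w1 w2 \<in> carrier_mat n n" using dsum_carrier[OF w12] nk by simp
  qed (use wc Tc Sc TS ST nk in simp_all)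
  then show ?thesis using that r1(1) r2(1) w12 nk k0 k'0 unfolding n_def[symmetric] by simp
qed

theorem complete_reducibility:
  assumes "rep w"
  shows "\<exists>vs. (\<forall>v\<in>set vs. irrep v) \<and> equivalent w (diag_block_mat vs)"
  using assms
proof (induction "dim_row w" arbitrary: w rule: less_induct)
  case less
  note wc = repD(2)[OF less.prems]
  consider "dim_row w = 0" | "irrep w" | "0 < dim_row w" "\<not> irrep w" by blast
  then show ?case
  proof cases
    case 1
    \<comment> \<open>The zero-dimensional representation is the empty direct sum.\<close>
    then have "w = diag_block_mat []" using carrier_matD(2)[OF wc] by (intro eq_matI) simp_all
    then show ?thesis using equivalent_refl[OF wc] by (intro exI[of _ "[]"]) simp
  next
    case 2
    have "equivalent w (diag_block_mat [w])"
      unfolding diag_block_mat_singleton by (rule equivalent_refl[OF wc])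
    then show ?thesis using 2 by (intro exI[of _ "[w]"]) auto
  next
    case 3
    then obtain P where P: "P \<in> carrier_mat (dim_row w) (dim_row w)" "P * P = P" "adj P = P"
      "w * cmat P = cmat P * w * cmat P" "P \<noteq> 0\<^sub>m (dim_row w) (dim_row w)" "P \<noteq> 1\<^sub>m (dim_row w)"
      using less.prems unfolding irreducible_rep_def by blast
    obtain w\<^sub>1 w\<^sub>2 where w12: "rep w\<^sub>1" "rep w\<^sub>2" "dim_row w\<^sub>1 < dim_row w" "dim_row w\<^sub>2 < dim_row w"
      "equivalent w (dsum w\<^sub>1 w\<^sub>2)" using rep_split[OF less.prems P] by metis
    obtain vs where vs: "\<forall>v\<in>set vs. irrep v" "equivalent w\<^sub>1 (diag_block_mat vs)"
      using less.hyps[OF w12(3,1)] by blast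
    obtain us where us: "\<forall>v\<in>set us. irrep v" "equivalent w\<^sub>2 (diag_block_mat us)"
      using less.hyps[OF w12(4,2)] by blast
    have "\<forall>v\<in>set vs. comul v" "\<forall>v\<in>set us. comul v" using vs(1) us(1) irrepD(4) by blast+
    note d = this[THEN comul_diag_block, THEN comul_carrier, folded equivalent_dim[OF vs(2)] equivalent_dim[OF us(2)]]
    have c: "w\<^sub>1 \<in> carrier_mat (dim_row w\<^sub>1) (dim_row w\<^sub>1)" "w\<^sub>2 \<in> carrier_mat (dim_row w\<^sub>2) (dim_row w\<^sub>2)"
      "diag_block_mat vs \<in> carrier_mat (dim_row w\<^sub>1) (dim_row w\<^sub>1)"
      "diag_block_mat us \<in> carrier_mat (dim_row w\<^sub>2) (dim_row w\<^sub>2)"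
      by (fact repD(2)[OF w12(1)] repD(2)[OF w12(2)] d)+
    have "equivalent (dsum w\<^sub>1 w\<^sub>2) (diag_block_mat (vs @ us))"
      unfolding diag_block_mat_append_dsum by (rule equivalent_dsum[OF vs(2) us(2) c(1,3,2,4)])
    moreover have dw: "dim_row w = dim_row w\<^sub>1 + dim_row w\<^sub>2" using equivalent_dim[OF w12(5)] by simp
    moreover have "dsum w\<^sub>1 w\<^sub>2 \<in> carrier_mat (dim_row w) (dim_row w)"
      unfolding dw by (rule dsum_carrier[OF c(1,2)])
    moreover have "diag_block_mat (vs @ us) \<in> carrier_mat (dim_row w) (dim_row w)"
      unfolding dw diag_block_mat_append_dsum by (rule dsum_carrier[OF c(3,4)])
    ultimately have "equivalent w (diag_block_mat (vs @ us))"
      using equivalent_trans[OF w12(5) _ wc] by blast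
    then show ?thesis using vs(1) us(1) by (intro exI[of _ "vs @ us"]) auto
  qed
qed

text \<open>Multiplication by \<open>adj v\<close> and \<open>adj w\<close> gives a relation between
  the adjoints of \<open>v\<close> and \<open>w\<close>; taking adjoints leads back to
  \<open>v\<close> and \<open>w\<close> with \<open>adj T\<close>.\<close>

lemma intertwiner_adj:
  assumes v: "rep v" "v \<in> carrier_mat m m" and w: "rep w" "w \<in> carrier_mat n n"
    and T: "T \<in> carrier_mat m n" "cmat T * w = v * cmat T"
  shows "cmat (adj T) * v = w * cmat (adj T)"
proof -
  define cT where "cT = (cmat T :: 'q mat)"
  have c: "cT \<in> carrier_mat m n" unfolding cT_def using T by simp
  have u: "adj v * v = 1\<^sub>m m" "w * adj w = 1\<^sub>m n" using repD[OF v(1)] repD[OF w(1)] v(2) w(2) by auto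
  have Tw: "cT * w = v * cT" using T(2) unfolding cT_def .
  have "adj v * cT = adj v * (cT * (w * adj w))" using c u by simp
  also have "\<dots> = adj v * (cT * w) * adj w" using c v(2) w(2) by (simp add: mult_assoc_dim)
  also have "\<dots> = adj v * (v * (cT * adj w))" unfolding Tw using c v(2) w(2) by (simp add: mult_assoc_dim)
  also have "\<dots> = cT * adj w" using u c v(2) w(2) by (intro mult_cancel_left) auto
  finally have "adj (adj v * cT) = adj (cT * adj w)" by simp
  then have "adj cT * v = w * adj cT" using c v(2) w(2) by (simp add: adj_mult)
  then show ?thesis unfolding cT_def adj_cmat .
qed

text \<open>For the projection \<open>P\<close> onto the kernel of \<open>T\<close>,
  \<open>(1 - P) w P = G T w P = G v T P = 0\<close>. So the kernel is invariant, and
  \<open>T \<noteq> 0\<close> leaves only \<open>P = 0\<close>, i.e. \<open>1 = G T\<close>.\<close>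

lemma intertwiner_injective:
  assumes w: "irrep w" "w \<in> carrier_mat n n" and v: "v \<in> carrier_mat m m"
    and T: "T \<in> carrier_mat m n" "cmat T * w = v * cmat T" "T \<noteq> 0\<^sub>m m n"
  obtains G where "G \<in> carrier_mat n m" "G * T = 1\<^sub>m n"
proof -
  obtain P G where P: "P \<in> carrier_mat n n" "P * P = P" "adj P = P" "T * P = 0\<^sub>m m n"
    "G \<in> carrier_mat n m" "1\<^sub>m n - P = G * T" using kernel_projection[OF T(1)] by metis
  define cP cT cG where "cP = (cmat P :: 'q mat)" and "cT = (cmat T :: 'q mat)" and "cG = (cmat G :: 'q mat)"
  have c: "cP \<in> carrier_mat n n" "cT \<in> carrier_mat m n" "cG \<in> carrier_mat n m"
    unfolding cP_def cT_def cG_def using P T by simp_all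
  have TP: "cT * cP = 0\<^sub>m m n" unfolding cT_def cP_def using P T by (simp flip: cmat_mult)
  have "cG * cT = cmat (G * T)" unfolding cG_def cT_def using P T by (simp add: cmat_mult)
  also have "\<dots> = 1\<^sub>m n - cP"
    unfolding P(6)[symmetric] cmat_minus[OF one_carrier_mat P(1)] cP_def by simp
  finally have cGT: "1\<^sub>m n - cP = cG * cT" by simp
  have wP: "w * cP \<in> carrier_mat n n" using w(2) c(1) by (rule mult_carrier_mat)
  have "(1\<^sub>m n - cP) * (w * cP) = cG * (cT * w * cP)" unfolding cGT using c w(2) by (simp add: mult_assoc_dim)
  also have "cT * w * cP = v * (cT * cP)" using T(2) c v unfolding cT_def[symmetric] by (simp add: mult_assoc_dim)
  also have "cG * \<dots> = 0\<^sub>m n n" unfolding TP using c v by simp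
  finally have "w * cP - cP * (w * cP) = 0\<^sub>m n n"
    using minus_mult_distrib_mat[OF one_carrier_mat c(1) wP] left_mult_one_mat[OF wP] by simp
  then have "w * cP = cP * (w * cP)"
    by (rule eq_of_minus_mat_zero[OF wP mult_carrier_mat[OF c(1) wP]])
  then have "w * cmat P = cmat P * w * cmat P" unfolding cP_def using w(2) P(1) by (simp add: mult_assoc_dim)
  then consider "P = 0\<^sub>m n n" | "P = 1\<^sub>m n" using irrepD(5)[OF w(1), of P] P w(2) by auto
  then show ?thesis
  proof cases
    case 1
    have "1\<^sub>m n - P = 1\<^sub>m n" unfolding 1 by (rule eq_matI) auto
    then show ?thesis using that[OF P(5)] P(6) by simp
  next
    case 2
    then show ?thesis using P(4) T by simp
  qed
qed

text \<open>\<open>T\<close> and \<open>adj T\<close> both have left inverses, so \<open>T\<close>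
  has a two-sided one.\<close>

lemma schur_equivalent:
  assumes v: "irrep v" "v \<in> carrier_mat m m" and w: "irrep w" "w \<in> carrier_mat n n"
    and T: "T \<in> carrier_mat m n" "cmat T * w = v * cmat T" "T \<noteq> 0\<^sub>m m n"
  shows "equivalent w v"
proof -
  have aT: "adj T \<in> carrier_mat n m" "adj T \<noteq> 0\<^sub>m n m"
  proof -
    show "adj T \<noteq> 0\<^sub>m n m"
    proof
      assume "adj T = 0\<^sub>m n m"
      then have "adj (adj T) = 0\<^sub>m m n" by (auto intro!: eq_matI)
      then show False using T by simp
    qed
  qed (use T in simp)
  obtain G where G: "G \<in> carrier_mat n m" "G * T = 1\<^sub>m n"
    using intertwiner_injective[OF w v(2) T] by metis
  obtain H where H: "H \<in> carrier_mat m n" "H * adj T = 1\<^sub>m m"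
    using intertwiner_injective[OF v w(2) aT(1) intertwiner_adj[OF irrepD(1)[OF v(1)] v(2) irrepD(1)[OF w(1)] w(2) T(1,2)] aT(2)]
    by metis
  have H': "adj H \<in> carrier_mat n m" "T * adj H = 1\<^sub>m m"
    using arg_cong[OF H(2), of adj] H(1) T(1) by (simp_all add: adj_mult)
  have "m = n" "G = adj H" using two_sided_inverse[OF T(1) G H'] by auto
  then show ?thesis using equivalentI[of w n v T G] w v T G H' by simp
qed

text \<open>For an eigenvalue \<open>c\<close> the intertwiner \<open>T - c\<close> kills an
  eigenvector, so it has no left inverse and must vanish.\<close>

lemma schur_scalar:
  assumes w: "irrep w" "w \<in> carrier_mat n n" and T: "T \<in> carrier_mat n n" "cmat T * w = w * cmat T"
  obtains c where "T = c \<cdot>\<^sub>m 1\<^sub>m n"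
proof -
  have n: "n > 0" using irrepD(2)[OF w(1)] w(2) by simp
  obtain c x where x: "x \<in> carrier_vec n" "x \<noteq> 0\<^sub>v n" "T *\<^sub>v x = c \<cdot>\<^sub>v x"
    using spectrum_non_empty[OF T(1) n] T(1)
    unfolding spectrum_def eigenvalue_def eigenvector_def by auto
  define N where "N = T - c \<cdot>\<^sub>m 1\<^sub>m n"
  have cI: "c \<cdot>\<^sub>m 1\<^sub>m n \<in> carrier_mat n n" by simp
  have N: "N \<in> carrier_mat n n" unfolding N_def by (rule minus_carrier_mat[OF cI])
  have com: "cmat N * w = w * cmat N"
  proof -
    define cI' where "cI' = (cmat (c \<cdot>\<^sub>m 1\<^sub>m n) :: 'q mat)"
    have c': "cI' \<in> carrier_mat n n" "(cmat T :: 'q mat) \<in> carrier_mat n n" unfolding cI'_def using T(1) by simp_all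
    have "cI' * w = w * cI'"
    proof (rule eq_matI)
      fix i j assume "i < dim_row (w * cI')" "j < dim_col (w * cI')"
      then have ij: "i < n" "j < n" using w c' by auto
      have "(cI' * w) $$ (i, j) = (\<Sum>a<n. (if i = a then c *\<^sub>C w $$ (a, j) else 0))"
        unfolding cI'_def using ij w by (subst index_cmat_mult) (auto simp: scaleC_if intro!: sum.cong)
      also have "\<dots> = (\<Sum>a<n. (if a = j then c *\<^sub>C w $$ (i, a) else 0))" using ij by simp
      also have "\<dots> = (w * cI') $$ (i, j)"
        unfolding cI'_def using ij w by (subst index_mult_cmat) (auto simp: scaleC_if intro!: sum.cong)
      finally show "(cI' * w) $$ (i, j) = (w * cI') $$ (i, j)" .
    qed (use w c' in auto)
    then show ?thesis unfolding N_def cmat_minus[OF T(1) cI] cI'_def[symmetric]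
      using minus_mult_distrib_mat[OF c'(2,1) w(2)] mult_minus_distrib_mat[OF w(2) c'(2,1)] T(2) by simp
  qed
  have Nx: "N *\<^sub>v x = 0\<^sub>v n"
  proof (rule eq_vecI)
    fix i assume "i < dim_vec (0\<^sub>v n :: complex vec)"
    then have i: "i < n" by simp
    have "(N *\<^sub>v x) $ i = (\<Sum>j<n. T $$ (i, j) * x $ j - (if i = j then c * x $ j else 0))"
      unfolding N_def using i T(1) x(1)
      by (auto simp: scalar_prod_def lessThan_atLeast0 left_diff_distrib intro!: sum.cong)
    also have "\<dots> = (T *\<^sub>v x) $ i - c * x $ i"
      using i T(1) x(1) by (simp add: sum_subtractf scalar_prod_def lessThan_atLeast0)
    also have "\<dots> = 0" unfolding x(3) using i x(1) by simp
    finally show "(N *\<^sub>v x) $ i = 0\<^sub>v n $ i" using i by simp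
  qed (use N in simp)
  have "N = 0\<^sub>m n n"
  proof (rule ccontr)
    assume "N \<noteq> 0\<^sub>m n n"
    then obtain G where G: "G \<in> carrier_mat n n" "G * N = 1\<^sub>m n"
      using intertwiner_injective[OF w w(2) N com] by metis
    have "x = G *\<^sub>v (N *\<^sub>v x)" using assoc_mult_mat_vec[OF G(1) N x(1)] G(2) x(1) by simp
    also have "\<dots> = 0\<^sub>v n" unfolding Nx using G(1) by (intro eq_vecI) (auto simp: scalar_prod_def)
    finally show False using x(2) by simp
  qed
  then have "T = c \<cdot>\<^sub>m 1\<^sub>m n"
    unfolding N_def by (rule eq_of_minus_mat_zero[OF T(1) cI])
  then show ?thesis by (rule that)
qed

end

section \<open>Orthogonality of characters\<close>

context compact_quantum_group
begin

text \<open>The matrix \<open>T\<close> is the Haar average of \<open>adj v E w\<close> for the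
  matrix unit \<open>E\<close> at \<open>(a, c)\<close>. Invariance gives
  \<open>adj v T w = T\<close>, and unitarity of \<open>v\<close> makes this an intertwining
  relation.\<close>

lemma haar_intertwiner:
  assumes h: "state h" and hL: "\<And>a. conv (\<lambda>b a. t a b) \<Delta> h a = h a *\<^sub>C 1"
    and v: "rep v" "v \<in> carrier_mat m m" and w: "rep w" "w \<in> carrier_mat n n"
    and ac: "a < m" "c < n"
  shows "cmat (mat m n (\<lambda>(b, d). h (star (v $$ (a, b)) * w $$ (c, d)))) * w =
    v * cmat (mat m n (\<lambda>(b, d). h (star (v $$ (a, b)) * w $$ (c, d))))"
proof -
  define T where "T = mat m n (\<lambda>(b, d). h (star (v $$ (a, b)) * w $$ (c, d)))"
  have T: "T \<in> carrier_mat m n" unfolding T_def by simp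
  define cT where "cT = (cmat T :: 'q mat)"
  have c: "cT \<in> carrier_mat m n" unfolding cT_def using T by simp
  have cw: "cT * w \<in> carrier_mat m n" using c w(2) by (rule mult_carrier_mat)
  have "adj v * (cT * w) = cT"
  proof (rule eq_matI)
    fix b d assume "b < dim_row cT" "d < dim_col cT"
    then have bd: "b < m" "d < n" using c by auto
    have Dv: "\<Delta> (v $$ (a, b)) = (\<Sum>s<m. t (v $$ (a, s)) (v $$ (s, b)))"
      using comulD[OF repD(1)[OF v(1)]] v(2) ac bd by simp
    have Dw: "\<Delta> (w $$ (c, d)) = (\<Sum>r<n. t (w $$ (c, r)) (w $$ (r, d)))"
      using comulD[OF repD(1)[OF w(1)]] w(2) ac bd by simp
    have "\<Delta> (star (v $$ (a, b)) * w $$ (c, d)) =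
        (\<Sum>s<m. \<Sum>r<n. t (star (v $$ (a, s)) * w $$ (c, r)) (star (v $$ (s, b)) * w $$ (r, d)))"
      by (simp add: comult_mult comult_star Dv Dw star_sum t_star[OF tens] sum_product t_mult[OF tens])
    then have "conv t' \<Delta> h (star (v $$ (a, b)) * w $$ (c, d)) =
        (\<Sum>s<m. \<Sum>r<n. h (star (v $$ (a, s)) * w $$ (c, r)) *\<^sub>C (star (v $$ (s, b)) * w $$ (r, d)))"
      unfolding conv_def by (simp add: slice_sum[OF tens' h] slice_tensor[OF tens' h])
    then have inv: "(\<Sum>s<m. \<Sum>r<n. T $$ (s, r) *\<^sub>C (star (v $$ (s, b)) * w $$ (r, d))) = T $$ (b, d) *\<^sub>C 1"
      unfolding T_def hL using bd by simp
    have "(adj v * (cT * w)) $$ (b, d) = (\<Sum>s<m. star (v $$ (s, b)) * (cT * w) $$ (s, d))"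
      using bd cw v(2) by (subst index_mult_sum) auto
    also have "\<dots> = (\<Sum>s<m. star (v $$ (s, b)) * (\<Sum>r<n. T $$ (s, r) *\<^sub>C w $$ (r, d)))"
      unfolding cT_def using bd T w(2) by (intro sum.cong refl) (subst index_cmat_mult, auto)
    also have "\<dots> = T $$ (b, d) *\<^sub>C 1" unfolding inv[symmetric]
      by (simp add: sum_distrib_left mult_scaleC_right)
    finally show "(adj v * (cT * w)) $$ (b, d) = cT $$ (b, d)"
      unfolding cT_def using bd T by simp
  qed (use c v(2) w(2) in auto)
  then have "v * (adj v * (cT * w)) = v * cT" by simp
  moreover have "v * adj v = 1\<^sub>m m" using repD(3)[OF v(1)] v(2) by simp
  then have "v * (adj v * (cT * w)) = cT * w" using v(2) cw by (intro mult_cancel_left) auto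
  ultimately show ?thesis unfolding cT_def T_def by simp
qed

text \<open>By Schur the average of every matrix unit at \<open>(a, c)\<close> vanishes; its entry
  at \<open>(a, c)\<close> is one term of the product of characters.\<close>

lemma character_orthogonal:
  assumes h: "state h" and hL: "\<And>a. conv (\<lambda>b a. t a b) \<Delta> h a = h a *\<^sub>C 1"
    and v: "irrep v" and w: "irrep w" and ne: "\<not> equivalent w v"
  shows "h (star (chi v) * chi w) = 0"
proof -
  define m n where "m = dim_row v" and "n = dim_row w"
  have vc: "v \<in> carrier_mat m m" and wc: "w \<in> carrier_mat n n"
    using irrepD(3)[OF v] irrepD(3)[OF w] unfolding m_def n_def .
  have z: "h (star (v $$ (a, a)) * w $$ (c, c)) = 0" if ac: "a < m" "c < n" for a c
  proof -
    define T where "T = mat m n (\<lambda>(b, d). h (star (v $$ (a, b)) * w $$ (c, d)))"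
    have "cmat T * w = v * cmat T" unfolding T_def
      by (rule haar_intertwiner[OF h hL irrepD(1)[OF v] vc irrepD(1)[OF w] wc ac])
    moreover have "T \<in> carrier_mat m n" unfolding T_def by simp
    ultimately have "T = 0\<^sub>m m n" using schur_equivalent[OF v vc w wc] ne by blast
    then have "T $$ (a, c) = 0" using ac by simp
    then show ?thesis unfolding T_def using ac by simp
  qed
  have "star (chi v) * chi w = (\<Sum>a<m. \<Sum>c<n. star (v $$ (a, a)) * w $$ (c, c))"
    unfolding chi_def star_sum m_def n_def by (simp add: sum_product)
  then show ?thesis using z by (simp add: state_sum[OF h])
qed

text \<open>The Haar state need not be a trace, but the averages are scalar matrices with equal
  diagonal entries; so \<open>v $$ (a, a)\<close> may be replaced by \<open>v $$ (a, 0)\<close> in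
  the diagonal terms, whose sum is then an entry of \<open>adj v * v = 1\<close>.\<close>

lemma character_normalized:
  assumes h: "state h" and hL: "\<And>a. conv (\<lambda>b a. t a b) \<Delta> h a = h a *\<^sub>C 1" and v: "irrep v"
  shows "h (star (chi v) * chi v) = 1"
proof -
  define m where "m = dim_row v"
  have vc: "v \<in> carrier_mat m m" using irrepD(3)[OF v] unfolding m_def .
  have m: "0 < m" using irrepD(2)[OF v] unfolding m_def .
  have z: "h (star (v $$ (a, a)) * v $$ (c, c)) =
      (if a = c then h (star (v $$ (a, 0)) * v $$ (a, 0)) else 0)" if ac: "a < m" "c < m" for a c
  proof -
    define T where "T = mat m m (\<lambda>(b, d). h (star (v $$ (a, b)) * v $$ (c, d)))"
    have "cmat T * v = v * cmat T" unfolding T_def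
      by (rule haar_intertwiner[OF h hL irrepD(1)[OF v] vc irrepD(1)[OF v] vc ac])
    moreover have "T \<in> carrier_mat m m" unfolding T_def by simp
    ultimately obtain k where k: "T = k \<cdot>\<^sub>m 1\<^sub>m m" using schur_scalar[OF v vc] by metis
    have T: "T $$ (b, d) = h (star (v $$ (a, b)) * v $$ (c, d))" if "b < m" "d < m" for b d
      unfolding T_def using that by simp
    show ?thesis using T[OF ac] T[OF m m] k ac m by auto
  qed
  have "star (chi v) * chi v = (\<Sum>a<m. \<Sum>c<m. star (v $$ (a, a)) * v $$ (c, c))"
    unfolding chi_def star_sum m_def by (simp add: sum_product)
  then have "h (star (chi v) * chi v) =
      (\<Sum>a<m. \<Sum>c<m. if a = c then h (star (v $$ (a, 0)) * v $$ (a, 0)) else 0)"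
    using z by (simp add: state_sum[OF h])
  also have "\<dots> = h (\<Sum>a<m. star (v $$ (a, 0)) * v $$ (a, 0))" by (simp add: state_sum[OF h])
  also have "(\<Sum>a<m. star (v $$ (a, 0)) * v $$ (a, 0)) = (adj v * v) $$ (0, 0)"
    using m vc by (subst index_mult_sum) auto
  also have "\<dots> = 1" using repD(4)[OF irrepD(1)[OF v]] m unfolding m_def by simp
  finally show ?thesis using state_one[OF h] by simp
qed

end

section \<open>Tensor products of matrices\<close>

lemma sum_lessThan_mult:
  "(\<Sum>r<n * m. g (r div m) (r mod m)) = (\<Sum>a<n. \<Sum>b<(m::nat). g a b :: 'a::comm_monoid_add)"
proof (induction n)
  case (Suc n)
  have "Suc n * m = n * m + m" by simp
  then show ?case using Suc by (simp only: sum_lessThan_add) simp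
qed simp

lemma dim_tprod [simp]: "dim_row (tprod u v) = dim_row u * dim_row v"
  "dim_col (tprod u v) = dim_col u * dim_col v"
  by (simp_all add: tprod_def)

lemma tprod_carrier [simp]:
  "u \<in> carrier_mat n k \<Longrightarrow> v \<in> carrier_mat m l \<Longrightarrow> tprod u v \<in> carrier_mat (n * m) (k * l)"
  by (intro carrier_matI) auto

lemma index_tprod:
  "v \<in> carrier_mat m l \<Longrightarrow> u \<in> carrier_mat n k \<Longrightarrow> i < n * m \<Longrightarrow> j < k * l \<Longrightarrow>
    tprod u v $$ (i, j) = u $$ (i div m, j div l) * v $$ (i mod m, j mod l)"
  by (simp add: tprod_def)

lemma div_mod_less: "i < n * m \<Longrightarrow> i div m < n \<and> i mod m < (m::nat)"
  by (metis less_mult_imp_div_less mod_less_divisor mult_0_right not_less_zero gr0I)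

lemma div_mod_eq_iff: "i = j \<longleftrightarrow> i div m = j div m \<and> i mod m = j mod (m::nat)"
  by (metis div_mult_mod_eq)

lemma tprod_one: "tprod (1\<^sub>m n) (1\<^sub>m m) = (1\<^sub>m (n * m) :: 'a::cstar_algebra mat)"
proof (rule eq_matI)
  fix i j assume "i < dim_row (1\<^sub>m (n * m) :: 'a mat)" "j < dim_col (1\<^sub>m (n * m) :: 'a mat)"
  then show "tprod (1\<^sub>m n) (1\<^sub>m m) $$ (i, j) = (1\<^sub>m (n * m) :: 'a mat) $$ (i, j)"
    using div_mod_less[of i n m] div_mod_less[of j n m] div_mod_eq_iff[of i j m]
    by (auto simp: index_tprod[of _ m m _ n n])
qed auto

lemma chi_tprod:
  assumes u: "u \<in> carrier_mat n n" and v: "v \<in> carrier_mat m m"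
  shows "chi (tprod u v) = chi u * chi (v :: 'a::cstar_algebra mat)"
proof -
  have "chi (tprod u v) = (\<Sum>r<n * m. u $$ (r div m, r div m) * v $$ (r mod m, r mod m))"
    unfolding chi_def using u v by (simp add: index_tprod[OF v u])
  also have "\<dots> = (\<Sum>a<n. \<Sum>b<m. u $$ (a, a) * v $$ (b, b))"
    by (rule sum_lessThan_mult[of "\<lambda>a b. u $$ (a, a) * v $$ (b, b)"])
  also have "\<dots> = chi u * chi v" unfolding chi_def using u v by (simp add: sum_product)
  finally show ?thesis .
qed

lemma cmat_complex [simp]: "cmat (T :: complex mat) = T"
  by (rule eq_matI) (auto simp: scaleC_complex_def)

lemma cmat_tprod_mult:
  fixes w :: "'a::cstar_algebra mat"
  assumes T: "T \<in> carrier_mat n n" and w: "w \<in> carrier_mat n n" and x: "x \<in> carrier_mat m m"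
  shows "cmat (tprod T (1\<^sub>m m)) * tprod w x = tprod (cmat T * w) x"
    and "tprod w x * cmat (tprod T (1\<^sub>m m)) = tprod (w * cmat T) x"
proof -
  have cT: "cmat T * w \<in> carrier_mat n n" "w * cmat T \<in> carrier_mat n n"
    using T w by (auto intro!: mult_carrier_mat)
  show "cmat (tprod T (1\<^sub>m m)) * tprod w x = tprod (cmat T * w) x"
  proof (rule eq_matI)
    fix i j assume "i < dim_row (tprod (cmat T * w) x)" "j < dim_col (tprod (cmat T * w) x)"
    then have ij: "i < n * m" "j < n * m" using cT x T w by auto
    note d = div_mod_less[OF ij(1)] div_mod_less[OF ij(2)]
    have "(cmat (tprod T (1\<^sub>m m)) * tprod w x) $$ (i, j) =
        (\<Sum>r<n * m. tprod T (1\<^sub>m m) $$ (i, r) *\<^sub>C tprod w x $$ (r, j))"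
      using ij T w x by (subst index_cmat_mult) auto
    also have "\<dots> = (\<Sum>r<n * m. (T $$ (i div m, r div m) * (if i mod m = r mod m then 1 else 0)) *\<^sub>C
        (w $$ (r div m, j div m) * x $$ (r mod m, j mod m)))"
      using ij T w x by (intro sum.cong refl) (use div_mod_less in \<open>auto simp: index_tprod[of _ m m _ n n]\<close>)
    also have "\<dots> = (\<Sum>a<n. \<Sum>b<m. (T $$ (i div m, a) * (if i mod m = b then 1 else 0)) *\<^sub>C
        (w $$ (a, j div m) * x $$ (b, j mod m)))"
      by (rule sum_lessThan_mult[of "\<lambda>a b. (T $$ (i div m, a) * (if i mod m = b then 1 else 0)) *\<^sub>C
        (w $$ (a, j div m) * x $$ (b, j mod m))"])
    also have "\<dots> = (\<Sum>a<n. T $$ (i div m, a) *\<^sub>C w $$ (a, j div m)) * x $$ (i mod m, j mod m)"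
      using d by (simp add: scaleC_if sum_distrib_right mult_scaleC_left)
    also have "\<dots> = (cmat T * w) $$ (i div m, j div m) * x $$ (i mod m, j mod m)"
      using d T w by (subst index_cmat_mult) auto
    finally show "(cmat (tprod T (1\<^sub>m m)) * tprod w x) $$ (i, j) = tprod (cmat T * w) x $$ (i, j)"
      by (simp only: index_tprod[OF x cT(1) ij])
  qed (use T w x in auto)
  show "tprod w x * cmat (tprod T (1\<^sub>m m)) = tprod (w * cmat T) x"
  proof (rule eq_matI)
    fix i j assume "i < dim_row (tprod (w * cmat T) x)" "j < dim_col (tprod (w * cmat T) x)"
    then have ij: "i < n * m" "j < n * m" using cT x T w by auto
    note d = div_mod_less[OF ij(1)] div_mod_less[OF ij(2)]
    have "(tprod w x * cmat (tprod T (1\<^sub>m m))) $$ (i, j) =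
        (\<Sum>r<n * m. tprod T (1\<^sub>m m) $$ (r, j) *\<^sub>C tprod w x $$ (i, r))"
      using ij T w x by (subst index_mult_cmat) auto
    also have "\<dots> = (\<Sum>r<n * m. (T $$ (r div m, j div m) * (if j mod m = r mod m then 1 else 0)) *\<^sub>C
        (w $$ (i div m, r div m) * x $$ (i mod m, r mod m)))"
      using ij T w x by (intro sum.cong refl) (use div_mod_less in \<open>auto simp: index_tprod[of _ m m _ n n]\<close>)
    also have "\<dots> = (\<Sum>a<n. \<Sum>b<m. (T $$ (a, j div m) * (if j mod m = b then 1 else 0)) *\<^sub>C
        (w $$ (i div m, a) * x $$ (i mod m, b)))"
      by (rule sum_lessThan_mult[of "\<lambda>a b. (T $$ (a, j div m) * (if j mod m = b then 1 else 0)) *\<^sub>C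
        (w $$ (i div m, a) * x $$ (i mod m, b))"])
    also have "\<dots> = (\<Sum>a<n. T $$ (a, j div m) *\<^sub>C w $$ (i div m, a)) * x $$ (i mod m, j mod m)"
      using d by (simp add: scaleC_if sum_distrib_right mult_scaleC_left)
    also have "\<dots> = (w * cmat T) $$ (i div m, j div m) * x $$ (i mod m, j mod m)"
      using d T w by (subst index_mult_cmat) auto
    finally show "(tprod w x * cmat (tprod T (1\<^sub>m m))) $$ (i, j) = tprod (w * cmat T) x $$ (i, j)"
      by (simp only: index_tprod[OF x cT(2) ij])
  qed (use T w x in auto)
qed

lemma equivalent_tprod:
  fixes w w' x :: "'a::cstar_algebra mat"
  assumes eq: "equivalent w w'" and w: "w \<in> carrier_mat n n" "w' \<in> carrier_mat n n"
    and x: "x \<in> carrier_mat m m"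
  shows "equivalent (tprod w x) (tprod w' x)"
proof -
  obtain T S where TS: "T \<in> carrier_mat n n" "S \<in> carrier_mat n n" "S * T = 1\<^sub>m n" "T * S = 1\<^sub>m n"
    "cmat T * w = w' * cmat T" using equivalentE[OF eq] w by (metis carrier_matD(1))
  show ?thesis
  proof (rule equivalentI[where T = "tprod T (1\<^sub>m m)" and S = "tprod S (1\<^sub>m m)" and n = "n * m"])
    show "tprod S (1\<^sub>m m) * tprod T (1\<^sub>m m) = 1\<^sub>m (n * m)"
      using cmat_tprod_mult(1)[OF TS(2,1) one_carrier_mat] TS(3) by (simp add: tprod_one)
    show "tprod T (1\<^sub>m m) * tprod S (1\<^sub>m m) = 1\<^sub>m (n * m)"
      using cmat_tprod_mult(1)[OF TS(1,2) one_carrier_mat] TS(4) by (simp add: tprod_one)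
    show "cmat (tprod T (1\<^sub>m m)) * tprod w x = tprod w' x * cmat (tprod T (1\<^sub>m m))"
      unfolding cmat_tprod_mult(1)[OF TS(1) w(1) x] cmat_tprod_mult(2)[OF TS(1) w(2) x] TS(5) ..
  qed (use w x TS in simp_all)
qed

lemma index_dsum_left:
  "b \<in> carrier_mat m m \<Longrightarrow> c \<in> carrier_mat l l \<Longrightarrow> x < m \<Longrightarrow> y < m \<Longrightarrow>
    dsum b c $$ (x, y) = b $$ (x, y)"
  unfolding dsum_four_block by simp

text \<open>In the lexicographic index order the blocks of the left factor stay contiguous, so this
  is an equality; on the right there is only an equivalence, by a shuffle.\<close>

lemma tprod_dsum_left:
  assumes a: "a \<in> carrier_mat n n" and b: "b \<in> carrier_mat m m" and c: "c \<in> carrier_mat l l"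
  shows "tprod (dsum a b) c = dsum (tprod a c) (tprod b (c :: 'a::cstar_algebra mat))"
proof (rule eq_matI)
  fix i j assume "i < dim_row (dsum (tprod a c) (tprod b c))" "j < dim_col (dsum (tprod a c) (tprod b c))"
  then have ij: "i < (n + m) * l" "j < (n + m) * l" using a b c by (auto simp: algebra_simps)
  then have l: "l > 0" by (cases l) auto
  have lt: "k div l < n \<longleftrightarrow> k < n * l" for k using l by (simp add: div_less_iff_less_mult)
  have ge: "(k - n * l) div l = k div l - n" "(k - n * l) mod l = k mod l" if "\<not> k < n * l" for k
  proof -
    define r where "r = k - n * l"
    have kr: "k = n * l + r" unfolding r_def using that by simp
    show "(k - n * l) div l = k div l - n" "(k - n * l) mod l = k mod l"
      unfolding kr using l by (simp_all only: add_diff_cancel_left' div_mult_self3 mod_mult_self3)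
  qed
  have dm: "k div l - n < m" if "k < (n + m) * l" "\<not> k < n * l" for k
    using lt[of k] that(2) div_mod_less[OF that(1)] by linarith
  have dl: "k - n * l < m * l" if "k < (n + m) * l" "\<not> k < n * l" for k
    using that by (simp add: algebra_simps)
  have ab: "dsum a b \<in> carrier_mat (n + m) (n + m)" using a b by simp
  have "tprod (dsum a b) c $$ (i, j) = dsum a b $$ (i div l, j div l) * c $$ (i mod l, j mod l)"
    by (rule index_tprod[OF c ab ij])
  also have "\<dots> = dsum (tprod a c) (tprod b c) $$ (i, j)"
  proof (cases "i < n * l"; cases "j < n * l")
    assume k: "i < n * l" "j < n * l"
    show ?thesis unfolding dsum_four_block using k ij lt[of i] lt[of j] a b c
      by (simp add: index_tprod[OF c a] distrib_right)
  next
    assume k: "i < n * l" "\<not> j < n * l"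
    show ?thesis unfolding dsum_four_block
      using k ij lt[of i] lt[of j] dl[of j] dm[of j] div_mod_less[OF ij(2)] a b c by (simp add: distrib_right)
  next
    assume k: "\<not> i < n * l" "j < n * l"
    show ?thesis unfolding dsum_four_block
      using k ij lt[of i] lt[of j] dl[of i] dm[of i] div_mod_less[OF ij(1)] a b c by (simp add: distrib_right)
  next
    assume k: "\<not> i < n * l" "\<not> j < n * l"
    show ?thesis unfolding dsum_four_block
      using k ij lt[of i] lt[of j] dl[of i] dl[of j] ge(1)[of i] ge(1)[of j] ge(2)[of i] ge(2)[of j]
        div_mod_less[OF ij(1)] div_mod_less[OF ij(2)] a b c
      by (simp add: index_tprod[OF c b] distrib_right)
  qed
  finally show "tprod (dsum a b) c $$ (i, j) = dsum (tprod a c) (tprod b c) $$ (i, j)" .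
qed (use a b c in \<open>auto simp: algebra_simps\<close>)

lemma equivalent_tprod_dsum_right:
  fixes a b c :: "'a::cstar_algebra mat"
  assumes a: "a \<in> carrier_mat n n" and b: "b \<in> carrier_mat m m" and c: "c \<in> carrier_mat l l"
  shows "equivalent (tprod a (dsum b c)) (dsum (tprod a b) (tprod a c))"
proof -
  let ?N = "n * (m + l)"
  \<comment> \<open>Sends a position in the direct sum to the one in the tensor product: the row of
    \<open>a\<close> times \<open>m + l\<close>, plus the offset in \<open>b\<close>, or plus
    \<open>m\<close> and the offset in \<open>c\<close>.\<close>
  define s where "s k = (if k < n * m then (k div m) * (m + l) + k mod m
    else ((k - n * m) div l) * (m + l) + (m + (k - n * m) mod l))" for k
  have s1: "s k div (m + l) = k div m" "s k mod (m + l) = k mod m" "k div m < n" "k mod m < m"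
    if k: "k < n * m" for k
  proof -
    have d: "k div m < n" "k mod m < m" using div_mod_less[OF k] by auto
    then show "k div m < n" "k mod m < m" by auto
    show "s k div (m + l) = k div m" "s k mod (m + l) = k mod m"
      unfolding s_def using k d by (simp_all add: div_mult_self3)
  qed
  have s2: "s k div (m + l) = (k - n * m) div l" "s k mod (m + l) = m + (k - n * m) mod l"
    "(k - n * m) div l < n" "(k - n * m) mod l < l" if k: "\<not> k < n * m" "k < ?N" for k
  proof -
    have k': "k - n * m < n * l" using k by (simp add: algebra_simps)
    have d: "(k - n * m) div l < n" "(k - n * m) mod l < l" using div_mod_less[OF k'] by auto
    then show "(k - n * m) div l < n" "(k - n * m) mod l < l" by auto
    show "s k div (m + l) = (k - n * m) div l" "s k mod (m + l) = m + (k - n * m) mod l"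
      unfolding s_def using k d by (simp_all add: div_mult_self3)
  qed
  have sN: "s k < ?N" if k: "k < ?N" for k
  proof -
    have "s k div (m + l) < n" using s1[of k] s2[of k] k by (cases "k < n * m") auto
    moreover have "m + l > 0" using k by (cases "m + l") auto
    ultimately show ?thesis by (simp add: div_less_iff_less_mult)
  qed
  have "inj_on s {..<?N}"
  proof (rule inj_onI)
    fix k k' assume "k \<in> {..<?N}" "k' \<in> {..<?N}" and eq: "s k = s k'"
    then have k: "k < ?N" "k' < ?N" by auto
    show "k = k'"
    proof (cases "k < n * m"; cases "k' < n * m")
      assume "k < n * m" "k' < n * m"
      then show ?thesis using s1[of k] s1[of k'] eq by (metis div_mod_eq_iff)
    next
      assume "k < n * m" "\<not> k' < n * m"
      then show ?thesis using s1[of k] s2[of k'] k eq by simp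
    next
      assume "\<not> k < n * m" "k' < n * m"
      then show ?thesis using s2[of k] s1[of k'] k eq by simp
    next
      assume kk: "\<not> k < n * m" "\<not> k' < n * m"
      then have "k - n * m = k' - n * m" using s2[of k] s2[of k'] k eq
        by (metis div_mod_eq_iff add_left_cancel)
      then show ?thesis using kk by simp
    qed
  qed
  moreover have "s ` {..<?N} \<subseteq> {..<?N}" using sN by auto
  ultimately have bij: "bij_betw s {..<?N} {..<?N}"
    unfolding bij_betw_def using endo_inj_surj by blast
  have bc: "dsum b c \<in> carrier_mat (m + l) (m + l)" using b c by simp
  show ?thesis
  proof (rule equivalent_permutation[OF _ _ bij])
    show "tprod a (dsum b c) \<in> carrier_mat ?N ?N" using a bc by simp
    show "dsum (tprod a b) (tprod a c) \<in> carrier_mat ?N ?N"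
      using dsum_carrier[OF tprod_carrier[OF a b] tprod_carrier[OF a c]] by (simp only: distrib_left)
    fix i j assume ij: "i < ?N" "j < ?N"
    have e: "tprod a (dsum b c) $$ (s i, s j) = a $$ (s i div (m + l), s j div (m + l)) *
        dsum b c $$ (s i mod (m + l), s j mod (m + l))"
      by (rule index_tprod[OF bc a sN[OF ij(1)] sN[OF ij(2)]])
    have lt: "k - n * m < n * l" if "\<not> k < n * m" "k < ?N" for k using that by (simp add: algebra_simps)
    show "dsum (tprod a b) (tprod a c) $$ (i, j) = tprod a (dsum b c) $$ (s i, s j)"
    proof (cases "i < n * m"; cases "j < n * m")
      assume k: "i < n * m" "j < n * m"
      have "dsum (tprod a b) (tprod a c) $$ (i, j) = tprod a b $$ (i, j)"
        by (rule index_dsum_left[OF tprod_carrier[OF a b] tprod_carrier[OF a c] k])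
      then show ?thesis
        unfolding e using index_dsum_left[OF b c s1(4)[OF k(1)] s1(4)[OF k(2)]]
        by (simp only: index_tprod[OF b a k] s1[OF k(1)] s1[OF k(2)])
    next
      assume k: "i < n * m" "\<not> j < n * m"
      show ?thesis unfolding e unfolding dsum_four_block using k s1[OF k(1)] s2[OF k(2) ij(2)] lt[OF k(2) ij(2)] a b c
        by simp
    next
      assume k: "\<not> i < n * m" "j < n * m"
      show ?thesis unfolding e unfolding dsum_four_block using k s2[OF k(1) ij(1)] s1[OF k(2)] lt[OF k(1) ij(1)] a b c
        by simp
    next
      assume k: "\<not> i < n * m" "\<not> j < n * m"
      show ?thesis unfolding e unfolding dsum_four_block
        using k s2[OF k(1) ij(1)] s2[OF k(2) ij(2)] lt[OF k(1) ij(1)] lt[OF k(2) ij(2)] a b c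
        by (simp add: index_tprod[OF c a])
    qed
  qed
qed

section \<open>Tensor products and tensor powers of representations\<close>

context compact_quantum_group
begin

lemma comul_tprod:
  assumes u: "comul u" and v: "comul v" shows "comul (tprod u v)"
proof -
  define n m where "n = dim_row u" and "m = dim_row v"
  have uc: "u \<in> carrier_mat n n" and vc: "v \<in> carrier_mat m m"
    using comul_carrier[OF u] comul_carrier[OF v] unfolding n_def m_def .
  have "\<Delta> (tprod u v $$ (i, j)) = (\<Sum>r<n * m. t (tprod u v $$ (i, r)) (tprod u v $$ (r, j)))"
    if ij: "i < n * m" "j < n * m" for i j
  proof -
    note d = div_mod_less[OF ij(1)] div_mod_less[OF ij(2)]
    have "\<Delta> (tprod u v $$ (i, j)) = \<Delta> (u $$ (i div m, j div m)) * \<Delta> (v $$ (i mod m, j mod m))"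
      by (simp add: index_tprod[OF vc uc ij] comult_mult)
    also have "\<dots> = (\<Sum>a<n. t (u $$ (i div m, a)) (u $$ (a, j div m))) *
        (\<Sum>b<m. t (v $$ (i mod m, b)) (v $$ (b, j mod m)))"
      using comulD[OF u] comulD[OF v] d unfolding n_def m_def by simp
    also have "\<dots> = (\<Sum>a<n. \<Sum>b<m. t (u $$ (i div m, a) * v $$ (i mod m, b)) (u $$ (a, j div m) * v $$ (b, j mod m)))"
      by (simp add: sum_product t_mult[OF tens])
    also have "\<dots> = (\<Sum>r<n * m. t (u $$ (i div m, r div m) * v $$ (i mod m, r mod m))
        (u $$ (r div m, j div m) * v $$ (r mod m, j mod m)))"
      by (rule sum_lessThan_mult[symmetric, of "\<lambda>a b. t (u $$ (i div m, a) * v $$ (i mod m, b))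
        (u $$ (a, j div m) * v $$ (b, j mod m))"])
    also have "\<dots> = (\<Sum>r<n * m. t (tprod u v $$ (i, r)) (tprod u v $$ (r, j)))"
      using ij by (simp add: index_tprod[OF vc uc])
    finally show ?thesis .
  qed
  then show ?thesis unfolding comultiplicative_def using uc vc by simp
qed

text \<open>Entries of \<open>u\<close> and \<open>v\<close> need not commute, so the inner pair has
  to collapse first: \<open>v adj v\<close> in one product, \<open>adj u u\<close> in the other,
  where the sums are exchanged for that purpose.\<close>

lemma rep_tprod:
  assumes u: "rep u" and v: "rep v" shows "rep (tprod u v)"
proof -
  define n m where "n = dim_row u" and "m = dim_row v"
  have uc: "u \<in> carrier_mat n n" and vc: "v \<in> carrier_mat m m"
    using repD(2)[OF u] repD(2)[OF v] unfolding n_def m_def .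
  have U: "(\<Sum>a<n. u $$ (i, a) * star (u $$ (j, a))) = (if i = j then 1 else 0)"
    "(\<Sum>a<n. star (u $$ (a, i)) * u $$ (a, j)) = (if i = j then 1 else 0)" if "i < n" "j < n" for i j
  proof -
    have "(u * adj u) $$ (i, j) = (\<Sum>a<n. u $$ (i, a) * star (u $$ (j, a)))"
      using that uc by (subst index_mult_sum) auto
    then show "(\<Sum>a<n. u $$ (i, a) * star (u $$ (j, a))) = (if i = j then 1 else 0)"
      unfolding repD(3)[OF u] n_def[symmetric] using that by simp
    have "(adj u * u) $$ (i, j) = (\<Sum>a<n. star (u $$ (a, i)) * u $$ (a, j))"
      using that uc by (subst index_mult_sum) auto
    then show "(\<Sum>a<n. star (u $$ (a, i)) * u $$ (a, j)) = (if i = j then 1 else 0)"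
      unfolding repD(4)[OF u] n_def[symmetric] using that by simp
  qed
  have V: "(\<Sum>a<m. v $$ (i, a) * star (v $$ (j, a))) = (if i = j then 1 else 0)"
    "(\<Sum>a<m. star (v $$ (a, i)) * v $$ (a, j)) = (if i = j then 1 else 0)" if "i < m" "j < m" for i j
  proof -
    have "(v * adj v) $$ (i, j) = (\<Sum>a<m. v $$ (i, a) * star (v $$ (j, a)))"
      using that vc by (subst index_mult_sum) auto
    then show "(\<Sum>a<m. v $$ (i, a) * star (v $$ (j, a))) = (if i = j then 1 else 0)"
      unfolding repD(3)[OF v] m_def[symmetric] using that by simp
    have "(adj v * v) $$ (i, j) = (\<Sum>a<m. star (v $$ (a, i)) * v $$ (a, j))"
      using that vc by (subst index_mult_sum) auto
    then show "(\<Sum>a<m. star (v $$ (a, i)) * v $$ (a, j)) = (if i = j then 1 else 0)"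
      unfolding repD(4)[OF v] m_def[symmetric] using that by simp
  qed
  have uv: "tprod u v \<in> carrier_mat (n * m) (n * m)" using uc vc by simp
  have "tprod u v * adj (tprod u v) = 1\<^sub>m (n * m)"
  proof (rule eq_matI)
    fix i j assume "i < dim_row (1\<^sub>m (n * m) :: 'q mat)" "j < dim_col (1\<^sub>m (n * m) :: 'q mat)"
    then have ij: "i < n * m" "j < n * m" by auto
    note d = div_mod_less[OF ij(1)] div_mod_less[OF ij(2)]
    have "(tprod u v * adj (tprod u v)) $$ (i, j) = (\<Sum>r<n * m. tprod u v $$ (i, r) * star (tprod u v $$ (j, r)))"
      using ij uc vc by (subst index_mult_sum) auto
    also have "\<dots> = (\<Sum>r<n * m. u $$ (i div m, r div m) * (v $$ (i mod m, r mod m) *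
        star (v $$ (j mod m, r mod m))) * star (u $$ (j div m, r div m)))"
      using ij by (simp add: index_tprod[OF vc uc] star_mult mult.assoc)
    also have "\<dots> = (\<Sum>a<n. \<Sum>b<m. u $$ (i div m, a) * (v $$ (i mod m, b) *
        star (v $$ (j mod m, b))) * star (u $$ (j div m, a)))"
      by (rule sum_lessThan_mult[of "\<lambda>a b. u $$ (i div m, a) * (v $$ (i mod m, b) *
        star (v $$ (j mod m, b))) * star (u $$ (j div m, a))"])
    also have "\<dots> = (\<Sum>a<n. u $$ (i div m, a) * (if i mod m = j mod m then 1 else 0) * star (u $$ (j div m, a)))"
      using d by (simp add: V flip: sum_distrib_left sum_distrib_right)
    also have "\<dots> = (if i mod m = j mod m \<and> i div m = j div m then 1 else 0)"
      using d by (auto simp: U)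
    also have "\<dots> = 1\<^sub>m (n * m) $$ (i, j)" using ij div_mod_eq_iff[of i j m] by auto
    finally show "(tprod u v * adj (tprod u v)) $$ (i, j) = 1\<^sub>m (n * m) $$ (i, j)" .
  qed (use uc vc in auto)
  moreover have "adj (tprod u v) * tprod u v = 1\<^sub>m (n * m)"
  proof (rule eq_matI)
    fix i j assume "i < dim_row (1\<^sub>m (n * m) :: 'q mat)" "j < dim_col (1\<^sub>m (n * m) :: 'q mat)"
    then have ij: "i < n * m" "j < n * m" by auto
    note d = div_mod_less[OF ij(1)] div_mod_less[OF ij(2)]
    have "(adj (tprod u v) * tprod u v) $$ (i, j) = (\<Sum>r<n * m. star (tprod u v $$ (r, i)) * tprod u v $$ (r, j))"
      using ij uc vc by (subst index_mult_sum) auto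
    also have "\<dots> = (\<Sum>r<n * m. star (v $$ (r mod m, i mod m)) * (star (u $$ (r div m, i div m)) *
        u $$ (r div m, j div m)) * v $$ (r mod m, j mod m))"
      using ij by (simp add: index_tprod[OF vc uc] star_mult mult.assoc)
    also have "\<dots> = (\<Sum>a<n. \<Sum>b<m. star (v $$ (b, i mod m)) * (star (u $$ (a, i div m)) *
        u $$ (a, j div m)) * v $$ (b, j mod m))"
      by (rule sum_lessThan_mult[of "\<lambda>a b. star (v $$ (b, i mod m)) * (star (u $$ (a, i div m)) *
        u $$ (a, j div m)) * v $$ (b, j mod m)"])
    also have "\<dots> = (\<Sum>b<m. \<Sum>a<n. star (v $$ (b, i mod m)) * (star (u $$ (a, i div m)) *
        u $$ (a, j div m)) * v $$ (b, j mod m))" by (rule sum.swap)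
    also have "\<dots> = (\<Sum>b<m. star (v $$ (b, i mod m)) * (if i div m = j div m then 1 else 0) * v $$ (b, j mod m))"
      using d by (simp add: U flip: sum_distrib_left sum_distrib_right)
    also have "\<dots> = (if i mod m = j mod m \<and> i div m = j div m then 1 else 0)"
      using d by (auto simp: V)
    also have "\<dots> = 1\<^sub>m (n * m) $$ (i, j)" using ij div_mod_eq_iff[of i j m] by auto
    finally show "(adj (tprod u v) * tprod u v) $$ (i, j) = 1\<^sub>m (n * m) $$ (i, j)" .
  qed (use uc vc in auto)
  ultimately show ?thesis unfolding representation_def
    using comul_tprod[OF repD(1)[OF u] repD(1)[OF v]] uc vc by simp
qed

lemma comul_one: "comul (1\<^sub>m 1)"
  by (simp add: comultiplicative_def t_one[OF tens])

lemma rep_one: "rep (1\<^sub>m 1)"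
  using comul_one unfolding representation_def by simp

lemma irrep_one: "irrep (1\<^sub>m 1)"
  unfolding irreducible_rep_def
proof (intro conjI ballI impI)
  fix P :: "complex mat"
  assume P: "P \<in> carrier_mat (dim_row (1\<^sub>m 1 :: 'q mat)) (dim_row (1\<^sub>m 1 :: 'q mat))" "P * P = P"
  then have c: "P \<in> carrier_mat 1 1" by simp
  have "(P * P) $$ (0, 0) = P $$ (0, 0) * P $$ (0, 0)"
    using c by (subst index_mult_sum) auto
  then have "P $$ (0, 0) * P $$ (0, 0) = P $$ (0, 0)" using P(2) by simp
  then consider "P $$ (0, 0) = 0" | "P $$ (0, 0) = 1" by (metis mult_cancel_left1)
  then have "P = 0\<^sub>m 1 1 \<or> P = 1\<^sub>m 1"
    by cases (use c in \<open>auto intro!: eq_matI\<close>)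
  then show "P = 0\<^sub>m (dim_row (1\<^sub>m 1 :: 'q mat)) (dim_row (1\<^sub>m 1 :: 'q mat)) \<or> P = 1\<^sub>m (dim_row (1\<^sub>m 1 :: 'q mat))"
    by simp
qed (use rep_one in auto)

lemma rep_tpow: "rep u \<Longrightarrow> rep (tpow u n)"
  by (induction n) (auto intro: rep_one rep_tprod simp del: One_nat_def)

lemma comul_tpow: "comul u \<Longrightarrow> comul (tpow u n)"
  by (induction n) (auto intro: comul_one comul_tprod simp del: One_nat_def)

lemma comul_conjugate: assumes u: "comul u" shows "comul (conjugate_rep u)"
  using u comulD[OF u] unfolding comultiplicative_def conjugate_rep_def
  by (simp add: comult_star star_sum t_star[OF tens])

text \<open>\<open>(u^n \<oplus> w') \<otimes> (u \<oplus> v)\<close> splits off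
  \<open>u^n \<otimes> u\<close>. The remainder is only comultiplicative because \<open>v\<close>
  will be the conjugate, which need not be unitary.\<close>

lemma tpow_summand:
  assumes u: "comul u" and v: "comul v"
  shows "\<exists>w'. comul w' \<and> equivalent (tpow (dsum u v) n) (dsum (tpow u n) w')"
proof (induction n)
  case 0
  have "dsum (1\<^sub>m 1) (0\<^sub>m 0 0) = (1\<^sub>m 1 :: 'q mat)" unfolding dsum_four_block by (rule eq_matI) auto
  moreover have "comul (0\<^sub>m 0 0)" by (simp add: comultiplicative_def)
  ultimately show ?case using equivalent_refl[of "1\<^sub>m 1 :: 'q mat" 1] by (intro exI[of _ "0\<^sub>m 0 0"]) simp
next
  case (Suc n)
  then obtain w' where w': "comul w'" "equivalent (tpow (dsum u v) n) (dsum (tpow u n) w')" by blast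
  define x a where "x = dsum u v" and "a = tpow u n"
  have cx: "comul x" and ca: "comul a" unfolding x_def a_def using u v comul_dsum comul_tpow by auto
  define k p m l where "k = dim_row a" and "p = dim_row w'" and "m = dim_row u" and "l = dim_row v"
  have c: "a \<in> carrier_mat k k" "w' \<in> carrier_mat p p" "u \<in> carrier_mat m m" "v \<in> carrier_mat l l"
    using comul_carrier[OF ca] comul_carrier[OF w'(1)] comul_carrier[OF u] comul_carrier[OF v]
    unfolding k_def p_def m_def l_def .
  have xc: "x \<in> carrier_mat (m + l) (m + l)" unfolding x_def using c by simp
  have eq: "equivalent (tpow x n) (dsum a w')" using w'(2) unfolding x_def a_def .
  have dc: "dsum a w' \<in> carrier_mat (k + p) (k + p)" using c by simp
  have tc: "tpow x n \<in> carrier_mat (k + p) (k + p)"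
    using comul_carrier[OF comul_tpow[OF cx, of n]]
    unfolding equivalent_dim[OF eq] carrier_matD(1)[OF dc] .
  have 1: "equivalent (tprod (tpow x n) x) (dsum (tprod a x) (tprod w' x))"
    using equivalent_tprod[OF eq tc dc xc] tprod_dsum_left[OF c(1,2) xc] by simp
  have 2: "equivalent (tprod a x) (dsum (tprod a u) (tprod a v))"
    unfolding x_def by (rule equivalent_tprod_dsum_right[OF c(1,3,4)])
  have ax: "tprod a x \<in> carrier_mat (k * (m + l)) (k * (m + l))" using c(1) xc by simp
  have wx: "tprod w' x \<in> carrier_mat (p * (m + l)) (p * (m + l))" using c(2) xc by simp
  have auv: "dsum (tprod a u) (tprod a v) \<in> carrier_mat (k * (m + l)) (k * (m + l))"
    using dsum_carrier[OF tprod_carrier[OF c(1,3)] tprod_carrier[OF c(1,4)]] by (simp only: distrib_left)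
  have 3: "equivalent (dsum (tprod a x) (tprod w' x)) (dsum (dsum (tprod a u) (tprod a v)) (tprod w' x))"
    by (rule equivalent_dsum[OF 2 equivalent_refl[OF wx] ax auv wx wx])
  have 4: "equivalent (tprod (tpow x n) x) (dsum (dsum (tprod a u) (tprod a v)) (tprod w' x))"
  proof (rule equivalent_trans[OF 1 3])
    have "(k + p) * (m + l) = k * (m + l) + p * (m + l)" by (simp add: algebra_simps)
    then show "tprod (tpow x n) x \<in> carrier_mat (k * (m + l) + p * (m + l)) (k * (m + l) + p * (m + l))"
      using tprod_carrier[OF tc xc] by simp
  qed (use ax wx auv in simp_all)
  have "comul (dsum (tprod a v) (tprod w' x))"
    by (intro comul_dsum comul_tprod ca v w'(1) cx)
  then show ?case using 4 unfolding dsum_assoc by (auto simp: x_def a_def)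
qed

end

section \<open>Additive extension to formal sums\<close>

definition frag_eval :: "('a \<Rightarrow> 'b::ring_1) \<Rightarrow> ('a \<Rightarrow>\<^sub>0 int) \<Rightarrow> 'b" where
  "frag_eval f x = (\<Sum>a\<in>Poly_Mapping.keys x. of_int (Poly_Mapping.lookup x a) * f a)"

lemma frag_eval_superset:
  "finite S \<Longrightarrow> Poly_Mapping.keys x \<subseteq> S \<Longrightarrow> frag_eval f x = (\<Sum>a\<in>S. of_int (Poly_Mapping.lookup x a) * f a)"
  unfolding frag_eval_def by (rule sum.mono_neutral_left) (auto simp: in_keys_iff)

lemma frag_eval_zero [simp]: "frag_eval f 0 = 0"
  by (simp add: frag_eval_def)

lemma frag_eval_of [simp]: "frag_eval f (frag_of a) = f a"
  by (simp add: frag_eval_def keys_frag_of)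

lemma frag_eval_add: "frag_eval f (x + y) = frag_eval f x + frag_eval f y"
proof -
  let ?S = "Poly_Mapping.keys x \<union> Poly_Mapping.keys y"
  have "Poly_Mapping.keys (x + y) \<subseteq> ?S" by (rule Poly_Mapping.keys_add)
  then show ?thesis
    by (simp add: frag_eval_superset[of ?S] Poly_Mapping.lookup_add distrib_right sum.distrib)
qed

lemma frag_eval_cmul: "frag_eval f (frag_cmul c x) = of_int c * frag_eval f x"
  by (simp add: frag_eval_superset[OF Poly_Mapping.finite_keys keys_cmul] frag_eval_def[of f x] sum_distrib_left mult.assoc)

lemma frag_eval_minus: "frag_eval f (- x) = - frag_eval f x"
  using frag_eval_cmul[of f "-1" x] by simp

lemma frag_eval_diff: "frag_eval f (x - y) = frag_eval f x - frag_eval f y"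
  using frag_eval_add[of f x "- y"] by (simp add: frag_eval_minus)

lemma frag_eval_sum: "frag_eval f (sum g A) = (\<Sum>i\<in>A. frag_eval f (g i))"
  by (induction A rule: infinite_finite_induct) (auto simp: frag_eval_add)

lemma frag_eval_extend:
  "frag_eval f (frag_extend b x) = (\<Sum>a\<in>Poly_Mapping.keys x. of_int (Poly_Mapping.lookup x a) * frag_eval f (b a))"
  by (simp add: frag_extend_def frag_eval_sum frag_eval_cmul)

text \<open>Elimination without division: the pivot \<open>k\<close> clears the coordinate
  \<open>s\<close> in \<open>f k s * f j - f j s * f k\<close>, and \<open>d\<close> expresses the
  relation found among these vectors in terms of the original ones.\<close>

lemma integer_relation:
  fixes f :: "'j \<Rightarrow> 's \<Rightarrow> int"
  assumes "finite S" "finite J" "card S < card J"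
  shows "\<exists>c. (\<exists>j\<in>J. c j \<noteq> 0) \<and> (\<forall>s\<in>S. (\<Sum>j\<in>J. c j * f j s) = 0)"
  using assms
proof (induction S arbitrary: J f rule: finite_induct)
  case empty
  then have "J \<noteq> {}" by auto
  then show ?case by (intro exI[of _ "\<lambda>_. 1"]) auto
next
  case (insert s S)
  show ?case
  proof (cases "\<forall>j\<in>J. f j s = 0")
    case True
    have "card S < card J" using insert by simp
    then obtain c where "\<exists>j\<in>J. c j \<noteq> 0" "\<forall>s\<in>S. (\<Sum>j\<in>J. c j * f j s) = 0"
      using insert.IH[of J f] insert.prems by blast
    then show ?thesis using True by (intro exI[of _ c]) auto
  next
    case False
    then obtain k where k: "k \<in> J" "f k s \<noteq> 0" by blast
    let ?J = "J - {k}"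
    have "card S < card ?J" using insert k by simp
    then obtain c where c: "\<exists>j\<in>?J. c j \<noteq> 0"
      "\<forall>s'\<in>S. (\<Sum>j\<in>?J. c j * (f k s * f j s' - f j s * f k s')) = 0"
      using insert.IH[of ?J "\<lambda>j s'. f k s * f j s' - f j s * f k s'"] insert.prems by auto
    define d where "d j = (if j = k then - (\<Sum>j\<in>?J. c j * f j s) else c j * f k s)" for j
    have sumJ: "(\<Sum>j\<in>J. d j * f j s') =
        - (\<Sum>j\<in>?J. c j * f j s) * f k s' + (\<Sum>j\<in>?J. c j * f k s * f j s')" for s'
    proof -
      have "(\<Sum>j\<in>J. d j * f j s') = d k * f k s' + (\<Sum>j\<in>?J. d j * f j s')"
        using insert.prems k by (simp add: sum.remove)
      also have "(\<Sum>j\<in>?J. d j * f j s') = (\<Sum>j\<in>?J. c j * f k s * f j s')"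
        by (intro sum.cong) (auto simp: d_def)
      finally show ?thesis by (simp add: d_def)
    qed
    have "(\<Sum>j\<in>?J. c j * f k s * f j s) = (\<Sum>j\<in>?J. c j * f j s) * f k s"
      unfolding sum_distrib_right by (intro sum.cong refl) (simp add: mult_ac)
    then have "(\<Sum>j\<in>J. d j * f j s) = 0" unfolding sumJ by simp
    moreover have "(\<Sum>j\<in>J. d j * f j s') = 0" if "s' \<in> S" for s'
    proof -
      have "(\<Sum>j\<in>?J. c j * (f k s * f j s' - f j s * f k s')) = 0" using c(2) that by blast
      moreover have "(\<Sum>j\<in>?J. c j * (f k s * f j s' - f j s * f k s')) =
          (\<Sum>j\<in>?J. c j * f k s * f j s') - (\<Sum>j\<in>?J. c j * f j s) * f k s'"
        unfolding sum_distrib_right sum_subtractf[symmetric]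
        by (intro sum.cong refl) (simp add: algebra_simps)
      ultimately show ?thesis unfolding sumJ by simp
    qed
    moreover have "\<exists>j\<in>J. d j \<noteq> 0"
    proof -
      obtain j where "j \<in> ?J" "c j \<noteq> 0" using c(1) by blast
      then show ?thesis using k unfolding d_def by (intro bexI[of _ j]) auto
    qed
    ultimately show ?thesis by (intro exI[of _ d]) auto
  qed
qed

section \<open>Integer polynomials in an element of a noncommutative ring\<close>

text \<open>Integer coefficients are central, so evaluation at an element of a noncommutative ring
  respects the factorization below.\<close>

definition int_poly_eval :: "int poly \<Rightarrow> 'a::ring_1 \<Rightarrow> 'a" where
  "int_poly_eval p x = (\<Sum>i\<le>degree p. of_int (coeff p i) * x ^ i)"

lemma int_poly_eval_bound:
  assumes "degree p \<le> n" shows "int_poly_eval p x = (\<Sum>i\<le>n. of_int (coeff p i) * x ^ i)"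
  unfolding int_poly_eval_def
  by (rule sum.mono_neutral_left) (use assms in \<open>auto simp: coeff_eq_0\<close>)

lemma int_poly_eval_linear_factor:
  "int_poly_eval ([:- d, 1:] * q) x = (x - of_int d) * int_poly_eval q x"
proof -
  let ?n = "degree q"
  have com: "of_int k * x = x * of_int k" for k
    by (rule mult_of_int_commute)
  have coeff: "coeff ([:- d, 1:] * q) i = coeff (pCons 0 q) i - d * coeff q i" for i
    by (simp add: mult_pCons_left)
  have "degree ([:- d, 1:] * q) \<le> Suc ?n" by (rule order_trans[OF degree_mult_le]) simp
  then have "int_poly_eval ([:- d, 1:] * q) x = (\<Sum>i\<le>Suc ?n. of_int (coeff ([:- d, 1:] * q) i) * x ^ i)"
    by (rule int_poly_eval_bound)
  also have "\<dots> = (\<Sum>i\<le>Suc ?n. of_int (coeff (pCons 0 q) i) * x ^ i) - (\<Sum>i\<le>Suc ?n. of_int (d * coeff q i) * x ^ i)"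
    by (simp only: coeff of_int_diff left_diff_distrib sum_subtractf)
  also have "(\<Sum>i\<le>Suc ?n. of_int (d * coeff q i) * x ^ i) = of_int d * int_poly_eval q x"
    unfolding int_poly_eval_bound[of q "Suc ?n", OF le_SucI[OF order_refl]] sum_distrib_left
    by (intro sum.cong refl) (simp add: mult.assoc)
  also have "(\<Sum>i\<le>Suc ?n. of_int (coeff (pCons 0 q) i) * x ^ i) = (\<Sum>i\<le>?n. of_int (coeff q i) * x ^ Suc i)"
    by (subst sum.atMost_Suc_shift) simp
  also have "\<dots> = x * int_poly_eval q x"
    unfolding int_poly_eval_def sum_distrib_left
    by (intro sum.cong refl) (metis com mult.assoc power_Suc)
  finally show ?thesis by (simp add: left_diff_distrib)
qed

section \<open>The fusion ring\<close>

lemma int_mult_scaleC: "of_int k * x = of_int k *\<^sub>C (x :: 'a::cstar_algebra)"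
proof -
  have "of_int k * x = of_real (of_int k) * x" by simp
  also have "\<dots> = of_int k *\<^sub>R x" by (simp add: scaleR_conv_of_real)
  also have "\<dots> = of_int k *\<^sub>C x" by (metis of_real_of_int_eq scaleC_of_real)
  finally show ?thesis .
qed

context compact_quantum_group
begin

abbreviation "cls \<equiv> irr_class t \<Delta>"
abbreviation "irr_cls \<equiv> irr_classes t \<Delta>"
abbreviation "fus \<equiv> fusion_mult t \<Delta>"

text \<open>The representative chosen inside \<open>fusion_mult\<close>.\<close>

definition pick :: "'q mat set \<Rightarrow> 'q mat" where "pick \<alpha> = (SOME u. u \<in> \<alpha>)"

lemma irrep_equivalent_sym: "irrep u \<Longrightarrow> irrep v \<Longrightarrow> equivalent u v \<Longrightarrow> equivalent v u"
  using irrepD(3) equivalent_dim equivalent_sym by metis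

lemma irrep_equivalent_trans:
  "irrep u \<Longrightarrow> irrep v \<Longrightarrow> irrep w \<Longrightarrow> equivalent u v \<Longrightarrow> equivalent v w \<Longrightarrow> equivalent u w"
  using irrepD(3) equivalent_dim equivalent_trans by metis

lemma irrep_mem_class: "irrep u \<Longrightarrow> u \<in> cls u"
  unfolding irr_class_def using equivalent_refl irrepD(3) by blast

lemma class_eq_iff: "irrep u \<Longrightarrow> irrep v \<Longrightarrow> cls u = cls v \<longleftrightarrow> equivalent u v"
proof
  assume "irrep u" "irrep v" "cls u = cls v"
  then show "equivalent u v" using irrep_mem_class[of v] unfolding irr_class_def by blast
next
  assume uv: "irrep u" "irrep v" "equivalent u v"
  then have "equivalent u w \<longleftrightarrow> equivalent v w" if "irrep w" for w
    using that irrep_equivalent_sym[of u v] irrep_equivalent_trans[of u v w]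
      irrep_equivalent_trans[of v u w] by blast
  then show "cls u = cls v" unfolding irr_class_def by blast
qed

lemma pick_class:
  assumes "irrep u" shows "irrep (pick (cls u))" "equivalent u (pick (cls u))"
proof -
  have "pick (cls u) \<in> cls u" unfolding pick_def by (rule someI) (rule irrep_mem_class[OF assms])
  then show "irrep (pick (cls u))" "equivalent u (pick (cls u))" unfolding irr_class_def by auto
qed

lemma classesE: "\<alpha> \<in> irr_cls \<Longrightarrow> irrep (pick \<alpha>) \<and> cls (pick \<alpha>) = \<alpha>"
  unfolding irr_classes_def using pick_class class_eq_iff by (metis imageE mem_Collect_eq)

lemma cls_mem: "irrep u \<Longrightarrow> cls u \<in> irr_cls"
  unfolding irr_classes_def by blast

text \<open>The character map of the fusion ring; by \<open>chi_equivalent\<close> the choice of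
  representatives is immaterial.\<close>

definition char_eval :: "('q mat set \<Rightarrow>\<^sub>0 int) \<Rightarrow> 'q" where
  "char_eval = frag_eval (\<lambda>\<alpha>. chi (pick \<alpha>))"

definition dim_eval :: "('q mat set \<Rightarrow>\<^sub>0 int) \<Rightarrow> int" where
  "dim_eval = frag_eval (\<lambda>\<alpha>. int (dim_row (pick \<alpha>)))"

text \<open>Pairing with the adjoint character of \<beta> under the Haar state isolates the
  coefficient at \<beta>.\<close>

lemma char_eval_inj:
  assumes x: "Poly_Mapping.keys x \<subseteq> irr_cls" and 0: "char_eval x = 0"
  shows "x = 0"
proof (rule poly_mapping_eqI)
  fix \<beta>
  obtain h where h: "state h" "\<And>a. conv (\<lambda>b a. t a b) \<Delta> h a = h a *\<^sub>C 1" using haar_state by metis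
  show "Poly_Mapping.lookup x \<beta> = Poly_Mapping.lookup 0 \<beta>"
  proof (cases "\<beta> \<in> Poly_Mapping.keys x")
    case True
    have b: "irrep (pick \<beta>)" "cls (pick \<beta>) = \<beta>" using classesE True x by auto
    have orth: "h (star (chi (pick \<beta>)) * chi (pick \<alpha>)) = (if \<alpha> = \<beta> then 1 else 0)"
      if a: "\<alpha> \<in> Poly_Mapping.keys x" for \<alpha>
    proof (cases "\<alpha> = \<beta>")
      case True
      then show ?thesis using character_normalized[OF h b(1)] by simp
    next
      case False
      have "irrep (pick \<alpha>)" "cls (pick \<alpha>) = \<alpha>" using classesE a x by auto
      moreover from this have "\<not> equivalent (pick \<alpha>) (pick \<beta>)" using class_eq_iff b False by metis
      ultimately show ?thesis using character_orthogonal[OF h b(1)] False by simp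
    qed
    have "star (chi (pick \<beta>)) * char_eval x =
        (\<Sum>\<alpha>\<in>Poly_Mapping.keys x. of_int (Poly_Mapping.lookup x \<alpha>) *\<^sub>C (star (chi (pick \<beta>)) * chi (pick \<alpha>)))"
      unfolding char_eval_def frag_eval_def
      by (simp add: int_mult_scaleC sum_distrib_left mult_scaleC_right)
    then have "h (star (chi (pick \<beta>)) * char_eval x) =
        (\<Sum>\<alpha>\<in>Poly_Mapping.keys x. of_int (Poly_Mapping.lookup x \<alpha>) * h (star (chi (pick \<beta>)) * chi (pick \<alpha>)))"
      by (simp add: state_sum[OF h(1)] state_scaleC[OF h(1)])
    also have "\<dots> = (\<Sum>\<alpha>\<in>Poly_Mapping.keys x. if \<alpha> = \<beta> then of_int (Poly_Mapping.lookup x \<beta>) else 0)"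
      by (intro sum.cong refl) (simp add: orth)
    also have "\<dots> = of_int (Poly_Mapping.lookup x \<beta>)" using True by simp
    finally have "of_int (Poly_Mapping.lookup x \<beta>) = (0 :: complex)" unfolding 0 by (simp add: state_zero[OF h(1)])
    then show ?thesis by simp
  qed (simp add: in_keys_iff)
qed

lemma char_eval_eqD:
  assumes "Poly_Mapping.keys x \<subseteq> irr_cls" "Poly_Mapping.keys y \<subseteq> irr_cls" "char_eval x = char_eval y"
  shows "x = y"
proof -
  have "Poly_Mapping.keys (x - y) \<subseteq> irr_cls" using assms by (meson Un_least keys_diff order_trans)
  moreover have "char_eval (x - y) = 0" using assms(3) unfolding char_eval_def frag_eval_diff by simp
  ultimately have "x - y = 0" by (rule char_eval_inj)
  then show ?thesis by simp
qed

lemma sum_list_classes: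
  assumes "\<forall>v\<in>set vs. irrep v"
  shows "Poly_Mapping.keys (\<Sum>v\<leftarrow>vs. frag_of (cls v)) \<subseteq> cls ` set vs"
    and "char_eval (\<Sum>v\<leftarrow>vs. frag_of (cls v)) = chi (diag_block_mat vs)"
    and "dim_eval (\<Sum>v\<leftarrow>vs. frag_of (cls v)) = int (dim_row (diag_block_mat vs))"
  using assms
proof (induction vs)
  case Nil
  case 1 show ?case by simp
  case 2 show ?case by (simp add: char_eval_def chi_def)
  case 3 show ?case by (simp add: dim_eval_def)
next
  case (Cons v vs)
  have v: "irrep v" and vs: "\<forall>v\<in>set vs. irrep v" if "\<forall>u\<in>set (v # vs). irrep u" using that by auto
  have app: "diag_block_mat (v # vs) = dsum v (diag_block_mat vs)"
    using diag_block_mat_append_dsum[of "[v]" vs] by (simp only: diag_block_mat_singleton append_Cons append_Nil)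
  { case 1
    have "Poly_Mapping.keys (\<Sum>v\<leftarrow>vs. frag_of (cls v)) \<subseteq> cls ` set vs" by (rule Cons.IH(1)[OF vs[OF 1]])
    moreover have "Poly_Mapping.keys (frag_of (cls v)) = {cls v}" by (rule keys_frag_of)
    ultimately show ?case
      using Poly_Mapping.keys_add[of "frag_of (cls v)" "\<Sum>v\<leftarrow>vs. frag_of (cls v)"] by auto
  next
    case 2
    have p: "irrep (pick (cls v))" "equivalent v (pick (cls v))" using pick_class[OF v[OF 2]] by auto
    have "pick (cls v) \<in> carrier_mat (dim_row v) (dim_row v)"
      unfolding equivalent_dim[OF p(2)] by (rule irrepD(3)[OF p(1)])
    from chi_equivalent[OF p(2) irrepD(3)[OF v[OF 2]] this]
    have "chi (pick (cls v)) = chi v" by simp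
    moreover have "comul (diag_block_mat vs)" using vs[OF 2] irrepD(4) by (intro comul_diag_block) blast
    then have "chi (dsum v (diag_block_mat vs)) = chi v + chi (diag_block_mat vs)"
      by (rule chi_dsum[OF irrepD(3)[OF v[OF 2]] comul_carrier])
    ultimately show ?case using Cons.IH(2)[OF vs[OF 2]] unfolding app char_eval_def
      by (simp add: frag_eval_add)
  next
    case 3
    have "dim_row (pick (cls v)) = dim_row v" using pick_class[OF v[OF 3]] equivalent_dim by metis
    then show ?case using Cons.IH(3)[OF vs[OF 3]] unfolding app dim_eval_def
      by (simp add: frag_eval_add) }
qed

text \<open>The definite description is legitimate: all decompositions have the character of
  \<open>w\<close>, and \<open>char_eval\<close> is injective.\<close>

lemma fusion_class_decomposition:
  assumes w: "rep w" and vs: "\<forall>v\<in>set vs. irrep v" "equivalent w (diag_block_mat vs)"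
  shows "fusion_class t \<Delta> w = (\<Sum>v\<leftarrow>vs. frag_of (cls v))"
    and "char_eval (fusion_class t \<Delta> w) = chi w"
    and "dim_eval (fusion_class t \<Delta> w) = int (dim_row w)"
    and "Poly_Mapping.keys (fusion_class t \<Delta> w) \<subseteq> cls ` set vs"
proof -
  have ch: "char_eval (\<Sum>v\<leftarrow>us. frag_of (cls v)) = chi w"
    if us: "\<forall>v\<in>set us. irrep v" "equivalent w (diag_block_mat us)" for us
  proof -
    have "comul (diag_block_mat us)" using us(1) irrepD(4) by (intro comul_diag_block) blast
    then have "diag_block_mat us \<in> carrier_mat (dim_row w) (dim_row w)"
      unfolding equivalent_dim[OF us(2)] by (rule comul_carrier)
    then show ?thesis using sum_list_classes(2)[OF us(1)] chi_equivalent[OF us(2) repD(2)[OF w]] by simp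
  qed
  have keys: "Poly_Mapping.keys (\<Sum>v\<leftarrow>us. frag_of (cls v)) \<subseteq> irr_cls" if "\<forall>v\<in>set us. irrep v" for us
    using sum_list_classes(1)[OF that] cls_mem that by blast
  show eq: "fusion_class t \<Delta> w = (\<Sum>v\<leftarrow>vs. frag_of (cls v))"
    unfolding fusion_class_def
  proof (rule the_equality)
    fix x assume "\<exists>us. (\<forall>v\<in>set us. irrep v) \<and> equivalent w (diag_block_mat us) \<and>
      x = (\<Sum>v\<leftarrow>us. frag_of (cls v))"
    then obtain us where us: "\<forall>v\<in>set us. irrep v" "equivalent w (diag_block_mat us)"
      "x = (\<Sum>v\<leftarrow>us. frag_of (cls v))" by blast
    show "x = (\<Sum>v\<leftarrow>vs. frag_of (cls v))"
      unfolding us(3) by (rule char_eval_eqD[OF keys[OF us(1)] keys[OF vs(1)]])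
        (simp only: ch[OF us(1,2)] ch[OF vs])
  qed (use vs in blast)
  show "char_eval (fusion_class t \<Delta> w) = chi w" unfolding eq by (rule ch[OF vs])
  show "dim_eval (fusion_class t \<Delta> w) = int (dim_row w)"
    unfolding eq using sum_list_classes(3)[OF vs(1)] equivalent_dim[OF vs(2)] by simp
  show "Poly_Mapping.keys (fusion_class t \<Delta> w) \<subseteq> cls ` set vs"
    unfolding eq by (rule sum_list_classes(1)[OF vs(1)])
qed

lemma fusion_class:
  assumes w: "rep w"
  shows "char_eval (fusion_class t \<Delta> w) = chi w"
    and "dim_eval (fusion_class t \<Delta> w) = int (dim_row w)"
    and "Poly_Mapping.keys (fusion_class t \<Delta> w) \<subseteq> irr_cls"
proof -
  obtain vs where vs: "\<forall>v\<in>set vs. irrep v" "equivalent w (diag_block_mat vs)"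
    using complete_reducibility[OF w] by blast
  note f = fusion_class_decomposition[OF w vs]
  show "char_eval (fusion_class t \<Delta> w) = chi w" "dim_eval (fusion_class t \<Delta> w) = int (dim_row w)"
    using f by auto
  show "Poly_Mapping.keys (fusion_class t \<Delta> w) \<subseteq> irr_cls" using f(4) vs(1) cls_mem by blast
qed

text \<open>Both maps are additive, which reduces the claims to irreducible classes; there
  characters and matrix sizes multiply under \<open>tprod\<close>.\<close>

lemma fusion_mult:
  assumes x: "Poly_Mapping.keys x \<subseteq> irr_cls" and y: "Poly_Mapping.keys y \<subseteq> irr_cls"
  shows "char_eval (fus x y) = char_eval x * char_eval y"
    and "dim_eval (fus x y) = dim_eval x * dim_eval y"
    and "Poly_Mapping.keys (fus x y) \<subseteq> irr_cls"
proof -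
  have r: "rep (tprod (pick \<alpha>) (pick \<beta>))"
    "pick \<alpha> \<in> carrier_mat (dim_row (pick \<alpha>)) (dim_row (pick \<alpha>))"
    "pick \<beta> \<in> carrier_mat (dim_row (pick \<beta>)) (dim_row (pick \<beta>))"
    if "\<alpha> \<in> Poly_Mapping.keys x" "\<beta> \<in> Poly_Mapping.keys y" for \<alpha> \<beta>
  proof -
    have "irrep (pick \<alpha>)" "irrep (pick \<beta>)" using that x y classesE by auto
    then show "rep (tprod (pick \<alpha>) (pick \<beta>))"
      "pick \<alpha> \<in> carrier_mat (dim_row (pick \<alpha>)) (dim_row (pick \<alpha>))"
      "pick \<beta> \<in> carrier_mat (dim_row (pick \<beta>)) (dim_row (pick \<beta>))"
      using rep_tprod irrepD(1,3) by blast+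
  qed
  have fm: "fus x y = frag_extend (\<lambda>\<alpha>. frag_extend (\<lambda>\<beta>. fusion_class t \<Delta> (tprod (pick \<alpha>) (pick \<beta>))) y) x"
    unfolding fusion_mult_def pick_def ..
  have "char_eval (fus x y) = (\<Sum>\<alpha>\<in>Poly_Mapping.keys x. of_int (Poly_Mapping.lookup x \<alpha>) *
      (\<Sum>\<beta>\<in>Poly_Mapping.keys y. of_int (Poly_Mapping.lookup y \<beta>) * (chi (pick \<alpha>) * chi (pick \<beta>))))"
    unfolding fm char_eval_def frag_eval_extend
    using fusion_class(1)[OF r(1)] chi_tprod[OF r(2,3)] unfolding char_eval_def
    by (intro sum.cong refl arg_cong2[where f = times]) simp
  also have "\<dots> = char_eval x * char_eval y"
    unfolding char_eval_def frag_eval_def sum_product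
    by (simp add: sum_distrib_left int_mult_scaleC mult_scaleC_left mult_scaleC_right)
  finally show "char_eval (fus x y) = char_eval x * char_eval y" .
  have "dim_eval (fus x y) = (\<Sum>\<alpha>\<in>Poly_Mapping.keys x. Poly_Mapping.lookup x \<alpha> *
      (\<Sum>\<beta>\<in>Poly_Mapping.keys y. Poly_Mapping.lookup y \<beta> * (int (dim_row (pick \<alpha>)) * int (dim_row (pick \<beta>)))))"
    unfolding fm dim_eval_def frag_eval_extend
    using fusion_class(2)[OF r(1)] unfolding dim_eval_def
    by (intro sum.cong refl arg_cong2[where f = times]) simp_all
  also have "\<dots> = dim_eval x * dim_eval y"
    unfolding dim_eval_def frag_eval_def sum_product
    by (simp add: sum_distrib_left mult_ac)
  finally show "dim_eval (fus x y) = dim_eval x * dim_eval y" .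
  have "Poly_Mapping.keys (fus x y) \<subseteq> (\<Union>\<alpha>\<in>Poly_Mapping.keys x. \<Union>\<beta>\<in>Poly_Mapping.keys y.
      Poly_Mapping.keys (fusion_class t \<Delta> (tprod (pick \<alpha>) (pick \<beta>))))"
    unfolding fm by (rule order_trans[OF keys_frag_extend UN_mono[OF order_refl keys_frag_extend]])
  also have "\<dots> \<subseteq> irr_cls" using fusion_class(3)[OF r(1)] by blast
  finally show "Poly_Mapping.keys (fus x y) \<subseteq> irr_cls" .
qed

lemma char_eval_one: "char_eval (frag_of (cls (1\<^sub>m 1))) = 1"
  and keys_one: "Poly_Mapping.keys (frag_of (cls (1\<^sub>m 1))) \<subseteq> irr_cls"
  using sum_list_classes[of "[1\<^sub>m 1]"] irrep_one cls_mem[OF irrep_one]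
  by (simp_all only: list.map sum_list.Cons sum_list.Nil diag_block_mat_singleton add_0_right list.set
    ball_simps keys_frag_of) (simp_all add: chi_def)

text \<open>Associativity, the unit laws and distributivity are checked after applying
  \<open>char_eval\<close>, where they hold in the C*-algebra.\<close>

lemma fusion_ring_ring: "ring (fusion_ring t \<Delta>)"
proof (rule ringI)
  let ?R = "fusion_ring t \<Delta>"
  have C: "x \<in> carrier ?R \<longleftrightarrow> Poly_Mapping.keys x \<subseteq> irr_cls" for x
    unfolding fusion_ring_def by simp
  have ops: "x \<oplus>\<^bsub>?R\<^esub> y = x + y" "x \<otimes>\<^bsub>?R\<^esub> y = fus x y" "\<zero>\<^bsub>?R\<^esub> = 0"
    "\<one>\<^bsub>?R\<^esub> = frag_of (cls (1\<^sub>m 1))" for x y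
    unfolding fusion_ring_def by simp_all
  have add: "Poly_Mapping.keys (x + y) \<subseteq> irr_cls"
    if "Poly_Mapping.keys x \<subseteq> irr_cls" "Poly_Mapping.keys y \<subseteq> irr_cls" for x y :: "'q mat set \<Rightarrow>\<^sub>0 int"
    using that Poly_Mapping.keys_add[of x y] by blast
  have ca: "char_eval (x + y) = char_eval x + char_eval y" for x y
    unfolding char_eval_def by (rule frag_eval_add)
  show "abelian_group ?R"
  proof (rule abelian_groupI)
    fix x assume "x \<in> carrier ?R"
    then show "\<exists>y\<in>carrier ?R. y \<oplus>\<^bsub>?R\<^esub> x = \<zero>\<^bsub>?R\<^esub>"
      unfolding ops C by (intro bexI[of _ "- x"]) (simp_all add: C keys_minus)
  qed (unfold ops C, auto intro: add[THEN subsetD] simp: add.assoc add.commute)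
  show "monoid ?R"
  proof (rule monoidI)
    fix x y z assume xyz: "x \<in> carrier ?R" "y \<in> carrier ?R" "z \<in> carrier ?R"
    show "x \<otimes>\<^bsub>?R\<^esub> y \<otimes>\<^bsub>?R\<^esub> z = x \<otimes>\<^bsub>?R\<^esub> (y \<otimes>\<^bsub>?R\<^esub> z)"
      using xyz unfolding ops C
      by (intro char_eval_eqD fusion_mult(3)) (simp_all add: fusion_mult mult.assoc)
  next
    fix x assume x: "x \<in> carrier ?R"
    show "\<one>\<^bsub>?R\<^esub> \<otimes>\<^bsub>?R\<^esub> x = x" "x \<otimes>\<^bsub>?R\<^esub> \<one>\<^bsub>?R\<^esub> = x"
      using x keys_one unfolding ops C
      by (intro char_eval_eqD fusion_mult(3); simp add: fusion_mult char_eval_one del: One_nat_def)+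
  qed (unfold ops C, use fusion_mult(3) keys_one in auto)
  fix x y z assume xyz: "x \<in> carrier ?R" "y \<in> carrier ?R" "z \<in> carrier ?R"
  show "(x \<oplus>\<^bsub>?R\<^esub> y) \<otimes>\<^bsub>?R\<^esub> z = x \<otimes>\<^bsub>?R\<^esub> z \<oplus>\<^bsub>?R\<^esub> y \<otimes>\<^bsub>?R\<^esub> z"
    "z \<otimes>\<^bsub>?R\<^esub> (x \<oplus>\<^bsub>?R\<^esub> y) = z \<otimes>\<^bsub>?R\<^esub> x \<oplus>\<^bsub>?R\<^esub> z \<otimes>\<^bsub>?R\<^esub> y"
    using xyz unfolding ops C
    by (intro char_eval_eqD fusion_mult(3) add; simp add: fusion_mult add ca distrib_left distrib_right)+
qed

lemma char_eval_coefficient: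
  assumes "Poly_Mapping.keys x \<subseteq> irr_cls"
  shows "char_eval x \<in> coefficient_algebra t \<Delta>"
  unfolding char_eval_def frag_eval_def coefficient_algebra_def
proof (intro cvec.span_sum)
  fix \<alpha> assume "\<alpha> \<in> Poly_Mapping.keys x"
  then have "rep (pick \<alpha>)" using assms classesE irrepD(1) by blast
  then have "chi (pick \<alpha>) \<in> cvec.span {u $$ (i, j) |u i j. rep u \<and> i < dim_row u \<and> j < dim_row u}"
    unfolding chi_def by (intro cvec.span_sum cvec.span_base) blast
  then show "of_int (Poly_Mapping.lookup x \<alpha>) * chi (pick \<alpha>) \<in>
      cvec.span {u $$ (i, j) |u i j. rep u \<and> i < dim_row u \<and> j < dim_row u}"
    unfolding int_mult_scaleC by (rule cvec.span_scale)
qed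

theorem irreducible_imp_weakly_irreducible:
  assumes dom: "irreducible_cqg t \<Delta>" shows "weakly_irreducible_cqg t \<Delta>"
  unfolding weakly_irreducible_cqg_def nc_domain_def
proof (intro conjI ballI impI)
  show "ring (fusion_ring t \<Delta>)" by (rule fusion_ring_ring)
  show "\<one>\<^bsub>fusion_ring t \<Delta>\<^esub> \<noteq> \<zero>\<^bsub>fusion_ring t \<Delta>\<^esub>" by (simp add: fusion_ring_def)
  fix x y assume "x \<in> carrier (fusion_ring t \<Delta>)" "y \<in> carrier (fusion_ring t \<Delta>)"
    "x \<otimes>\<^bsub>fusion_ring t \<Delta>\<^esub> y = \<zero>\<^bsub>fusion_ring t \<Delta>\<^esub>"
  then have x: "Poly_Mapping.keys x \<subseteq> irr_cls" and y: "Poly_Mapping.keys y \<subseteq> irr_cls"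
    and xy: "fus x y = 0" unfolding fusion_ring_def by simp_all
  have "char_eval x * char_eval y = 0" using fusion_mult(1)[OF x y] xy by (simp add: char_eval_def)
  then have "char_eval x = 0 \<or> char_eval y = 0"
    using dom char_eval_coefficient[OF x] char_eval_coefficient[OF y]
    unfolding irreducible_cqg_def nc_domain_def coefficient_ring_def by simp
  then have "x = 0 \<or> y = 0" using char_eval_inj[OF x] char_eval_inj[OF y] by blast
  then show "x = \<zero>\<^bsub>fusion_ring t \<Delta>\<^esub> \<or> y = \<zero>\<^bsub>fusion_ring t \<Delta>\<^esub>" by (simp add: fusion_ring_def)
qed

text \<open>\<open>summand\<close> wants \<open>v\<close> as the leading block, so the blocks before
  it are moved behind.\<close>

lemma summand_of_decomposition:
  assumes w: "comul w" and x: "comul x" "comul w'" "equivalent x (dsum w w')"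
    and vs: "\<forall>v\<in>set vs. irrep v" "equivalent w (diag_block_mat vs)" and v: "v \<in> set vs"
  shows "summand t \<Delta> v x"
proof -
  obtain as bs where ab: "vs = as @ [v] @ bs" using v by (metis append_Cons append_Nil split_list)
  define A B where "A = diag_block_mat as" and "B = diag_block_mat bs"
  have cm: "comul v" "comul A" "comul B"
    unfolding A_def B_def using vs(1) irrepD(4) ab by (auto intro!: comul_diag_block)
  define n k a b where "n = dim_row w'" and "k = dim_row v" and "a = dim_row A" and "b = dim_row B"
  have c: "w' \<in> carrier_mat n n" "v \<in> carrier_mat k k" "A \<in> carrier_mat a a" "B \<in> carrier_mat b b"
    unfolding n_def k_def a_def b_def by (fact comul_carrier[OF x(2)] cm[THEN comul_carrier])+
  have vB: "dsum v B \<in> carrier_mat (k + b) (k + b)" using c by simp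
  have diag: "diag_block_mat vs = dsum A (dsum v B)"
    unfolding ab diag_block_mat_append_dsum A_def B_def by (simp only: diag_block_mat_singleton)
  have dc: "dsum A (dsum v B) \<in> carrier_mat (a + (k + b)) (a + (k + b))" using c(3) vB by simp
  have dc': "dsum (dsum v B) A \<in> carrier_mat (a + (k + b)) (a + (k + b))"
    using dsum_carrier[OF vB c(3)] by (simp only: add.commute)
  have wc: "w \<in> carrier_mat (a + (k + b)) (a + (k + b))"
    using comul_carrier[OF w] unfolding equivalent_dim[OF vs(2)] diag carrier_matD(1)[OF dc] .
  have "equivalent w (dsum (dsum v B) A)"
    using equivalent_trans[OF vs(2)[unfolded diag] equivalent_dsum_swap[OF c(3) vB] wc dc dc'] .
  then have e: "equivalent (dsum w w') (dsum (dsum (dsum v B) A) w')"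
    by (rule equivalent_dsum[OF _ equivalent_refl[OF c(1)] wc dc' c(1) c(1)])
  have ww': "dsum w w' \<in> carrier_mat (a + (k + b) + n) (a + (k + b) + n)" using wc c(1) by simp
  have xc: "x \<in> carrier_mat (a + (k + b) + n) (a + (k + b) + n)"
    using comul_carrier[OF x(1)] unfolding equivalent_dim[OF x(3)] carrier_matD(1)[OF ww'] .
  have "dsum (dsum (dsum v B) A) w' \<in> carrier_mat (a + (k + b) + n) (a + (k + b) + n)"
    by (rule dsum_carrier[OF dc' c(1)])
  then have "equivalent x (dsum v (dsum B (dsum A w')))"
    using equivalent_trans[OF x(3) e xc ww'] unfolding dsum_assoc by blast
  moreover have "comul (dsum B (dsum A w'))" using cm x(2) comul_dsum by blast
  ultimately show ?thesis unfolding summand_def by blast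
qed

theorem weakly_irreducible_imp_connected:
  assumes dom: "weakly_irreducible_cqg t \<Delta>" shows "connected_cqg t \<Delta>"
  unfolding connected_cqg_def
proof (intro allI impI)
  fix u assume tors: "torsion_rep t \<Delta> u"
  define x where "x = dsum u (conjugate_rep u)"
  define S where "S = {cls v |v. irrep v \<and> (\<exists>n. summand t \<Delta> v (tpow x n))}"
  have u: "irrep u" and fin: "finite S" using tors unfolding torsion_rep_def S_def x_def by auto
  note ru = irrepD(1)[OF u] and cu = irrepD(4)[OF u]
  have cx: "comul x" unfolding x_def by (intro comul_dsum cu comul_conjugate)
  define X d where "X = chi u" and "d = int (dim_row u)"
  define P where "P n = fusion_class t \<Delta> (tpow u n)" for n
  have chi_tpow: "chi (tpow u n) = X ^ n" for n
  proof (induction n)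
    case 0 show ?case by (simp add: chi_def)
  next
    case (Suc n)
    then show ?case unfolding X_def
      using chi_tprod[OF repD(2)[OF rep_tpow[OF ru, of n]] irrepD(3)[OF u]] by (simp add: power_commutes)
  qed
  have dim_tpow: "int (dim_row (tpow u n)) = d ^ n" for n
    by (induction n) (simp_all add: d_def mult.commute)
  have P: "char_eval (P n) = X ^ n" "dim_eval (P n) = d ^ n" "Poly_Mapping.keys (P n) \<subseteq> irr_cls" for n
    unfolding P_def using fusion_class[OF rep_tpow[OF ru]] chi_tpow dim_tpow by simp_all
  \<comment> \<open>Constituents of \<open>u^n\<close> occur in the n-th power of
    \<open>u \<oplus> conjugate\<close>, so all \<open>P n\<close> are supported on the finite set
    \<open>S\<close>.\<close>
  have PS: "Poly_Mapping.keys (P n) \<subseteq> S" for n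
  proof -
    obtain vs where vs: "\<forall>v\<in>set vs. irrep v" "equivalent (tpow u n) (diag_block_mat vs)"
      using complete_reducibility[OF rep_tpow[OF ru]] by blast
    obtain w' where w': "comul w'" "equivalent (tpow x n) (dsum (tpow u n) w')"
      using tpow_summand[OF cu comul_conjugate[OF cu]] unfolding x_def by blast
    have "cls v \<in> S" if "v \<in> set vs" for v
      unfolding S_def
      using summand_of_decomposition[OF comul_tpow[OF cu] comul_tpow[OF cx] w' vs that] vs(1) that by blast
    then show ?thesis using fusion_class_decomposition(4)[OF rep_tpow[OF ru] vs] unfolding P_def by blast
  qed
  define ev where "ev p = int_poly_eval p X" for p
  \<comment> \<open>The value of \<open>p\<close> at the class of \<open>u\<close>; classes of
    tensor powers stand for powers in the fusion ring, which have the same characters.\<close>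
  define Z where "Z p = (\<Sum>i\<le>degree p. frag_cmul (coeff p i) (P i))" for p
  have Z: "char_eval (Z p) = ev p" "dim_eval (Z p) = poly p d" "Poly_Mapping.keys (Z p) \<subseteq> irr_cls" for p
  proof -
    show "char_eval (Z p) = ev p"
      unfolding Z_def ev_def int_poly_eval_def using P(1)
      unfolding char_eval_def frag_eval_sum frag_eval_cmul by simp
    show "dim_eval (Z p) = poly p d"
      unfolding Z_def poly_altdef using P(2)
      unfolding dim_eval_def frag_eval_sum frag_eval_cmul by simp
    have "Poly_Mapping.keys (Z p) \<subseteq> (\<Union>i\<in>{..degree p}. Poly_Mapping.keys (frag_cmul (coeff p i) (P i)))"
      unfolding Z_def by (rule Poly_Mapping.keys_sum)
    also have "\<dots> \<subseteq> irr_cls" using P(3) keys_cmul by blast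
    finally show "Poly_Mapping.keys (Z p) \<subseteq> irr_cls" .
  qed
  have "\<exists>p. p \<noteq> 0 \<and> ev p = 0"
  proof -
    \<comment> \<open>The \<open>card S + 1\<close> classes \<open>P 0\<close> to
      \<open>P (card S)\<close> lie in a group of rank \<open>card S\<close>.\<close>
    obtain c where c: "\<exists>j\<in>{..card S}. c j \<noteq> 0" "\<forall>s\<in>S. (\<Sum>j\<le>card S. c j * Poly_Mapping.lookup (P j) s) = 0"
      using integer_relation[OF fin, of "{..card S}" "\<lambda>j. Poly_Mapping.lookup (P j)"] by auto
    define p where "p = (\<Sum>j\<le>card S. monom (c j) j)"
    have cp: "coeff p i = (if i \<le> card S then c i else 0)" for i
      unfolding p_def by (simp add: coeff_sum if_distrib cong: if_cong)
    have deg: "degree p \<le> card S" by (rule degree_le) (simp add: cp)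
    have "(\<Sum>j\<le>card S. frag_cmul (c j) (P j)) = 0"
    proof (rule poly_mapping_eqI)
      fix s
      show "Poly_Mapping.lookup (\<Sum>j\<le>card S. frag_cmul (c j) (P j)) s = Poly_Mapping.lookup 0 s"
      proof (cases "s \<in> S")
        case True
        then show ?thesis using c(2) by (simp add: Poly_Mapping.lookup_sum)
      next
        case False
        then have "Poly_Mapping.lookup (P j) s = 0" for j using PS[of j] by (meson in_keys_iff subsetD)
        then show ?thesis by (simp add: Poly_Mapping.lookup_sum)
      qed
    qed
    then have "0 = char_eval (\<Sum>j\<le>card S. frag_cmul (c j) (P j))" by (simp add: char_eval_def)
    also have "\<dots> = (\<Sum>j\<le>card S. of_int (c j) * X ^ j)"
      using P(1) unfolding char_eval_def frag_eval_sum frag_eval_cmul by simp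
    also have "\<dots> = ev p" unfolding ev_def int_poly_eval_bound[OF deg] by (simp add: cp)
    finally have "ev p = 0" by simp
    moreover have "p \<noteq> 0" using c(1) cp by (metis atMost_iff coeff_0)
    ultimately show ?thesis by blast
  qed
  then obtain p0 where p0: "p0 \<noteq> 0 \<and> ev p0 = 0" by blast
  obtain p where "(p \<noteq> 0 \<and> ev p = 0) \<and> (\<forall>q. (q \<noteq> 0 \<and> ev q = 0) \<longrightarrow> degree p \<le> degree q)"
    using ex_has_least_nat[of "\<lambda>p. p \<noteq> 0 \<and> ev p = 0" p0 degree, OF p0] by (rule exE)
  then have p: "p \<noteq> 0" "ev p = 0" and min: "\<And>q. q \<noteq> 0 \<Longrightarrow> ev q = 0 \<Longrightarrow> degree p \<le> degree q"
    by simp_all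
  \<comment> \<open>The dimension lives on formal sums, so the relation between characters is first
    lifted by injectivity.\<close>
  have "Z p = 0" using char_eval_inj[OF Z(3)] Z(1) p(2) by simp
  then have "poly p d = 0" using Z(2)[of p] by (simp add: dim_eval_def)
  then obtain q where q: "p = [:- d, 1:] * q" using poly_eq_0_iff_dvd by blast
  have q0: "q \<noteq> 0" using p(1) q by auto
  then have "degree p = Suc (degree q)" unfolding q by (subst degree_mult_eq) auto
  then have evq: "ev q \<noteq> 0" using min[OF q0] by auto
  define y where "y = frag_of (cls u) - frag_cmul d (frag_of (cls (1\<^sub>m 1)))"
  have y1: "char_eval (frag_of (cls u)) = X" "Poly_Mapping.keys (frag_of (cls u)) \<subseteq> irr_cls"
    using sum_list_classes(2)[of "[u]"] u cls_mem[OF u] unfolding X_def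
    by (simp_all only: list.map sum_list.Cons sum_list.Nil diag_block_mat_singleton add_0_right list.set
      ball_simps keys_frag_of) simp_all
  have y: "char_eval y = X - of_int d" "Poly_Mapping.keys y \<subseteq> irr_cls"
  proof -
    show "char_eval y = X - of_int d"
      using y1(1) char_eval_one unfolding y_def char_eval_def frag_eval_diff frag_eval_cmul by simp
    show "Poly_Mapping.keys y \<subseteq> irr_cls"
      unfolding y_def using y1(2) keys_one keys_cmul by (meson Un_least keys_diff order_trans)
  qed
  have "char_eval (fus y (Z q)) = ev p"
    unfolding fusion_mult(1)[OF y(2) Z(3)] y(1) Z(1) unfolding ev_def q int_poly_eval_linear_factor ..
  then have "fus y (Z q) = 0" using p(2) char_eval_inj[OF fusion_mult(3)[OF y(2) Z(3)]] by simp
  then have "y = 0 \<or> Z q = 0"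
    using dom y(2) Z(3)[of q]
    unfolding weakly_irreducible_cqg_def nc_domain_def fusion_ring_def by simp
  moreover have "Z q \<noteq> 0" using Z(1)[of q] evq by (auto simp: char_eval_def)
  ultimately have "y = 0" by blast
  \<comment> \<open>The left side is 1; the right side is 0 unless \<open>u\<close> and the trivial
    representation have the same class.\<close>
  then have "Poly_Mapping.lookup (frag_of (cls u)) (cls u) = Poly_Mapping.lookup (frag_cmul d (frag_of (cls (1\<^sub>m 1)))) (cls u)"
    unfolding y_def by simp
  then have "cls u = cls (1\<^sub>m 1)" by (simp split: if_splits)
  then show "equivalent u (1\<^sub>m 1)" using class_eq_iff[OF u irrep_one] by simp
qed

end

theorem theorem4p7:
  fixes t :: "'q::cstar_algebra \<Rightarrow> 'q \<Rightarrow> 't::cstar_algebra"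
    and tl :: "'t \<Rightarrow> 'q \<Rightarrow> 'w::cstar_algebra"
    and tr :: "'q \<Rightarrow> 't \<Rightarrow> 'w"
    and \<Delta> :: "'q \<Rightarrow> 't"
  assumes "compact_quantum_group t tl tr \<Delta>"
  shows "(irreducible_cqg t \<Delta> \<longrightarrow> weakly_irreducible_cqg t \<Delta>) \<and>
         (weakly_irreducible_cqg t \<Delta> \<longrightarrow> connected_cqg t \<Delta>)"
  using compact_quantum_group.irreducible_imp_weakly_irreducible[OF assms]
    compact_quantum_group.weakly_irreducible_imp_connected[OF assms] by blast

end
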